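(* Let $\mathbb{K}$ be a subfield of $\mathbb{C}$, $p\ge1$, and $A_1,\dots,A_p,n_1,\dots,n_p,r_1,\dots,r_p$ non-negative integers. Let $P\in\mathbb{K}[k_1,\dots,k_p]$ satisfy $\sum_{i=1}^j\deg_{k_i}P\le\big(\sum_{i=1}^jA_i(n_i+1)\big)-j-1$ for every $j\in\{1,\dots,p\}$, let $R=P/\prod_{i=1}^p(k_i+r_i)_{n_i+1}^{A_i}$ and $S=\sum_{k_1\ge\dots\ge k_p\ge1}R(k_1,\dots,k_p)$. Let $H$ be a subgroup of $G$ and $\chi:H\to\mathbb{C}^*$ a group homomorphism such that $\varrho(g)(R)=\chi(g)R$ for every $g\in H$. Then there exist an admissible representation $(\lambda[s_1,\dots,s_q])$ of $S$ and an element $x\in W'_{\mathbb{K}}$ such that $\tilde\varrho(g)(x)=\chi(g)x$ for every $g\in H$ and $$\sum_{s_1,\dots,s_p}\lambda[s_1,\dots,s_p]\,\zeta(s_1,\dots,s_p)=\varphi(x).$$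
   Context: $(k)_\alpha=k(k+1)\cdots(k+\alpha-1)$; $\zeta(s_1,\dots,s_q)=\sum_{k_1>\dots>k_q\ge1}k_1^{-s_1}\cdots k_q^{-s_q}$ ($s_1\ge2$), $\zeta(\emptyset)=1$. Admissible representation of $S$: coefficients $\lambda[s_1,\dots,s_q]\in\mathbb{K}$, indexed by tuples of positive integers with $0\le q\le p$ and $s_1\ge2$ when $q\ge1$, finitely many nonzero, with $S=\sum\lambda[s_1,\dots,s_q]\zeta(s_1,\dots,s_q)$, such that whenever $\lambda[s_1,\dots,s_q]\ne0$, $q\ge1$: (a) there exist $1=\ell_0<\dots<\ell_q=p+1$ with $s_j\le A_{\ell_{j-1}}+\dots+A_{\ell_j-1}$ for all $j$; (b) if $r_i\ge r_{i+1}+n_{i+1}+1$ for all $i\le p-1$, there exist $1\le i_1<\dots<i_q\le p$ with $1\le s_\ell\le A_{i_\ell}$ for all $\ell$, and the number of $\ell$ with $s_\ell=1$ is at most the number of $i$ with $\deg_{k_i}P\ge A_i(n_i+1)-1$. Group: $G=(\mathbb{Z}/2\mathbb{Z})^p\rtimes\mathfrak{S}_p$ with $\mathbb{Z}/2\mathbb{Z}=\{-1,1\}$ multiplicatively, elements $(\varepsilon_1,\dots,\varepsilon_p,\gamma)$, law $(\underline\varepsilon,\gamma)(\underline\varepsilon',\gamma')=(\varepsilon_1\varepsilon'_{\gamma^{-1}(1)},\dots,\varepsilon_p\varepsilon'_{\gamma^{-1}(p)},\gamma\gamma')$. Set $K_i=k_i+r_i+\frac{n_i}{2}$ and view rational functions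 of $k_1,\dots,k_p$ as functions of $K_1,\dots,K_p$. $\varrho(\varepsilon_1,\dots,\varepsilon_p,\gamma)$ sends a rational function $R(K_1,\dots,K_p)$ to $R(\varepsilon_{\gamma(1)}K_{\gamma(1)},\dots,\varepsilon_{\gamma(p)}K_{\gamma(p)})$. $W_{\mathbb{K}}$ is the $\mathbb{K}$-vector space with basis the formal symbols $\zeta_f(s_1,\dots,s_p)$, $s_i\ge1$ integers; $W'_{\mathbb{K}}$ is the subspace spanned by those with $s_1\ge2$; $\varphi:W'_{\mathbb{K}}\to\mathbb{C}$ is the $\mathbb{K}$-linear map $\zeta_f(s_1,\dots,s_p)\mapsto\zeta(s_1,\dots,s_p)$. $\tilde\varrho(\varepsilon_1,\dots,\varepsilon_p,\gamma)$ is the $\mathbb{K}$-linear map of $W_{\mathbb{K}}$ with $\zeta_f(s_1,\dots,s_p)\mapsto\varepsilon_1^{s_{\gamma^{-1}(1)}}\cdots\varepsilon_p^{s_{\gamma^{-1}(p)}}\zeta_f(s_{\gamma^{-1}(1)},\dots,s_{\gamma^{-1}(p)})$. *)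

theory Defs
  imports
    "HOL-Analysis.Analysis"
    "HOL-Library.Poly_Mapping"
    "HOL-Computational_Algebra.Fraction_Field"
    "HOL-Algebra.Multiplicative_Group"
    "HOL-Algebra.Sym_Groups"
    "HOL-Algebra.Algebraic_Closure_Type"
begin

section \<open>Polynomials and rational functions in several variables\<close>

text \<open>
  Polynomials over the complex numbers in variables indexed by the natural numbers: a monomial is a
  finitely supported exponent vector, and multiplication is the convolution product of
  \<^theory>\<open>HOL-Library.Poly_Mapping\<close>. Only the variables with index in \<open>{1..p}\<close> will be used.
\<close>

type_synonym cpoly = "(nat \<Rightarrow>\<^sub>0 nat) \<Rightarrow>\<^sub>0 complex"
type_synonym ratfun = "cpoly fract"

definition PConst :: "complex \<Rightarrow> cpoly" where
  "PConst c = Poly_Mapping.single 0 c"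

definition PVar :: "nat \<Rightarrow> cpoly" where
  "PVar i = Poly_Mapping.single (Poly_Mapping.single i 1) 1"

definition polys_over :: "complex set \<Rightarrow> nat \<Rightarrow> cpoly set" where
  "polys_over K p = {f. \<forall>m. Poly_Mapping.lookup f m \<in> K \<and>
     (m \<in> Poly_Mapping.keys f \<longrightarrow> Poly_Mapping.keys m \<subseteq> {1..p})}"

text \<open>The degree in one variable; it is \<open>-\<infinity>\<close> for the zero polynomial (supremum of the empty set).\<close>

definition deg_in :: "nat \<Rightarrow> cpoly \<Rightarrow> ereal" where
  "deg_in i f = (SUP m\<in>Poly_Mapping.keys f. ereal (real (Poly_Mapping.lookup m i)))"

text \<open>Evaluation at \<open>x\<close>, the coefficients being mapped by \<open>c\<close>.\<close>

definition poly_eval :: "(complex \<Rightarrow> 'b::comm_ring_1) \<Rightarrow> (nat \<Rightarrow> 'b) \<Rightarrow> cpoly \<Rightarrow> 'b" where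
  "poly_eval c x f = (\<Sum>m\<in>Poly_Mapping.keys f. c (Poly_Mapping.lookup f m) *
      (\<Prod>i\<in>Poly_Mapping.keys m. x i ^ Poly_Mapping.lookup m i))"

abbreviation poly_value :: "(nat \<Rightarrow> complex) \<Rightarrow> cpoly \<Rightarrow> complex" where
  "poly_value \<equiv> poly_eval (\<lambda>c. c)"

abbreviation poly_subst :: "(nat \<Rightarrow> cpoly) \<Rightarrow> cpoly \<Rightarrow> cpoly" where
  "poly_subst \<equiv> poly_eval PConst"

text \<open>
  The value of a rational function at a point where some representation has a nonvanishing
  denominator; see \<open>ratfun_value_Fract\<close>.
\<close>

definition ratfun_value :: "(nat \<Rightarrow> complex) \<Rightarrow> ratfun \<Rightarrow> complex" where
  "ratfun_value x R = (THE v. \<exists>a b. R = Fract a b \<and> poly_value x b \<noteq> 0 \<and>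
     v = poly_value x a / poly_value x b)"

lemma poly_eval_superset:
  assumes "finite M" "Poly_Mapping.keys f \<subseteq> M" "c 0 = 0"
  shows "poly_eval c x f = (\<Sum>m\<in>M. c (Poly_Mapping.lookup f m) *
      (\<Prod>i\<in>Poly_Mapping.keys m. x i ^ Poly_Mapping.lookup m i))"
  unfolding poly_eval_def
  by (rule sum.mono_neutral_left) (use assms in \<open>auto simp: in_keys_iff\<close>)

lemma monom_eval_superset:
  fixes x :: "nat \<Rightarrow> 'b::comm_ring_1"
  assumes "finite I" "Poly_Mapping.keys m \<subseteq> I"
  shows "(\<Prod>i\<in>Poly_Mapping.keys m. x i ^ Poly_Mapping.lookup m i) =
    (\<Prod>i\<in>I. x i ^ Poly_Mapping.lookup m i)"
  by (rule prod.mono_neutral_left) (use assms in \<open>auto simp: in_keys_iff\<close>)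

lemma monom_eval_add:
  fixes x :: "nat \<Rightarrow> 'b::comm_ring_1"
  shows "(\<Prod>i\<in>Poly_Mapping.keys (m + m'). x i ^ Poly_Mapping.lookup (m + m') i) =
    (\<Prod>i\<in>Poly_Mapping.keys m. x i ^ Poly_Mapping.lookup m i) *
    (\<Prod>i\<in>Poly_Mapping.keys m'. x i ^ Poly_Mapping.lookup m' i)"
proof -
  let ?I = "Poly_Mapping.keys m \<union> Poly_Mapping.keys m'"
  have fin: "finite ?I" by simp
  have sub: "Poly_Mapping.keys (m + m') \<subseteq> ?I" by (rule keys_add)
  show ?thesis
    unfolding monom_eval_superset[OF fin sub]
      monom_eval_superset[OF fin Un_upper1] monom_eval_superset[OF fin Un_upper2]
    by (simp add: lookup_add power_add prod.distrib)
qed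

lemma poly_eval_single:
  assumes "c 0 = 0"
  shows "poly_eval c x (Poly_Mapping.single m a) =
    c a * (\<Prod>i\<in>Poly_Mapping.keys m. x i ^ Poly_Mapping.lookup m i)"
  using poly_eval_superset[of "{m}" "Poly_Mapping.single m a" c x] assms by simp

lemma poly_eval_add:
  assumes "c 0 = 0" "\<And>a b. c (a + b) = c a + c b"
  shows "poly_eval c x (f + g) = poly_eval c x f + poly_eval c x g"
proof -
  let ?M = "Poly_Mapping.keys f \<union> Poly_Mapping.keys g"
  have fin: "finite ?M" by simp
  have sub: "Poly_Mapping.keys (f + g) \<subseteq> ?M" by (rule keys_add)
  show ?thesis
    unfolding poly_eval_superset[where c = c, OF fin sub assms(1)]
      poly_eval_superset[where c = c, OF fin Un_upper1 assms(1)]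
      poly_eval_superset[where c = c, OF fin Un_upper2 assms(1)]
    by (simp add: lookup_add assms(2) distrib_right sum.distrib)
qed

lemma poly_eval_0 [simp]: "poly_eval c x 0 = 0"
  by (simp add: poly_eval_def)

lemma poly_eval_sum:
  assumes "c 0 = 0" "\<And>a b. c (a + b) = c a + c b"
  shows "poly_eval c x (\<Sum>j\<in>J. f j) = (\<Sum>j\<in>J. poly_eval c x (f j))"
  by (induction J rule: infinite_finite_induct) (simp_all add: poly_eval_add[of c, OF assms])

lemma cpoly_expand:
  fixes f :: cpoly
  shows "f = (\<Sum>m\<in>Poly_Mapping.keys f. Poly_Mapping.single m (Poly_Mapping.lookup f m))"
  by (rule poly_mapping_eqI)
    (auto simp: lookup_sum lookup_single when_def sum.delta in_keys_iff)

lemma poly_eval_mult: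
  assumes c: "c 0 = 0" "\<And>a b. c (a + b) = c a + c b" "\<And>a b. c (a * b) = c a * c b"
  shows "poly_eval c x (f * g) = poly_eval c x f * poly_eval c x g"
proof -
  let ?F = "\<lambda>f m. Poly_Mapping.single m (Poly_Mapping.lookup f m)"
  have ss: "poly_eval c x (Poly_Mapping.single m a * Poly_Mapping.single m' a') =
      poly_eval c x (Poly_Mapping.single m a) * poly_eval c x (Poly_Mapping.single m' a')"
    for m a m' a'
    by (simp add: mult_single poly_eval_single c monom_eval_add mult_ac)
  have "f * g = (\<Sum>m\<in>Poly_Mapping.keys f. \<Sum>m'\<in>Poly_Mapping.keys g. ?F f m * ?F g m')"
    by (subst (1) cpoly_expand[of f], subst (1) cpoly_expand[of g]) (rule sum_product)
  then have "poly_eval c x (f * g) =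
      (\<Sum>m\<in>Poly_Mapping.keys f. \<Sum>m'\<in>Poly_Mapping.keys g.
        poly_eval c x (?F f m) * poly_eval c x (?F g m'))"
    by (simp only: poly_eval_sum[of c, OF c(1,2)] ss)
  also have "\<dots> = (\<Sum>m\<in>Poly_Mapping.keys f. poly_eval c x (?F f m)) *
      (\<Sum>m'\<in>Poly_Mapping.keys g. poly_eval c x (?F g m'))"
    by (rule sum_product[symmetric])
  also have "\<dots> = poly_eval c x f * poly_eval c x g"
    by (simp only: poly_eval_sum[of c, OF c(1,2), symmetric] cpoly_expand[symmetric])
  finally show ?thesis .
qed

lemma PConst_hom [simp]:
  "PConst 0 = 0" "PConst 1 = 1" "PConst (a + b) = PConst a + PConst b"
  "PConst (a * b) = PConst a * PConst b"
  by (simp_all add: PConst_def single_add mult_single)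

lemma poly_value_add: "poly_value x (f + g) = poly_value x f + poly_value x g"
  by (rule poly_eval_add) simp_all

lemma poly_value_mult: "poly_value x (f * g) = poly_value x f * poly_value x g"
  by (rule poly_eval_mult) simp_all

lemma poly_subst_add: "poly_subst x (f + g) = poly_subst x f + poly_subst x g"
  by (rule poly_eval_add) simp_all

lemma poly_subst_mult: "poly_subst x (f * g) = poly_subst x f * poly_subst x g"
  by (rule poly_eval_mult) simp_all

lemma poly_subst_PConst [simp]: "poly_subst x (PConst a) = PConst a"
  using poly_eval_single[of PConst x 0 a] by (simp add: PConst_def)

lemma poly_subst_PVar [simp]: "poly_subst x (PVar i) = x i"
  using poly_eval_single[of PConst x "Poly_Mapping.single i 1" 1] by (simp add: PVar_def)

lemma poly_subst_power: "poly_subst x (f ^ k) = poly_subst x f ^ k"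
  using poly_subst_PConst[of x 1] by (induction k) (simp_all add: poly_subst_mult)

lemma poly_subst_prod: "poly_subst x (\<Prod>j\<in>J. f j) = (\<Prod>j\<in>J. poly_subst x (f j))"
  using poly_subst_PConst[of x 1]
  by (induction J rule: infinite_finite_induct) (simp_all add: poly_subst_mult)

lemma poly_subst_sum: "poly_subst x (\<Sum>j\<in>J. f j) = (\<Sum>j\<in>J. poly_subst x (f j))"
  by (rule poly_eval_sum) simp_all

lemma poly_subst_subst:
  "poly_subst y (poly_subst x f) = poly_subst (\<lambda>i. poly_subst y (x i)) f"
proof -
  have "poly_subst y (poly_subst x f) = poly_subst y (\<Sum>m\<in>Poly_Mapping.keys f.
      PConst (Poly_Mapping.lookup f m) *
      (\<Prod>i\<in>Poly_Mapping.keys m. x i ^ Poly_Mapping.lookup m i))"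
    by (simp only: poly_eval_def[of PConst x f])
  also have "\<dots> = poly_subst (\<lambda>i. poly_subst y (x i)) f"
    by (simp only: poly_subst_sum poly_subst_mult poly_subst_prod poly_subst_power
        poly_subst_PConst poly_eval_def[of PConst "\<lambda>i. poly_subst y (x i)" f])
  finally show ?thesis .
qed

lemma PVar_power: "PVar i ^ k = Poly_Mapping.single (Poly_Mapping.single i k) 1"
  by (induction k) (simp_all add: PVar_def mult_single flip: single_add)

lemma prod_single_one:
  "finite J \<Longrightarrow> (\<Prod>j\<in>J. Poly_Mapping.single (f j) 1 :: cpoly) = Poly_Mapping.single (sum f J) 1"
  by (induction J rule: finite_induct) (simp_all add: mult_single)

lemma poly_subst_id: "poly_subst PVar f = f"
proof -
  have monom: "(\<Sum>i\<in>Poly_Mapping.keys m. Poly_Mapping.single i (Poly_Mapping.lookup m i)) = m"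
    for m :: "nat \<Rightarrow>\<^sub>0 nat"
    by (rule poly_mapping_eqI)
      (auto simp: lookup_sum lookup_single when_def sum.delta in_keys_iff)
  have "poly_subst PVar f =
      (\<Sum>m\<in>Poly_Mapping.keys f. Poly_Mapping.single m (Poly_Mapping.lookup f m))"
    unfolding poly_eval_def
    by (intro sum.cong refl)
      (simp add: PVar_power prod_single_one monom PConst_def mult_single)
  then show ?thesis
    using cpoly_expand[of f] by simp
qed

lemma ratfun_value_Fract:
  assumes "poly_value x b \<noteq> 0"
  shows "ratfun_value x (Fract a b) = poly_value x a / poly_value x b"
  unfolding ratfun_value_def
proof (rule the_equality)
  show "\<exists>a' b'. Fract a b = Fract a' b' \<and> poly_value x b' \<noteq> 0 \<and>
      poly_value x a / poly_value x b = poly_value x a' / poly_value x b'"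
    using assms by blast
next
  fix v assume "\<exists>a' b'. Fract a b = Fract a' b' \<and> poly_value x b' \<noteq> 0 \<and>
      v = poly_value x a' / poly_value x b'"
  then obtain a' b' where *: "Fract a b = Fract a' b'" "poly_value x b' \<noteq> 0"
    "v = poly_value x a' / poly_value x b'" by blast
  have "b \<noteq> 0" "b' \<noteq> 0" using assms *(2) by auto
  then have "a * b' = a' * b" using *(1) by (simp add: eq_fract)
  then have "poly_value x a * poly_value x b' = poly_value x a' * poly_value x b"
    by (metis poly_value_mult)
  then show "v = poly_value x a / poly_value x b"
    using assms *(2,3) by (simp add: frac_eq_eq)
qed


section \<open>The rational function \<open>R\<close> and its sum\<close>

definition ser_denom :: "nat \<Rightarrow> (nat \<Rightarrow> nat) \<Rightarrow> (nat \<Rightarrow> nat) \<Rightarrow> (nat \<Rightarrow> nat) \<Rightarrow> cpoly" where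
  "ser_denom p A n r = (\<Prod>i=1..p. pochhammer (PVar i + of_nat (r i)) (n i + 1) ^ A i)"

text \<open>
  Tuples are lists, so that the \<open>i\<close>-th entry (counted from 1) of \<open>k\<close> is \<open>k ! (i - 1)\<close>.
\<close>

definition weak_chains :: "nat \<Rightarrow> nat list set" where
  "weak_chains p = {k. length k = p \<and> sorted_wrt (\<ge>) k \<and> 0 \<notin> set k}"

definition ser_term :: "ratfun \<Rightarrow> nat list \<Rightarrow> complex" where
  "ser_term R k = ratfun_value (\<lambda>i. of_nat (k ! (i - 1))) R"


section \<open>Multiple zeta values and admissible representations\<close>

definition strict_chains :: "nat \<Rightarrow> nat list set" where
  "strict_chains q = {k. length k = q \<and> sorted_wrt (>) k \<and> 0 \<notin> set k}"

text \<open>For the empty list this is the sum of the empty product over \<open>{[]}\<close>, that is, 1.\<close>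

definition mzv :: "nat list \<Rightarrow> complex" where
  "mzv s = (\<Sum>\<^sub>\<infinity>k\<in>strict_chains (length s). \<Prod>j<length s. 1 / of_nat (k ! j) ^ (s ! j))"

lemma mzv_Nil: "mzv [] = 1"
proof -
  have "strict_chains 0 = {[]}" by (auto simp: strict_chains_def)
  then show ?thesis by (simp add: mzv_def)
qed

definition mzv_indices :: "nat \<Rightarrow> nat list set" where
  "mzv_indices p = {s. length s \<le> p \<and> 0 \<notin> set s \<and> (s \<noteq> [] \<longrightarrow> s ! 0 \<ge> 2)}"

definition block_bound :: "nat \<Rightarrow> (nat \<Rightarrow> nat) \<Rightarrow> nat list \<Rightarrow> bool" where
  "block_bound p A s \<longleftrightarrow> (let q = length s in
     \<exists>l::nat \<Rightarrow> nat. l 0 = 1 \<and> l q = p + 1 \<and> (\<forall>j\<in>{1..q}. l (j - 1) < l j) \<and>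
       (\<forall>j\<in>{1..q}. s ! (j - 1) \<le> (\<Sum>i=l (j - 1)..l j - 1. A i)))"

definition separated_bound :: "nat \<Rightarrow> (nat \<Rightarrow> nat) \<Rightarrow> (nat \<Rightarrow> nat) \<Rightarrow> cpoly \<Rightarrow> nat list \<Rightarrow> bool" where
  "separated_bound p A n P s \<longleftrightarrow> (let q = length s in
     (\<exists>i::nat \<Rightarrow> nat. strict_mono_on {1..q} i \<and> i ` {1..q} \<subseteq> {1..p} \<and>
       (\<forall>l\<in>{1..q}. 1 \<le> s ! (l - 1) \<and> s ! (l - 1) \<le> A (i l))) \<and>
     card {l\<in>{1..q}. s ! (l - 1) = 1}
       \<le> card {i\<in>{1..p}. deg_in i P \<ge> ereal (real (A i) * (real (n i) + 1) - 1)})"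

definition admissible_rep :: "complex set \<Rightarrow> nat \<Rightarrow> (nat \<Rightarrow> nat) \<Rightarrow> (nat \<Rightarrow> nat) \<Rightarrow> (nat \<Rightarrow> nat) \<Rightarrow>
    cpoly \<Rightarrow> complex \<Rightarrow> (nat list \<Rightarrow> complex) \<Rightarrow> bool" where
  "admissible_rep K p A n r P S lam \<longleftrightarrow>
     (\<forall>s. lam s \<in> K) \<and>
     finite {s. lam s \<noteq> 0} \<and> {s. lam s \<noteq> 0} \<subseteq> mzv_indices p \<and>
     S = (\<Sum>s | lam s \<noteq> 0. lam s * mzv s) \<and>
     (\<forall>s. lam s \<noteq> 0 \<and> s \<noteq> [] \<longrightarrow>
        block_bound p A s \<and>
        ((\<forall>i. 1 \<le> i \<and> i \<le> p - 1 \<longrightarrow> r i \<ge> r (i + 1) + n (i + 1) + 1) \<longrightarrow>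
           separated_bound p A n P s))"


section \<open>The group \<open>G\<close> and its action on rational functions\<close>

definition signed_perm_group :: "nat \<Rightarrow> ((nat \<Rightarrow> int) \<times> (nat \<Rightarrow> nat)) monoid" where
  "signed_perm_group p =
     \<lparr>carrier = ({1..p} \<rightarrow>\<^sub>E {-1, 1}) \<times> carrier (sym_group p),
      mult = (\<lambda>(e, g) (e', g'). (\<lambda>i\<in>{1..p}. e i * e' (Hilbert_Choice.inv g i), g \<circ> g')),
      one = (\<lambda>i\<in>{1..p}. 1, id)\<rparr>"

lemma signed_perm_group_is_group: "group (signed_perm_group p)"
proof (rule groupI)
  fix x y assume "x \<in> carrier (signed_perm_group p)" "y \<in> carrier (signed_perm_group p)"
  then obtain e g e' g' where xy: "x = (e, g)" "y = (e', g')"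
    "e \<in> {1..p} \<rightarrow>\<^sub>E {-1, 1}" "e' \<in> {1..p} \<rightarrow>\<^sub>E {-1, 1}" "g permutes {1..p}" "g' permutes {1..p}"
    by (auto simp: signed_perm_group_def sym_group_carrier)
  have "e i * e' (Hilbert_Choice.inv g i) \<in> {-1, 1}" if "i \<in> {1..p}" for i
  proof -
    have "Hilbert_Choice.inv g i \<in> {1..p}"
      using that permutes_in_image[OF permutes_inv[OF xy(5)]] by blast
    then have "e i \<in> {-1, 1}" "e' (Hilbert_Choice.inv g i) \<in> {-1, 1}"
      using xy that by (auto simp: PiE_def Pi_def)
    then show ?thesis by auto
  qed
  then show "x \<otimes>\<^bsub>signed_perm_group p\<^esub> y \<in> carrier (signed_perm_group p)"
    using xy by (auto simp: signed_perm_group_def sym_group_carrier permutes_compose)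
next
  show "\<one>\<^bsub>signed_perm_group p\<^esub> \<in> carrier (signed_perm_group p)"
    by (auto simp: signed_perm_group_def sym_group_carrier permutes_id)
next
  fix x y z assume "x \<in> carrier (signed_perm_group p)" "y \<in> carrier (signed_perm_group p)"
    "z \<in> carrier (signed_perm_group p)"
  then obtain e g e' g' e'' g'' where xyz: "x = (e, g)" "y = (e', g')" "z = (e'', g'')"
    "g permutes {1..p}" "g' permutes {1..p}"
    by (auto simp: signed_perm_group_def sym_group_carrier)
  have inv: "Hilbert_Choice.inv (g \<circ> g') i = Hilbert_Choice.inv g' (Hilbert_Choice.inv g i)" for i
    using xyz by (simp add: o_inv_distrib permutes_bij)
  have "Hilbert_Choice.inv g i \<in> {1..p}" if "i \<in> {1..p}" for i
    using that permutes_in_image[OF permutes_inv[OF xyz(4)]] by blast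
  then show "x \<otimes>\<^bsub>signed_perm_group p\<^esub> y \<otimes>\<^bsub>signed_perm_group p\<^esub> z =
      x \<otimes>\<^bsub>signed_perm_group p\<^esub> (y \<otimes>\<^bsub>signed_perm_group p\<^esub> z)"
    unfolding signed_perm_group_def xyz
    by (simp add: inv comp_assoc restrict_def fun_eq_iff mult.assoc)
next
  fix x assume "x \<in> carrier (signed_perm_group p)"
  then show "\<one>\<^bsub>signed_perm_group p\<^esub> \<otimes>\<^bsub>signed_perm_group p\<^esub> x = x"
    by (auto simp: signed_perm_group_def fun_eq_iff PiE_def extensional_def)
next
  fix x assume "x \<in> carrier (signed_perm_group p)"
  then obtain e g where x: "x = (e, g)" "e \<in> {1..p} \<rightarrow>\<^sub>E {-1, 1}" "g permutes {1..p}"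
    by (auto simp: signed_perm_group_def sym_group_carrier)
  define y where "y = (\<lambda>i\<in>{1..p}. e (g i), Hilbert_Choice.inv g)"
  have gi: "g i \<in> {1..p} \<longleftrightarrow> i \<in> {1..p}" for i by (rule permutes_in_image[OF x(3)])
  have ee: "e i * e i = 1" "e i \<in> {-1, 1}" if "i \<in> {1..p}" for i
    using x(2) that by (auto simp: PiE_def Pi_def)
  have ii: "Hilbert_Choice.inv (Hilbert_Choice.inv g) = g"
    using permutes_inv_inv[OF x(3)] .
  have "y \<in> carrier (signed_perm_group p)"
    unfolding y_def signed_perm_group_def
    using ee(2) gi permutes_inv[OF x(3)] by (auto simp: sym_group_carrier)
  moreover have "y \<otimes>\<^bsub>signed_perm_group p\<^esub> x = \<one>\<^bsub>signed_perm_group p\<^esub>"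
    unfolding y_def signed_perm_group_def x(1)
    using ee(1) gi permutes_inv_o(2)[OF x(3)] by (simp add: ii restrict_def fun_eq_iff)
  ultimately show "\<exists>y\<in>carrier (signed_perm_group p).
      y \<otimes>\<^bsub>signed_perm_group p\<^esub> x = \<one>\<^bsub>signed_perm_group p\<^esub>" by blast
qed

text \<open>
  With \<open>K\<^sub>i = k\<^sub>i + c\<^sub>i\<close>, \<open>c\<^sub>i = r\<^sub>i + n\<^sub>i/2\<close>, replacing \<open>K\<^sub>i\<close> by \<open>e\<^sub>g\<^sub>(\<^sub>i\<^sub>) K\<^sub>g\<^sub>(\<^sub>i\<^sub>)\<close> for all \<open>i\<close> means replacing
  \<open>k\<^sub>i\<close> by \<open>e\<^sub>g\<^sub>(\<^sub>i\<^sub>) (k\<^sub>g\<^sub>(\<^sub>i\<^sub>) + c\<^sub>g\<^sub>(\<^sub>i\<^sub>)) - c\<^sub>i\<close>.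
\<close>

definition Kshift :: "(nat \<Rightarrow> nat) \<Rightarrow> (nat \<Rightarrow> nat) \<Rightarrow> nat \<Rightarrow> cpoly" where
  "Kshift n r i = PConst (of_nat (r i) + of_nat (n i) / 2)"

definition rho_subst :: "nat \<Rightarrow> (nat \<Rightarrow> nat) \<Rightarrow> (nat \<Rightarrow> nat) \<Rightarrow>
    (nat \<Rightarrow> int) \<times> (nat \<Rightarrow> nat) \<Rightarrow> nat \<Rightarrow> cpoly" where
  "rho_subst p n r = (\<lambda>(e, g) i.
     if i \<in> {1..p} then of_int (e (g i)) * (PVar (g i) + Kshift n r (g i)) - Kshift n r i
     else PVar i)"

text \<open>
  On a fraction the substitution acts on numerator and denominator; independence of the chosen
  fraction is \<open>rho_Fract\<close>.
\<close>

definition rho :: "nat \<Rightarrow> (nat \<Rightarrow> nat) \<Rightarrow> (nat \<Rightarrow> nat) \<Rightarrow>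
    (nat \<Rightarrow> int) \<times> (nat \<Rightarrow> nat) \<Rightarrow> ratfun \<Rightarrow> ratfun" where
  "rho p n r h R = (THE R'. \<exists>a b. b \<noteq> 0 \<and> R = Fract a b \<and>
     R' = Fract (poly_subst (rho_subst p n r h) a) (poly_subst (rho_subst p n r h) b))"

lemma poly_subst_rho_subst_eq_0:
  assumes h: "h \<in> carrier (signed_perm_group p)" and f: "poly_subst (rho_subst p n r h) f = 0"
  shows "f = 0"
proof -
  obtain e g where eg: "h = (e, g)" "e \<in> {1..p} \<rightarrow>\<^sub>E {-1, 1}" "g permutes {1..p}"
    using h by (auto simp: signed_perm_group_def sym_group_carrier)
  define y where "y j = (if j \<in> {1..p} then of_int (e j) *
     (PVar (Hilbert_Choice.inv g j) + Kshift n r (Hilbert_Choice.inv g j)) - Kshift n r j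
     else PVar j)" for j
  have sub_int: "poly_subst y (of_int k) = of_int k" for k
  proof -
    have "of_int k = PConst (of_int k)" by (simp add: PConst_def)
    then show ?thesis by (metis poly_subst_PConst)
  qed
  have sub_diff: "poly_subst y (a - b) = poly_subst y a - poly_subst y b" for a b
    using poly_subst_add[of y "a - b" b] by (simp add: algebra_simps)
  have "poly_subst y (rho_subst p n r h i) = PVar i" for i
  proof (cases "i \<in> {1..p}")
    case True
    then have gi: "g i \<in> {1..p}" using permutes_in_image[OF eg(3)] by blast
    then have "e (g i) \<in> {-1, 1}" using eg(2) by (auto simp: PiE_def Pi_def)
    then have ee: "e (g i) = 1 \<or> e (g i) = -1" by blast
    have ig: "Hilbert_Choice.inv g (g i) = i" using permutes_inverses(2)[OF eg(3)] .
    show ?thesis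
      using True gi ee
      by (auto simp: rho_subst_def eg(1) sub_diff poly_subst_mult poly_subst_add sub_int
          Kshift_def y_def ig algebra_simps)
  next
    case False
    then show ?thesis by (auto simp: rho_subst_def eg(1) y_def)
  qed
  then have "poly_subst y (poly_subst (rho_subst p n r h) f) = f"
    by (simp add: poly_subst_subst poly_subst_id)
  then show ?thesis using f by simp
qed

lemma rho_Fract:
  assumes h: "h \<in> carrier (signed_perm_group p)" and b: "b \<noteq> 0"
  shows "rho p n r h (Fract a b) =
    Fract (poly_subst (rho_subst p n r h) a) (poly_subst (rho_subst p n r h) b)"
  unfolding rho_def
proof (rule the_equality)
  let ?s = "poly_subst (rho_subst p n r h)"
  show "\<exists>a' b'. b' \<noteq> 0 \<and> Fract a b = Fract a' b' \<and> Fract (?s a) (?s b) = Fract (?s a') (?s b')"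
    using b by blast
  fix R' assume "\<exists>a' b'. b' \<noteq> 0 \<and> Fract a b = Fract a' b' \<and> R' = Fract (?s a') (?s b')"
  then obtain a' b' where *: "b' \<noteq> 0" "Fract a b = Fract a' b'" "R' = Fract (?s a') (?s b')"
    by blast
  have nz: "?s b \<noteq> 0" "?s b' \<noteq> 0" using poly_subst_rho_subst_eq_0[OF h] b *(1) by blast+
  have "a * b' = a' * b" using * b by (simp add: eq_fract)
  then have "?s a * ?s b' = ?s a' * ?s b" by (metis poly_subst_mult)
  then show "R' = Fract (?s a) (?s b)" using nz *(3) by (simp add: eq_fract)
qed

definition scale_ratfun :: "complex \<Rightarrow> ratfun \<Rightarrow> ratfun" where
  "scale_ratfun c R = Fract (PConst c) 1 * R"


section \<open>Formal multiple zeta values of depth \<open>p\<close>\<close>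

text \<open>The basis symbol with exponents \<open>s\<close> is \<open>Poly_Mapping.single s 1\<close>.\<close>

type_synonym fmzv = "nat list \<Rightarrow>\<^sub>0 complex"

definition W_space :: "complex set \<Rightarrow> nat \<Rightarrow> fmzv set" where
  "W_space K p = {x. (\<forall>s. Poly_Mapping.lookup x s \<in> K) \<and>
     (\<forall>s\<in>Poly_Mapping.keys x. length s = p \<and> 0 \<notin> set s)}"

definition W'_space :: "complex set \<Rightarrow> nat \<Rightarrow> fmzv set" where
  "W'_space K p = {x \<in> W_space K p. \<forall>s\<in>Poly_Mapping.keys x. s ! 0 \<ge> 2}"

definition phi :: "fmzv \<Rightarrow> complex" where
  "phi x = (\<Sum>s\<in>Poly_Mapping.keys x. Poly_Mapping.lookup x s * mzv s)"

definition perm_tuple :: "nat \<Rightarrow> (nat \<Rightarrow> nat) \<Rightarrow> nat list \<Rightarrow> nat list" where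
  "perm_tuple p g s = map (\<lambda>i. s ! (Hilbert_Choice.inv g i - 1)) [1..<p + 1]"

definition rho_tilde :: "nat \<Rightarrow> (nat \<Rightarrow> int) \<times> (nat \<Rightarrow> nat) \<Rightarrow> fmzv \<Rightarrow> fmzv" where
  "rho_tilde p = (\<lambda>(e, g) x. \<Sum>s\<in>Poly_Mapping.keys x.
     Poly_Mapping.single (perm_tuple p g s)
       (Poly_Mapping.lookup x s * of_int (\<Prod>i=1..p. e i ^ (perm_tuple p g s ! (i - 1)))))"

definition scale_fmzv :: "complex \<Rightarrow> fmzv \<Rightarrow> fmzv" where
  "scale_fmzv c x = Poly_Mapping.map ((*) c) x"

end

theory Submission
  imports Defs
begin

text \<open>
  By linearity \<open>P\<close> may be replaced by its monomials, so that the summand becomes a product of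
  univariate rational functions. A polynomial part in one variable can be summed over that variable,
  which is confined between its two neighbours; this leaves fewer variables and preserves the degree
  conditions. What remains are products of simple fractions \<open>1 / (k\<^sub>i + a)\<^sup>s\<close>. Shifting \<open>a\<close> by one
  produces a telescoping sum over \<open>k\<^sub>i\<close>, again with fewer variables, since a product of simple
  fractions in one variable decomposes into simple fractions. So, modulo sums with fewer variables, \<open>a\<close>
  can be moved to the value for which the sum over weak chains is exactly a multiple zeta value. The
  poles are moved from the last variable to the first, so that those of different variables stay
  separated if they were so initially; then pole orders are never added. All of this takes place
  for the truncated sums, where no question of convergence arises.

  The depth \<open>p\<close> part is therefore given by the coefficients of the partial fraction expansion of \<open>R\<close>,
  summed over the poles. As the expansion is unique, these sums inherit the symmetry of \<open>R\<close>;
  residues adding up to zero exclude \<open>s\<^sub>1 = 1\<close>.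
\<close>

section \<open>Truncated sums over chains\<close>

text \<open>Multiple zeta values satisfy linear relations, so a symmetry of \<open>S\<close> gives
  no information on the coefficients of a given representation of it. The representation has to be
  built so that its depth \<open>p\<close> coefficients are an explicit function of
  \<open>R\<close>, and every reduction must leave an error of strictly smaller depth; hence the
  pairing of an explicit \<open>top_value\<close> with an error in \<open>lower_adms\<close>. Moving
  a pole forgets its place: for each order s, only the sum of the coefficients over all poles
  survives. A substitution k -> -k + u moves the poles and multiplies the coefficients of order s by
  (-1)^s, whatever u is. This is the sign in \<open>rho_tilde\<close>, and it explains why the
  shifts r + n/2 leave no trace there. Conditions (a) and (b) bound exponents in terms of the
  original variables that were merged. It is enough to carry along, for each variable, a bound on
  the pole orders, a range for the poles and a flag for the exponent 1; a Boolean parameter lets one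
  induction serve both conditions.\<close>

text \<open>The sum over the chains \<open>N \<ge> k\<^sub>1\<close>, \<open>h k\<^sub>1 \<ge> k\<^sub>2\<close>, \<open>\<dots>\<close>: weakly decreasing ones for \<open>h k = k\<close>,
  strictly decreasing ones for \<open>h k = k - 1\<close>.\<close>

fun chain_sum :: "(nat \<Rightarrow> nat) \<Rightarrow> (nat \<Rightarrow> 'a::comm_ring_1) list \<Rightarrow> nat \<Rightarrow> 'a" where
  "chain_sum h [] N = 1"
| "chain_sum h (f # fs) N = (\<Sum>k=1..N. f k * chain_sum h fs (h k))"

abbreviation wsum :: "(nat \<Rightarrow> 'a::comm_ring_1) list \<Rightarrow> nat \<Rightarrow> 'a" where
  "wsum \<equiv> chain_sum (\<lambda>k. k)"

abbreviation ssum :: "(nat \<Rightarrow> 'a::comm_ring_1) list \<Rightarrow> nat \<Rightarrow> 'a" where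
  "ssum \<equiv> chain_sum (\<lambda>k. k - 1)"

definition chains_upto :: "(nat \<Rightarrow> nat \<Rightarrow> bool) \<Rightarrow> nat \<Rightarrow> nat \<Rightarrow> nat list set" where
  "chains_upto rel q N = {k. length k = q \<and> sorted_wrt rel k \<and> 0 \<notin> set k \<and> set k \<subseteq> {..N}}"

lemma finite_chains_upto: "finite (chains_upto rel q N)"
proof -
  have "chains_upto rel q N \<subseteq> {k. set k \<subseteq> {..N} \<and> length k = q}"
    by (auto simp: chains_upto_def)
  then show ?thesis by (rule finite_subset) (simp add: finite_lists_length_eq)
qed

text \<open>The equivalence is required for positive \<open>k\<close> only: for strict chains
  \<open>h k = k - 1\<close>, and truncated subtraction makes it fail at
  \<open>k = j = 0\<close>.\<close>

lemma chains_upto_Suc: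
  assumes "\<And>k j. 0 < k \<Longrightarrow> rel k j \<longleftrightarrow> j \<le> h k" "\<And>k. h k \<le> k"
  shows "chains_upto rel (Suc q) N = (\<Union>k\<in>{1..N}. (#) k ` chains_upto rel q (h k))"
    (is "?L = ?R")
proof
  show "?L \<subseteq> ?R"
  proof
    fix x assume x: "x \<in> ?L"
    then obtain k l where xk: "x = k # l" by (auto simp: chains_upto_def length_Suc_conv)
    have "0 < k" "k \<le> N" using x xk by (auto simp: chains_upto_def)
    moreover have "l \<in> chains_upto rel q (h k)"
      using x xk assms(1)[OF \<open>0 < k\<close>] by (auto simp: chains_upto_def)
    ultimately show "x \<in> ?R" using xk by auto
  qed
next
  show "?R \<subseteq> ?L"
  proof
    fix x assume "x \<in> ?R"
    then obtain k l where k: "1 \<le> k" "k \<le> N" and l: "l \<in> chains_upto rel q (h k)" and x: "x = k # l"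
      by auto
    have "j \<le> h k" if "j \<in> set l" for j using l that by (auto simp: chains_upto_def)
    then have "rel k j \<and> j \<le> N" if "j \<in> set l" for j
      using that assms(1)[of k j] assms(2)[of k] k by (meson le_trans less_le_trans zero_less_one)
    then show "x \<in> ?L" using x l k by (auto simp: chains_upto_def)
  qed
qed

lemma sum_chains_upto:
  assumes "\<And>k j. 0 < k \<Longrightarrow> rel k j \<longleftrightarrow> j \<le> h k" "\<And>k. h k \<le> k"
  shows "(\<Sum>k\<in>chains_upto rel (length fs) N. \<Prod>j<length fs. (fs ! j) (k ! j)) = chain_sum h fs N"
proof (induction fs arbitrary: N)
  case Nil
  have "chains_upto rel 0 N = {[]}" by (auto simp: chains_upto_def)
  then show ?case by simp
next
  case (Cons f fs)
  have disj: "\<forall>i\<in>{1..N}. \<forall>j\<in>{1..N}. i \<noteq> j \<longrightarrow>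
      (#) i ` chains_upto rel (length fs) (h i) \<inter> (#) j ` chains_upto rel (length fs) (h j) = {}"
    by auto
  have eq: "chains_upto rel (length (f # fs)) N =
      (\<Union>k\<in>{1..N}. (#) k ` chains_upto rel (length fs) (h k))"
    unfolding length_Cons by (rule chains_upto_Suc) (use assms in auto)
  have "(\<Sum>k\<in>chains_upto rel (length (f # fs)) N. \<Prod>j<length (f # fs). ((f # fs) ! j) (k ! j)) =
     (\<Sum>k=1..N. \<Sum>l\<in>(#) k ` chains_upto rel (length fs) (h k).
        \<Prod>j<length (f # fs). ((f # fs) ! j) (l ! j))"
    unfolding eq
    by (rule sum.UNION_disjoint) (use disj finite_chains_upto in auto)
  also have "\<dots> = (\<Sum>k=1..N. \<Sum>l\<in>chains_upto rel (length fs) (h k).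
        f k * (\<Prod>j<length fs. (fs ! j) (l ! j)))"
    by (rule sum.cong[OF refl], subst sum.reindex)
      (simp_all add: prod.lessThan_Suc_shift del: prod.lessThan_Suc)
  also have "\<dots> = chain_sum h (f # fs) N"
    by (simp add: Cons.IH sum_distrib_left[symmetric])
  finally show ?case .
qed

lemma finite_subset_chains_upto:
  assumes "finite F" "F \<subseteq> {k. length k = q \<and> sorted_wrt rel k \<and> 0 \<notin> set k}"
  shows "\<exists>N0. \<forall>N\<ge>N0. F \<subseteq> chains_upto rel q N"
proof -
  have "finite (\<Union> (set ` F))" using assms(1) by auto
  then obtain N0 where N0: "\<forall>j\<in>\<Union> (set ` F). j \<le> N0" using finite_nat_set_iff_bounded_le by blast
  have "F \<subseteq> chains_upto rel q N" if "N \<ge> N0" for N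
    unfolding chains_upto_def
  proof safe
    fix x y assume "x \<in> F" "y \<in> set x"
    then show "y \<le> N" using N0 that by force
  qed (use assms(2) in auto)
  then show ?thesis by blast
qed

text \<open>The truncations eventually contain any given finite set of chains, so an unconditional
  sum is also the limit along them. This is the bridge from infinite sums to truncated ones, used
  both for the series (weak chains) and for multiple zeta values (strict chains).\<close>

lemma has_sum_chains_tendsto:
  fixes fs :: "(nat \<Rightarrow> complex) list"
  assumes rel: "\<And>k j. 0 < k \<Longrightarrow> rel k j \<longleftrightarrow> j \<le> h k" "\<And>k. h k \<le> k"
    and "((\<lambda>k. \<Prod>j<length fs. (fs ! j) (k ! j)) has_sum S)
      {k. length k = length fs \<and> sorted_wrt rel k \<and> 0 \<notin> set k}"
  shows "chain_sum h fs \<longlonglongrightarrow> S"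
proof -
  define Z where "Z = {k. length k = length fs \<and> sorted_wrt rel k \<and> 0 \<notin> set k}"
  have sub: "chains_upto rel (length fs) N \<subseteq> Z" for N by (auto simp: chains_upto_def Z_def)
  have "\<forall>\<^sub>F N in sequentially. Q (chains_upto rel (length fs) N)"
    if ev: "\<forall>\<^sub>F Y in finite_subsets_at_top Z. Q Y" for Q
  proof -
    obtain F where F: "finite F" "F \<subseteq> Z"
      and Q: "\<forall>Y. finite Y \<and> F \<subseteq> Y \<and> Y \<subseteq> Z \<longrightarrow> Q Y"
      using ev unfolding eventually_finite_subsets_at_top by blast
    obtain N0 where N0: "\<forall>N\<ge>N0. F \<subseteq> chains_upto rel (length fs) N"
      using finite_subset_chains_upto[OF F(1) F(2)[unfolded Z_def]] by (rule exE) rule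
    have "\<forall>N\<ge>N0. Q (chains_upto rel (length fs) N)"
      by (intro allI impI Q[rule_format] conjI finite_chains_upto N0[rule_format] sub)
    then show ?thesis unfolding eventually_sequentially by (rule exI)
  qed
  then have "filterlim (chains_upto rel (length fs)) (finite_subsets_at_top Z) sequentially"
    unfolding filterlim_iff by (intro allI impI)
  from filterlim_compose[OF assms(3)[unfolded has_sum_def, folded Z_def] this]
  have "(\<lambda>N. \<Sum>k\<in>chains_upto rel (length fs) N. \<Prod>j<length fs. (fs ! j) (k ! j)) \<longlonglongrightarrow> S" .
  moreover have "(\<Sum>k\<in>chains_upto rel (length fs) N. \<Prod>j<length fs. (fs ! j) (k ! j)) =
      chain_sum h fs N" for N
    by (rule sum_chains_upto[of rel h]) (simp_all only: rel)
  ultimately show ?thesis by (simp only:)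
qed

lemma chain_sum_cong:
  assumes "list_all2 (\<lambda>f g. \<forall>k>0. f k = g k) fs gs"
  shows "chain_sum h fs N = chain_sum h gs N"
  using assms
proof (induction fs gs arbitrary: N rule: list_all2_induct)
  case (Cons f fs g gs)
  then have "f k * chain_sum h fs (h k) = g k * chain_sum h gs (h k)" if "k \<in> {1..N}" for k
    using that by simp
  then show ?case unfolding chain_sum.simps(2) by (rule sum.cong[OF refl])
qed simp

section \<open>Multilinearity of truncated sums in each slot\<close>

lemma wsum_cong_slot:
  assumes "\<And>k. k > 0 \<Longrightarrow> f k = g k"
  shows "wsum (xs @ f # ys) = wsum (xs @ g # ys)"
proof
  fix N show "wsum (xs @ f # ys) N = wsum (xs @ g # ys) N"
    by (rule chain_sum_cong) (simp add: assms list_all2_appendI list_all2_same)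
qed

lemma wsum_add_slot:
  "wsum (xs @ (\<lambda>k. f k + g k) # ys) N = wsum (xs @ f # ys) N + wsum (xs @ g # ys) N"
  by (induction xs arbitrary: N) (simp_all add: distrib_left distrib_right sum.distrib)

lemma wsum_diff_slot:
  "wsum (xs @ (\<lambda>k. f k - g k) # ys) N = wsum (xs @ f # ys) N - wsum (xs @ g # ys) N"
  by (induction xs arbitrary: N) (simp_all add: left_diff_distrib right_diff_distrib sum_subtractf)

lemma wsum_scale_slot:
  "wsum (xs @ (\<lambda>k. c * f k) # ys) N = c * wsum (xs @ f # ys) N"
  by (induction xs arbitrary: N) (simp_all add: mult_ac sum_distrib_left)

lemma wsum_zero_slot:
  "wsum (xs @ (\<lambda>k. 0) # ys) N = 0"
  by (induction xs arbitrary: N) auto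

lemma wsum_sum_slot:
  "wsum (xs @ (\<lambda>k. \<Sum>i\<in>I. f i k) # ys) N = (\<Sum>i\<in>I. wsum (xs @ f i # ys) N)"
proof (induction I rule: infinite_finite_induct)
  case (insert i I)
  then show ?case using wsum_add_slot[of xs "f i" "\<lambda>k. \<Sum>i\<in>I. f i k" ys N] by simp
qed (simp_all add: wsum_zero_slot)

text \<open>This lemma and the next three sum over one variable, which runs from its right neighbour
  (or 1) up to its left neighbour (or \<open>N\<close>). The factor collapses to \<open>u\<close> at
  the lower end minus \<open>u\<close> at the successor of the upper end, and these values are
  absorbed by the factors of the neighbours.\<close>

lemma wsum_telescope_last:
  assumes "\<And>k. k > 0 \<Longrightarrow> g k = u k - u (Suc k)"
  shows "wsum [g] N = u 1 - u (Suc N)"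
proof -
  have "wsum [g] N = (\<Sum>k=1..N. u k - u (Suc k))" using assms by simp
  also have "\<dots> = u 1 - u (Suc N)" by (induction N) auto
  finally show ?thesis .
qed

lemma wsum_telescope:
  assumes "\<And>k. k > 0 \<Longrightarrow> g k = u k - u (Suc k)"
  shows "wsum (g # f # ys) N = wsum ((\<lambda>k. u k * f k) # ys) N - u (Suc N) * wsum (f # ys) N"
proof (induction N)
  case (Suc N)
  define x where "x = wsum (f # ys) N"
  define y where "y = f (Suc N) * wsum ys (Suc N)"
  define z where "z = wsum ((\<lambda>k. u k * f k) # ys) N"
  have xy: "wsum (f # ys) (Suc N) = x + y" "wsum ((\<lambda>k. u k * f k) # ys) (Suc N) = z + u (Suc N) * y"
    by (simp_all add: x_def y_def z_def mult.assoc)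
  have g: "g (Suc N) = u (Suc N) - u (Suc (Suc N))" by (rule assms) simp
  have "wsum (g # f # ys) (Suc N) = wsum (g # f # ys) N + g (Suc N) * wsum (f # ys) (Suc N)"
    unfolding chain_sum.simps(2)[of _ g] by simp
  also have "\<dots> = (z - u (Suc N) * x) + (u (Suc N) - u (Suc (Suc N))) * (x + y)"
    unfolding Suc x_def[symmetric] z_def[symmetric] g xy ..
  also have "\<dots> = (z + u (Suc N) * y) - u (Suc (Suc N)) * (x + y)"
    by (simp add: algebra_simps)
  finally show ?case by (simp only: xy)
qed simp

lemma wsum_telescope_inner:
  assumes "\<And>k. k > 0 \<Longrightarrow> g k = u k - u (Suc k)"
  shows "wsum (xs @ f' # g # f # ys) N =
    wsum (xs @ f' # (\<lambda>k. u k * f k) # ys) N - wsum (xs @ (\<lambda>k. u (Suc k) * f' k) # f # ys) N"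
proof (induction xs arbitrary: N)
  case Nil
  have tel: "wsum (g # f # ys) k =
      wsum ((\<lambda>k. u k * f k) # ys) k - u (Suc k) * wsum (f # ys) k" for k
    by (rule wsum_telescope) (fact assms)
  have "f' k * wsum (g # f # ys) k = f' k * wsum ((\<lambda>k. u k * f k) # ys) k -
      u (Suc k) * f' k * wsum (f # ys) k" for k
    unfolding tel by (simp only: right_diff_distrib mult_ac)
  then show ?case
    unfolding append_Nil chain_sum.simps(2)[of _ f'] chain_sum.simps(2)[of _ "\<lambda>k. u (Suc k) * f' k"]
    by (simp only: sum_subtractf)
next
  case (Cons a xs)
  show ?case
    unfolding append_Cons chain_sum.simps(2)[of _ a] Cons.IH by (simp only: right_diff_distrib sum_subtractf)
qed

lemma wsum_telescope_inner_last:
  assumes "\<And>k. k > 0 \<Longrightarrow> g k = u k - u (Suc k)"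
  shows "wsum (xs @ [f', g]) N = u 1 * wsum (xs @ [f']) N - wsum (xs @ [\<lambda>k. u (Suc k) * f' k]) N"
proof (induction xs arbitrary: N)
  case Nil
  have tel: "wsum [g] k = u 1 - u (Suc k)" for k
    by (rule wsum_telescope_last) (fact assms)
  have "f' k * wsum [g] k = u 1 * (f' k * wsum [] k) - u (Suc k) * f' k * wsum [] k" for k
    unfolding tel by (simp add: algebra_simps)
  then show ?case
    unfolding append_Nil chain_sum.simps(2)[of _ f'] chain_sum.simps(2)[of _ "\<lambda>k. u (Suc k) * f' k"]
    by (simp only: sum_subtractf sum_distrib_left)
next
  case (Cons a xs)
  have "a k * wsum (xs @ [f', g]) k =
      u 1 * (a k * wsum (xs @ [f']) k) - a k * wsum (xs @ [\<lambda>k. u (Suc k) * f' k]) k" for k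
    unfolding Cons.IH right_diff_distrib by (simp only: mult.left_commute)
  then show ?case
    unfolding append_Cons chain_sum.simps(2)[of _ a] by (simp only: sum_subtractf sum_distrib_left)
qed

section \<open>Convergence\<close>

text \<open>For \<open>D = 1\<close> this is the hypothesis of the theorem: the first \<open>j\<close> exponents add up to at most
  \<open>- j - 1\<close>.\<close>

fun surplus_bounded :: "int \<Rightarrow> int list \<Rightarrow> bool" where
  "surplus_bounded D [] = True"
| "surplus_bounded D (d # ds) = (D + d + 1 \<le> 0 \<and> surplus_bounded (D + d + 1) ds)"

lemma powi_antimono_nonpos:
  fixes x y :: real
  assumes "0 < x" "x \<le> y" "n \<le> 0"
  shows "y powi n \<le> x powi n"
proof -
  have "y powi n = inverse (y ^ nat (- n))" "x powi n = inverse (x ^ nat (- n))"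
    using assms(3) by (auto simp: power_int_def power_inverse)
  then show ?thesis using assms by (simp add: le_imp_inverse_le power_mono)
qed

text \<open>Along a weakly decreasing chain the exponent surplus is handed from each variable to the next
  smaller one.\<close>

lemma prod_powi_le_prod_inverse:
  assumes "surplus_bounded D (d # ds)" "length ks = length ds" "sorted_wrt (\<ge>) (k # ks)" "0 \<notin> set (k # ks)"
  shows "real k powi D * (\<Prod>j<Suc (length ds). real ((k # ks) ! j) powi ((d # ds) ! j))
    \<le> (\<Prod>j<Suc (length ds). 1 / real ((k # ks) ! j))"
  using assms
proof (induction ds arbitrary: D d k ks)
  case Nil
  then have k: "real k \<ge> 1" by (cases k) auto
  have "real k powi D * real k powi d = real k powi (D + d + 1) / real k"
    using k by (simp add: power_int_add)
  also have "\<dots> \<le> 1 / real k"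
    using powi_antimono_nonpos[of 1 "real k" "D + d + 1"] k Nil by (simp add: divide_right_mono)
  finally show ?case by simp
next
  case (Cons d' ds)
  then obtain k' ks' where ks: "ks = k' # ks'" by (cases ks) auto
  have k: "real k \<ge> 1" "real k' \<ge> 1" "real k' \<le> real k"
    using Cons.prems ks by (auto simp: Suc_le_eq)
  define Q where "Q = (\<Prod>j<Suc (length ds). real ((k' # ks') ! j) powi ((d' # ds) ! j))"
  have Q: "Q \<ge> 0" unfolding Q_def by (intro prod_nonneg ballI zero_le_power_int) simp
  have IH: "real k' powi (D + d + 1) * Q \<le> (\<Prod>j<Suc (length ds). 1 / real ((k' # ks') ! j))"
    unfolding Q_def by (rule Cons.IH) (use Cons.prems ks in auto)
  have "real k powi D * (\<Prod>j<Suc (length (d' # ds)). real ((k # ks) ! j) powi ((d # d' # ds) ! j)) =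
      real k powi D * real k powi d * Q"
    unfolding Q_def ks by (subst prod.lessThan_Suc_shift) simp
  also have "\<dots> = real k powi (D + d + 1) * Q / real k"
    using k by (simp add: power_int_add)
  also have "\<dots> \<le> real k' powi (D + d + 1) * Q / real k"
    using powi_antimono_nonpos[of "real k'" "real k" "D + d + 1"] k Q Cons.prems(1)
    by (intro divide_right_mono mult_right_mono) auto
  also have "\<dots> \<le> (\<Prod>j<Suc (length ds). 1 / real ((k' # ks') ! j)) / real k"
    using IH k by (intro divide_right_mono) auto
  also have "\<dots> = (\<Prod>j<Suc (length (d' # ds)). 1 / real ((k # ks) ! j))"
    unfolding ks by (subst (2) prod.lessThan_Suc_shift) simp
  finally show ?case .
qed

lemma sum_inverse_sqrt_le: "(\<Sum>k=1..N. 1 / sqrt (real k)) \<le> 2 * sqrt (real N)"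
proof (induction N)
  case (Suc N)
  define a b where "a = sqrt (real N)" and "b = sqrt (real (Suc N))"
  have b: "b > 0" "a \<ge> 0" "b\<^sup>2 = a\<^sup>2 + 1" by (auto simp: a_def b_def)
  have "a * b \<le> (a\<^sup>2 + b\<^sup>2) / 2" using sum_squares_bound[of a b] by simp
  then have "2 * a * b + 1 \<le> 2 * b\<^sup>2" using b by simp
  then have "(2 * a * b + 1) / b \<le> (2 * b\<^sup>2) / b" using b by (intro divide_right_mono) auto
  then have "2 * a + 1 / b \<le> 2 * b" using b by (simp add: add_divide_distrib power2_eq_square)
  then show ?case using Suc by (simp add: a_def b_def)
qed simp

text \<open>The true growth is a power of the logarithm. The coarser bound by a square root
  reproduces itself: multiplied by 1/k and summed it is again a square root. It is still beaten by
  the factor 1/N of a boundary term. The \<open>+ 1\<close> covers the empty list at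
  \<open>N = 0\<close>.\<close>

lemma wsum_bound_sqrt:
  fixes fs :: "(nat \<Rightarrow> 'a::{real_normed_algebra_1, comm_ring_1}) list"
  assumes "\<forall>f\<in>set fs. \<exists>C. \<forall>k>0. norm (f k) \<le> C / real k"
  shows "\<exists>C\<ge>0. \<forall>N. norm (wsum fs N) \<le> C * sqrt (real N + 1)"
  using assms
proof (induction fs)
  case Nil
  show ?case by (intro exI[of _ 1]) auto
next
  case (Cons f fs)
  then obtain C' where C': "C' \<ge> 0" "\<And>N. norm (wsum fs N) \<le> C' * sqrt (real N + 1)" by auto
  obtain C where C: "\<And>k. k > 0 \<Longrightarrow> norm (f k) \<le> C / real k" using Cons.prems by auto
  have "0 \<le> C / real 1" by (rule order_trans[OF norm_ge_zero C]) simp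
  then have C0: "C \<ge> 0" by simp
  have *: "norm (f k * wsum fs k) \<le> C * C' * sqrt 2 * (1 / sqrt (real k))" if "k \<in> {1..N}" for k N
  proof -
    have k: "real k \<ge> 1" using that by auto
    have "norm (f k * wsum fs k) \<le> C / real k * (C' * sqrt (real k + 1))"
      using C[of k] C'(2)[of k] C0 k
      by (intro order_trans[OF norm_mult_ineq] mult_mono) (auto intro!: divide_nonneg_nonneg)
    also have "\<dots> \<le> C / real k * (C' * (sqrt 2 * sqrt (real k)))"
      using C0 C'(1) k by (intro mult_left_mono) (auto simp flip: real_sqrt_mult)
    also have "\<dots> = C * C' * sqrt 2 * (sqrt (real k) / real k)" by simp
    also have "sqrt (real k) / real k = 1 / sqrt (real k)"
      using k by (simp add: field_simps)
    finally show ?thesis .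
  qed
  have "norm (wsum (f # fs) N) \<le> 2 * C * C' * sqrt 2 * sqrt (real N + 1)" for N
  proof -
    have "norm (wsum (f # fs) N) \<le> (\<Sum>k=1..N. C * C' * sqrt 2 * (1 / sqrt (real k)))"
      unfolding chain_sum.simps by (rule sum_norm_le) (use * in auto)
    also have "\<dots> \<le> C * C' * sqrt 2 * (2 * sqrt (real N))"
      unfolding sum_distrib_left[symmetric]
      by (rule mult_left_mono[OF sum_inverse_sqrt_le]) (use C0 C' in auto)
    also have "\<dots> \<le> C * C' * sqrt 2 * (2 * sqrt (real N + 1))"
      using C0 C' by (intro mult_left_mono) auto
    finally show ?thesis by (simp add: mult_ac)
  qed
  then show ?case using C0 C' by (intro exI[of _ "2 * C * C' * sqrt 2"]) auto
qed

text \<open>One more factor 1/k in the largest variable turns square root growth of the inner sum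
  into terms of order k^(-3/2), which are summable.\<close>

lemma wsum_inverse_square_bounded:
  "\<exists>B. \<forall>N. wsum ((\<lambda>k. 1 / (real k)\<^sup>2) # replicate q (\<lambda>k. 1 / real k)) N \<le> B"
proof -
  obtain C where C: "C \<ge> 0" "\<And>N. norm (wsum (replicate q (\<lambda>k. 1 / real k)) N) \<le> C * sqrt (real N + 1)"
    using wsum_bound_sqrt[of "replicate q (\<lambda>k. 1 / real k)"] by force
  define t where "t k = C * sqrt 2 * real k powr (- 3 / 2)" for k
  have summ: "summable t" unfolding t_def
    by (intro summable_mult) (simp add: summable_real_powr_iff)
  have t0: "t k \<ge> 0" for k using C by (simp add: t_def)
  have "1 / (real k)\<^sup>2 * wsum (replicate q (\<lambda>k. 1 / real k)) k \<le> t k" if "k > 0" for k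
  proof -
    have "wsum (replicate q (\<lambda>k. 1 / real k)) k \<le> C * sqrt (real k + 1)"
      using C(2)[of k] by auto
    also have "\<dots> \<le> C * (sqrt 2 * sqrt (real k))"
      using C(1) that by (intro mult_left_mono) (auto simp flip: real_sqrt_mult)
    finally have "1 / (real k)\<^sup>2 * wsum (replicate q (\<lambda>k. 1 / real k)) k \<le>
        1 / (real k)\<^sup>2 * (C * (sqrt 2 * sqrt (real k)))"
      by (intro mult_left_mono) auto
    also have "\<dots> = C * sqrt 2 * (real k powr (1/2) / real k powr 2)"
      using that by (simp add: powr_half_sqrt)
    also have "\<dots> = t k" unfolding t_def powr_diff[symmetric] by simp
    finally show ?thesis .
  qed
  then have "wsum ((\<lambda>k. 1 / (real k)\<^sup>2) # replicate q (\<lambda>k. 1 / real k)) N \<le> sum t {1..N}" for N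
    unfolding chain_sum.simps by (intro sum_mono) auto
  moreover have "sum t {1..N} \<le> suminf t" for N
    by (rule sum_le_suminf[OF summ]) (use t0 in auto)
  ultimately show ?thesis by (meson order_trans)
qed

lemma weak_chains_eq: "weak_chains q = {k. length k = q \<and> sorted_wrt (\<ge>) k \<and> 0 \<notin> set k}"
  by (simp add: weak_chains_def)

text \<open>Transferring exponents along a chain bounds its term by 1/k_1 times the product of all
  the 1/k_j, and the truncated sums of this majorant are bounded.\<close>

lemma summable_on_weak_chains:
  fixes fs :: "(nat \<Rightarrow> complex) list"
  assumes "surplus_bounded 1 ds"
    and "list_all2 (\<lambda>f d. \<exists>C. \<forall>k>0. norm (f k) \<le> C * real k powi d) fs ds"
  shows "(\<lambda>k. \<Prod>j<length fs. (fs ! j) (k ! j)) summable_on weak_chains (length fs)"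
proof (cases ds)
  case Nil
  then have "weak_chains (length fs) = {[]}" using assms(2) by (auto simp: weak_chains_def)
  then show ?thesis by simp
next
  case (Cons d ds')
  let ?q = "length fs"
  let ?g = "\<lambda>k::nat list. norm (\<Prod>j<?q. (fs ! j) (k ! j))"
  have len: "?q = Suc (length ds')" "length ds = ?q"
    using assms(2) Cons by (auto dest: list_all2_lengthD)
  have "\<exists>C. \<forall>k>0. norm ((fs ! j) k) \<le> C * real k powi (ds ! j)" if "j < ?q" for j
    using list_all2_nthD[OF assms(2) that] .
  then obtain C where C: "\<And>j k. j < ?q \<Longrightarrow> k > 0 \<Longrightarrow> norm ((fs ! j) k) \<le> C j * real k powi (ds ! j)"
    by metis
  define D where "D = (\<Prod>j<?q. \<bar>C j\<bar>)"
  let ?h = "\<lambda>k. \<Prod>j<?q. (((\<lambda>k. 1 / (real k)\<^sup>2) # replicate (length ds') (\<lambda>k. 1 / real k)) ! j) (k ! j)"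
  have bound: "?g k \<le> D * ?h k" if k: "k \<in> weak_chains ?q" for k
  proof -
    obtain k0 ks where ks: "k = k0 # ks" "length ks = length ds'"
      using k len by (auto simp: weak_chains_def length_Suc_conv)
    have pos: "k ! j > 0" if "j < ?q" for j
      using k that unfolding weak_chains_def by (metis (mono_tags, lifting) mem_Collect_eq neq0_conv nth_mem)
    have k0: "real k0 > 0" using pos[of 0] len ks by simp
    have "?g k \<le> (\<Prod>j<?q. \<bar>C j\<bar> * real (k ! j) powi (ds ! j))"
      unfolding prod_norm[symmetric]
    proof (rule prod_mono, safe)
      fix j assume j: "j < ?q"
      have "norm ((fs ! j) (k ! j)) \<le> C j * real (k ! j) powi (ds ! j)" using C[OF j pos[OF j]] .
      also have "\<dots> \<le> \<bar>C j\<bar> * real (k ! j) powi (ds ! j)"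
        by (rule mult_right_mono) auto
      finally show "norm ((fs ! j) (k ! j)) \<le> \<bar>C j\<bar> * real (k ! j) powi (ds ! j)" .
    qed simp
    also have "\<dots> = D * (\<Prod>j<?q. real (k ! j) powi (ds ! j))"
      by (simp add: D_def prod.distrib)
    also have "\<dots> \<le> D * ?h k"
    proof (rule mult_left_mono)
      \<comment> \<open>The initial surplus 1 is what yields the additional factor 1/k0, hence the
        square in the first factor of the majorant.\<close>
      have "real k0 powi 1 * (\<Prod>j<?q. real (k ! j) powi (ds ! j)) \<le> (\<Prod>j<?q. 1 / real (k ! j))"
        unfolding len(1) ks(1) Cons
        by (rule prod_powi_le_prod_inverse) (use assms(1) Cons ks k in \<open>auto simp: weak_chains_def\<close>)
      then have "(\<Prod>j<?q. real (k ! j) powi (ds ! j)) \<le> (\<Prod>j<?q. 1 / real (k ! j)) / real k0"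
        using k0 by (simp add: field_simps)
      also have "\<dots> = ?h k"
        unfolding len(1) ks(1) by (simp add: prod.lessThan_Suc_shift power2_eq_square del: prod.lessThan_Suc)
      finally show "(\<Prod>j<?q. real (k ! j) powi (ds ! j)) \<le> ?h k" .
    qed (simp add: D_def prod_nonneg)
    finally show ?thesis .
  qed
  obtain B where B: "\<And>N. wsum ((\<lambda>k. 1 / (real k)\<^sup>2) # replicate (length ds') (\<lambda>k. 1 / real k)) N \<le> B"
    using wsum_inverse_square_bounded by blast
  have D0: "D \<ge> 0" by (simp add: D_def prod_nonneg)
  have "sum ?g F \<le> D * B" if F: "F \<subseteq> weak_chains ?q" "finite F" for F
  proof -
    obtain N where N: "F \<subseteq> chains_upto (\<ge>) ?q N"
      using finite_subset_chains_upto[OF F(2), of ?q "(\<ge>)"] F(1) unfolding weak_chains_eq by blast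
    have "sum ?g F \<le> sum ?g (chains_upto (\<ge>) ?q N)"
      by (rule sum_mono2[OF finite_chains_upto N]) auto
    also have "\<dots> \<le> (\<Sum>k\<in>chains_upto (\<ge>) ?q N. D * ?h k)"
      by (rule sum_mono, rule bound) (auto simp: chains_upto_def weak_chains_def)
    also have "\<dots> = D * wsum ((\<lambda>k. 1 / (real k)\<^sup>2) # replicate (length ds') (\<lambda>k. 1 / real k)) N"
      using sum_chains_upto[of "(\<ge>)" "\<lambda>k. k" "(\<lambda>k. 1 / (real k)\<^sup>2) # replicate (length ds') (\<lambda>k. 1 / real k)" N]
      unfolding sum_distrib_left[symmetric] length_Cons length_replicate len(1) by (simp only: order_refl)
    also have "\<dots> \<le> D * B" using B D0 by (rule mult_left_mono)
    finally show ?thesis .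
  qed
  then have "?g summable_on weak_chains ?q"
    by (intro nonneg_bdd_above_summable_on bdd_aboveI[of _ "D * B"]) auto
  then show ?thesis by (rule abs_summable_summable)
qed

section \<open>Multiple zeta values as weak sums with shifted poles\<close>

definition pole :: "nat \<Rightarrow> nat \<Rightarrow> nat \<Rightarrow> complex" where
  "pole a s k = 1 / (of_nat k + of_nat a) ^ s"

lemma norm_pole_le:
  assumes "s \<ge> 1" "k > 0"
  shows "norm (pole a s k) \<le> 1 / real k"
proof -
  have "norm (of_nat k + of_nat a :: complex) = real k + real a"
    by (metis norm_of_nat of_nat_add)
  then have "norm (pole a s k) = 1 / (real k + real a) ^ s"
    by (simp add: pole_def norm_divide norm_power)
  also have "\<dots> \<le> 1 / (real k + real a) ^ 1"
    using assms by (intro divide_left_mono power_increasing) auto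
  also have "\<dots> \<le> 1 / real k" using assms by (auto intro!: divide_left_mono)
  finally show ?thesis .
qed

fun shifted_poles :: "nat list \<Rightarrow> (nat \<Rightarrow> complex) list" where
  "shifted_poles [] = []"
| "shifted_poles (s # ss) = pole (length ss) s # shifted_poles ss"

lemma length_shifted_poles [simp]: "length (shifted_poles s) = length s"
  by (induction s) auto

abbreviation zeta_terms :: "nat list \<Rightarrow> (nat \<Rightarrow> complex) list" where
  "zeta_terms s \<equiv> map (\<lambda>t k. 1 / of_nat k ^ t) s"

lemma prod_zeta_terms:
  "(\<Prod>j<length (zeta_terms s). (zeta_terms s ! j) (k ! j)) = (\<Prod>j<length s. 1 / of_nat (k ! j) ^ (s ! j))"
  by (auto intro!: prod.cong)

lemma ssum_eq_0: "N < length fs \<Longrightarrow> ssum fs N = 0"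
proof (induction fs arbitrary: N)
  case (Cons f fs)
  have "ssum fs (k - 1) = 0" if "k \<in> {1..N}" for k
    using Cons.prems that by (intro Cons.IH) auto
  then show ?case by simp
qed simp

text \<open>Adding to every variable the number of variables to its right turns weakly decreasing chains
  into strictly decreasing ones.\<close>

lemma wsum_shifted_poles:
  "wsum (shifted_poles s) N = ssum (zeta_terms s) (N + length s - 1)"
proof (induction s arbitrary: N)
  case (Cons t s)
  let ?q = "length s"
  let ?f = "\<lambda>k. 1 / of_nat k ^ t * ssum (zeta_terms s) (k - 1)"
  have "wsum (shifted_poles (t # s)) N = (\<Sum>k=1..N. ?f (k + ?q))"
    by (simp add: Cons.IH pole_def)
  \<comment> \<open>The new terms have \<open>k \<le> ?q\<close>, and no strict chain of length
    \<open>?q\<close> fits below such a \<open>k\<close>.\<close>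
  also have "\<dots> = sum ?f {1 + ?q..N + ?q}"
    by (rule sum.shift_bounds_cl_nat_ivl[symmetric])
  also have "\<dots> = sum ?f {1..N + ?q}"
  proof (rule sum.mono_neutral_left)
    show "\<forall>i\<in>{1..N + ?q} - {1 + ?q..N + ?q}. ?f i = 0"
      using ssum_eq_0[of _ "zeta_terms s"] by auto
  qed auto
  finally show ?case by simp
qed simp

text \<open>Strict chains are weak chains. A first exponent of at least 2 uses up the initial
  surplus 1, and the later exponents, being at least 1, never let it become positive again.\<close>

lemma mzv_summable:
  assumes "0 \<notin> set s" "s \<noteq> [] \<longrightarrow> s ! 0 \<ge> 2"
  shows "(\<lambda>k. \<Prod>j<length s. 1 / of_nat (k ! j) ^ (s ! j) :: complex) summable_on strict_chains (length s)"
proof -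
  have bd: "list_all2 (\<lambda>f d. \<exists>C. \<forall>k>0. norm (f k) \<le> C * real k powi d)
      (zeta_terms u) (map (\<lambda>t. - int t) u)" for u
    by (auto simp: list_all2_conv_all_nth norm_inverse norm_power power_int_minus divide_inverse
        intro!: exI[of _ 1])
  have "surplus_bounded D (map (\<lambda>t. - int t) u)" if "0 \<notin> set u" "D \<le> 0" for D u
    using that
  proof (induction u arbitrary: D)
    case (Cons t u)
    then show ?case by (cases t) auto
  qed simp
  then have "surplus_bounded 1 (map (\<lambda>t. - int t) s)"
    using assms by (cases s) auto
  from summable_on_weak_chains[OF this bd]
  have "(\<lambda>k. \<Prod>j<length s. 1 / of_nat (k ! j) ^ (s ! j) :: complex) summable_on weak_chains (length s)"
    unfolding prod_zeta_terms by simp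
  moreover have "strict_chains (length s) \<subseteq> weak_chains (length s)"
    by (auto simp: strict_chains_def weak_chains_def elim: sorted_wrt_mono_rel[rotated])
  ultimately show ?thesis by (rule summable_on_subset)
qed

lemma wsum_shifted_poles_tendsto:
  assumes "0 \<notin> set s" "s \<noteq> [] \<longrightarrow> s ! 0 \<ge> 2"
  shows "wsum (shifted_poles s) \<longlonglongrightarrow> mzv s"
proof (cases "s = []")
  case True
  have "wsum ([] :: (nat \<Rightarrow> complex) list) = (\<lambda>N. 1)" by (rule ext) simp
  then show ?thesis using True by (simp add: mzv_Nil)
next
  case False
  have "((\<lambda>k. \<Prod>j<length s. 1 / of_nat (k ! j) ^ (s ! j)) has_sum mzv s) (strict_chains (length s))"
    unfolding mzv_def by (rule has_sum_infsum) (rule mzv_summable[OF assms])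
  then have "((\<lambda>k. \<Prod>j<length (zeta_terms s). (zeta_terms s ! j) (k ! j)) has_sum mzv s)
      {k. length k = length (zeta_terms s) \<and> sorted_wrt (>) k \<and> 0 \<notin> set k}"
    unfolding prod_zeta_terms by (simp add: strict_chains_def)
  then have "ssum (zeta_terms s) \<longlonglongrightarrow> mzv s"
    by (rule has_sum_chains_tendsto[of "(>)" "\<lambda>k. k - 1", rotated 2]) auto
  then have "(\<lambda>N. ssum (zeta_terms s) (N + (length s - 1))) \<longlonglongrightarrow> mzv s"
    by (rule LIMSEQ_ignore_initial_segment)
  then show ?thesis using False by (simp add: wsum_shifted_poles[abs_def] Suc_le_eq)
qed

section \<open>Spaces of multiple zeta values\<close>

locale complex_subfield =
  fixes K :: "complex set"
  assumes zero_closed [simp, intro]: "0 \<in> K"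
    and one_closed [simp, intro]: "1 \<in> K"
    and add_closed [intro]: "x \<in> K \<Longrightarrow> y \<in> K \<Longrightarrow> x + y \<in> K"
    and mult_closed [intro]: "x \<in> K \<Longrightarrow> y \<in> K \<Longrightarrow> x * y \<in> K"
    and uminus_closed [intro]: "x \<in> K \<Longrightarrow> - x \<in> K"
    and inverse_closed [intro]: "x \<in> K \<Longrightarrow> inverse x \<in> K"
begin

lemma diff_closed [intro]: "x \<in> K \<Longrightarrow> y \<in> K \<Longrightarrow> x - y \<in> K"
  using add_closed[of x "- y"] by auto

lemma divide_closed [intro]: "x \<in> K \<Longrightarrow> y \<in> K \<Longrightarrow> x / y \<in> K"
  by (auto simp: divide_inverse)

lemma of_nat_closed [simp, intro]: "of_nat n \<in> K"
  by (induction n) auto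

lemma power_closed [intro]: "x \<in> K \<Longrightarrow> x ^ n \<in> K"
  by (induction n) auto

lemma sum_closed [intro]: "(\<And>i. i \<in> I \<Longrightarrow> f i \<in> K) \<Longrightarrow> sum f I \<in> K"
  by (induction I rule: infinite_finite_induct) auto

lemma prod_closed [intro]: "(\<And>i. i \<in> I \<Longrightarrow> f i \<in> K) \<Longrightarrow> prod f I \<in> K"
  by (induction I rule: infinite_finite_induct) auto

definition zspan :: "nat list set \<Rightarrow> complex set" where
  "zspan T = {v. \<exists>l. range l \<subseteq> K \<and> finite {s. l s \<noteq> 0} \<and> {s. l s \<noteq> 0} \<subseteq> T \<and>
     v = (\<Sum>s | l s \<noteq> 0. l s * mzv s)}"

lemma zspanI:
  assumes "\<And>s. l s \<in> K" "finite F" "F \<subseteq> T" "\<And>s. s \<notin> F \<Longrightarrow> l s = 0"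
  shows "(\<Sum>s\<in>F. l s * mzv s) \<in> zspan T"
proof -
  have "{s. l s \<noteq> 0} \<subseteq> F" using assms(4) by auto
  moreover from this have "(\<Sum>s\<in>F. l s * mzv s) = (\<Sum>s | l s \<noteq> 0. l s * mzv s)"
    by (intro sum.mono_neutral_right assms(2)) auto
  ultimately show ?thesis
    unfolding zspan_def using assms(1-3) finite_subset by blast
qed

lemma zspan_0 [simp]: "0 \<in> zspan T"
  using zspanI[of "\<lambda>s. 0" "{}" T] by simp

lemma zspan_mzv: "s \<in> T \<Longrightarrow> mzv s \<in> zspan T"
  using zspanI[of "\<lambda>t. if t = s then 1 else 0" "{s}" T] by auto

lemma zspan_mono: "v \<in> zspan T \<Longrightarrow> T \<subseteq> T' \<Longrightarrow> v \<in> zspan T'"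
  unfolding zspan_def by blast

lemma zspan_scale:
  assumes "v \<in> zspan T" "c \<in> K"
  shows "c * v \<in> zspan T"
proof -
  obtain l where l: "range l \<subseteq> K" "finite {s. l s \<noteq> 0}" "{s. l s \<noteq> 0} \<subseteq> T"
    "v = (\<Sum>s | l s \<noteq> 0. l s * mzv s)"
    using assms(1) by (auto simp: zspan_def)
  have "(\<Sum>s | l s \<noteq> 0. (c * l s) * mzv s) \<in> zspan T"
    by (rule zspanI) (use l assms(2) in auto)
  then show ?thesis by (simp add: l(4) sum_distrib_left mult.assoc)
qed

lemma zspan_add:
  assumes "v \<in> zspan T" "w \<in> zspan T"
  shows "v + w \<in> zspan T"
proof -
  obtain l where l: "range l \<subseteq> K" "finite {s. l s \<noteq> 0}" "{s. l s \<noteq> 0} \<subseteq> T"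
    "v = (\<Sum>s | l s \<noteq> 0. l s * mzv s)"
    using assms(1) by (auto simp: zspan_def)
  obtain m where m: "range m \<subseteq> K" "finite {s. m s \<noteq> 0}" "{s. m s \<noteq> 0} \<subseteq> T"
    "w = (\<Sum>s | m s \<noteq> 0. m s * mzv s)"
    using assms(2) by (auto simp: zspan_def)
  let ?F = "{s. l s \<noteq> 0} \<union> {s. m s \<noteq> 0}"
  have "v = (\<Sum>s\<in>?F. l s * mzv s)" unfolding l(4)
    by (rule sum.mono_neutral_left) (use l m in auto)
  moreover have "w = (\<Sum>s\<in>?F. m s * mzv s)" unfolding m(4)
    by (rule sum.mono_neutral_left) (use l m in auto)
  ultimately have "v + w = (\<Sum>s\<in>?F. (l s + m s) * mzv s)"
    by (simp add: sum.distrib distrib_right)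
  also have "\<dots> \<in> zspan T"
  proof (rule zspanI)
    show "l s + m s \<in> K" for s using l(1) m(1) by (intro add_closed) auto
  qed (use l m in auto)
  finally show ?thesis .
qed

lemma zspan_sum: "(\<And>i. i \<in> I \<Longrightarrow> v i \<in> zspan T) \<Longrightarrow> sum v I \<in> zspan T"
  by (induction I rule: infinite_finite_induct) (auto intro: zspan_add)

text \<open>Convergence is part of the predicate, which can thus be asserted for a difference of
  truncated sums that diverge separately.\<close>

definition lim_rep :: "nat list set \<Rightarrow> (nat \<Rightarrow> complex) \<Rightarrow> bool" where
  "lim_rep T F \<longleftrightarrow> (\<exists>v\<in>zspan T. F \<longlonglongrightarrow> v)"

lemma lim_rep_add: "lim_rep T F \<Longrightarrow> lim_rep T G \<Longrightarrow> lim_rep T (\<lambda>N. F N + G N)"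
  unfolding lim_rep_def using tendsto_add zspan_add by blast

lemma lim_rep_scale: "lim_rep T F \<Longrightarrow> c \<in> K \<Longrightarrow> lim_rep T (\<lambda>N. c * F N)"
  unfolding lim_rep_def using tendsto_mult_left zspan_scale by blast

lemma lim_rep_diff: "lim_rep T F \<Longrightarrow> lim_rep T G \<Longrightarrow> lim_rep T (\<lambda>N. F N - G N)"
  using lim_rep_add[of T F "\<lambda>N. - 1 * G N"] lim_rep_scale[of T G "- 1"] by auto

lemma lim_rep_0: "F \<longlonglongrightarrow> 0 \<Longrightarrow> lim_rep T F"
  unfolding lim_rep_def using zspan_0 by blast

lemma lim_rep_sum: "(\<And>i. i \<in> I \<Longrightarrow> lim_rep T (F i)) \<Longrightarrow> lim_rep T (\<lambda>N. \<Sum>i\<in>I. F i N)"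
  by (induction I rule: infinite_finite_induct) (auto intro: lim_rep_add lim_rep_0)

lemma lim_rep_mono: "lim_rep T F \<Longrightarrow> T \<subseteq> T' \<Longrightarrow> lim_rep T' F"
  unfolding lim_rep_def using zspan_mono by blast

end

section \<open>Slots and the exponents they admit\<close>

text \<open>A slot describes the univariate factor attached to one summation variable: its poles \<open>- a\<close>
  satisfy \<open>pmin \<le> a \<le> pmax\<close>, their order is at most \<open>order_bd\<close>, and unless \<open>allow1\<close> holds the
  residues add up to zero, so that no exponent 1 can arise from it.\<close>

datatype slot = Slot (order_bd: nat) (allow1: bool) (pmin: nat) (pmax: nat)

text \<open>A block is a run of consecutive original variables that have been merged into one, and
  \<open>x\<close> is the exponent of the merged variable. Without separation common poles may have
  added their orders; with it the largest single order is a bound.\<close>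

definition block_ok :: "bool \<Rightarrow> nat \<Rightarrow> slot list \<Rightarrow> bool" where
  "block_ok b x blk \<longleftrightarrow>
     (if b then \<exists>d\<in>set blk. x \<le> order_bd d else x \<le> sum_list (map order_bd blk))"

text \<open>\<open>b\<close> says whether the pole ranges of different slots are separated, in which case merging
  variables never adds pole orders.\<close>

definition adm :: "bool \<Rightarrow> slot list \<Rightarrow> nat list \<Rightarrow> bool" where
  "adm b ds s \<longleftrightarrow> 0 \<notin> set s \<and> (s \<noteq> [] \<longrightarrow>
     s ! 0 \<ge> 2 \<and> (\<exists>bs. concat bs = ds \<and> [] \<notin> set bs \<and> list_all2 (block_ok b) s bs) \<and>
     length (filter ((=) 1) s) \<le> length (filter allow1 ds))"

abbreviation adms :: "bool \<Rightarrow> slot list \<Rightarrow> nat list set" where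
  "adms b ds \<equiv> {s. adm b ds s}"

text \<open>The place for correction terms: since their depth is smaller than the number of slots,
  they cannot disturb the coefficients of full depth.\<close>

definition lower_adms :: "bool \<Rightarrow> slot list \<Rightarrow> nat list set" where
  "lower_adms b ds = {s. adm b ds s \<and> length s < length ds}"

lemma adm_Nil [simp]: "adm b ds []"
  by (simp add: adm_def)

lemma length_le_concat: "[] \<notin> set bs \<Longrightarrow> length bs \<le> length (concat bs)"
proof (induction bs)
  case (Cons x bs)
  then show ?case by (cases x) auto
qed simp

lemma adm_length: "adm b ds s \<Longrightarrow> length s \<le> length ds"
  using length_le_concat by (cases "s = []") (auto simp: adm_def dest!: list_all2_lengthD)

lemma split_block:
  assumes "concat bs = pre @ e # post"
  obtains bs1 b1 b2 bs2 where "bs = bs1 @ (b1 @ e # b2) # bs2" "pre = concat bs1 @ b1" "post = b2 @ concat bs2"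
  using assms
proof (induction bs arbitrary: pre thesis)
  case (Cons x bs)
  show ?case
  proof (cases "length pre < length x")
    case True
    then have "pre = take (length pre) x" "e # post = drop (length pre) x @ concat bs"
      using Cons.prems(2) by (auto simp: append_eq_append_conv_if)
    moreover obtain y ys where y: "drop (length pre) x = y # ys"
      using True by (cases "drop (length pre) x") auto
    ultimately have "x = pre @ e # ys" "post = ys @ concat bs"
      by (metis append_Cons append_take_drop_id list.inject)+
    then show ?thesis using Cons.prems(1)[of "[]" pre ys bs] by simp
  next
    case False
    then have "x = take (length x) pre" "concat bs = drop (length x) pre @ e # post"
      using Cons.prems(2) by (auto simp: append_eq_append_conv_if)
    then obtain bs1 b1 b2 bs2 where *: "bs = bs1 @ (b1 @ e # b2) # bs2"
      "drop (length x) pre = concat bs1 @ b1" "post = b2 @ concat bs2"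
      using Cons.IH by metis
    have "pre = concat (x # bs1) @ b1"
      using * \<open>x = take (length x) pre\<close> by (metis append_take_drop_id append.assoc concat.simps(2))
    then show ?thesis using Cons.prems(1)[of "x # bs1" b1 b2 bs2] * by simp
  qed
qed simp

text \<open>In the block containing the merged slot \<open>e\<close>, the slots \<open>d\<close> and
  \<open>d'\<close> are put back in its place. The order hypothesis keeps the bound of that block
  valid, and the flag hypothesis keeps the number of ones below the number of flags.\<close>

lemma adm_merge:
  assumes "adm b (pre @ e # post) s"
    and "order_bd e \<le> (if b then max (order_bd d) (order_bd d') else order_bd d + order_bd d')"
    and "allow1 e \<longrightarrow> allow1 d \<or> allow1 d'"
  shows "adm b (pre @ d # d' # post) s"
proof (cases "s = []")
  case False
  with assms(1) obtain bs where bs: "concat bs = pre @ e # post" "[] \<notin> set bs"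
    "list_all2 (block_ok b) s bs" by (auto simp: adm_def)
  obtain bs1 b1 b2 bs2 where sp: "bs = bs1 @ (b1 @ e # b2) # bs2" "pre = concat bs1 @ b1"
    "post = b2 @ concat bs2" using split_block[OF bs(1)] by blast
  let ?bs = "bs1 @ (b1 @ d # d' # b2) # bs2"
  have ok: "block_ok b x (b1 @ d # d' # b2)" if "block_ok b x (b1 @ e # b2)" for x
    using that assms(2) by (cases b) (auto simp: block_ok_def)
  have "list_all2 (block_ok b) s ?bs"
    using bs(3) ok unfolding sp(1) by (fastforce simp: list_all2_append2 list_all2_Cons2)
  moreover have "concat ?bs = pre @ d # d' # post" "[] \<notin> set ?bs" using sp bs(2) by auto
  moreover have "length (filter allow1 (pre @ e # post)) \<le> length (filter allow1 (pre @ d # d' # post))"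
    using assms(3) by auto
  ultimately show ?thesis using assms(1) False unfolding adm_def by (metis order_trans)
qed simp

text \<open>The blocks have to exhaust the list, so the dropped slot is put back into the last
  block, whose bound can only grow.\<close>

lemma adm_drop_last:
  assumes "adm b pre s"
  shows "adm b (pre @ [d]) s"
proof (cases "s = []")
  case False
  with assms obtain bs where bs: "concat bs = pre" "[] \<notin> set bs"
    "list_all2 (block_ok b) s bs" by (auto simp: adm_def)
  then have "bs \<noteq> []" using False by auto
  then obtain bs1 x where x: "bs = bs1 @ [x]" by (metis append_butlast_last_id)
  have "block_ok b y (x @ [d])" if "block_ok b y x" for y
    using that by (cases b) (auto simp: block_ok_def)
  then have "list_all2 (block_ok b) s (bs1 @ [x @ [d]])"
    using bs(3) unfolding x by (auto simp: list_all2_append2 list_all2_Cons2)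
  moreover have "concat (bs1 @ [x @ [d]]) = pre @ [d]" "[] \<notin> set (bs1 @ [x @ [d]])"
    using x bs by auto
  moreover have "length (filter allow1 pre) \<le> length (filter allow1 (pre @ [d]))" by simp
  ultimately show ?thesis using assms False unfolding adm_def by (metis order_trans)
qed simp

text \<open>Pole ranges are left out because \<open>adm\<close> sees only orders and flags. This
  allows a range to be enlarged or replaced while poles are being moved.\<close>

definition slot_le :: "slot \<Rightarrow> slot \<Rightarrow> bool" where
  "slot_le d e \<longleftrightarrow> order_bd d \<le> order_bd e \<and> (allow1 d \<longrightarrow> allow1 e)"

lemma list_all2_concat_split:
  assumes "list_all2 Q (concat bs) es"
  shows "\<exists>cs. concat cs = es \<and> list_all2 (list_all2 Q) bs cs"
  using assms
proof (induction bs arbitrary: es)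
  case (Cons x bs)
  then obtain es1 es2 where es: "es = es1 @ es2" "list_all2 Q x es1" "list_all2 Q (concat bs) es2"
    by (auto simp: list_all2_append1)
  obtain cs where "concat cs = es2" "list_all2 (list_all2 Q) bs cs" using Cons.IH[OF es(3)] by blast
  then show ?case using es by (intro exI[of _ "es1 # cs"]) auto
qed auto

lemma adm_mono:
  assumes "adm b ds s" "list_all2 slot_le ds es"
  shows "adm b es s"
proof (cases "s = []")
  case False
  with assms(1) obtain bs where bs: "concat bs = ds" "[] \<notin> set bs"
    "list_all2 (block_ok b) s bs" by (auto simp: adm_def)
  obtain cs where cs: "concat cs = es" "list_all2 (list_all2 slot_le) bs cs"
    using list_all2_concat_split assms(2) bs(1) by blast
  have ok: "block_ok b x c" if blk: "block_ok b x blk" "list_all2 slot_le blk c" for x blk c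
  proof (cases b)
    case True
    then have "\<exists>d\<in>set blk. x \<le> order_bd d" using blk(1) by (simp add: block_ok_def)
    then obtain d where "d \<in> set blk" "x \<le> order_bd d" by blast
    moreover from this obtain e where "e \<in> set c" "slot_le d e"
      using blk(2) by (metis in_set_conv_nth list_all2_conv_all_nth)
    ultimately show ?thesis using True by (auto simp: block_ok_def slot_le_def intro!: bexI[of _ e])
  next
    case False
    have "sum_list (map order_bd blk) \<le> sum_list (map order_bd c)"
      using blk(2) by (induction rule: list_all2_induct) (auto simp: slot_le_def)
    then show ?thesis using blk(1) False by (simp add: block_ok_def)
  qed
  have "list_all2 (block_ok b) s cs"
    using list_all2_trans[of "block_ok b" "list_all2 slot_le" "block_ok b"] ok bs(3) cs(2) by blast
  moreover have "[] \<notin> set cs"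
    using bs(2) cs(2) by (metis in_set_conv_nth list_all2_Nil2 list_all2_conv_all_nth)
  moreover have "length (filter allow1 ds) \<le> length (filter allow1 es)"
    using assms(2) by (induction rule: list_all2_induct) (auto simp: slot_le_def)
  ultimately show ?thesis using assms(1) cs(1) False unfolding adm_def by (metis order_trans)
qed simp

lemma lower_adms_mono: "list_all2 slot_le ds es \<Longrightarrow> lower_adms b ds \<subseteq> lower_adms b es"
  using adm_mono by (auto simp: lower_adms_def dest: list_all2_lengthD)

section \<open>Partial fractions\<close>

context complex_subfield
begin

definition pf_sum :: "slot \<Rightarrow> (nat \<Rightarrow> nat \<Rightarrow> complex) \<Rightarrow> complex \<Rightarrow> complex" where
  "pf_sum d c z = (\<Sum>a=pmin d..pmax d. \<Sum>s=1..order_bd d. c a s / (z + of_nat a) ^ s)"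

definition off_poles :: "slot \<Rightarrow> complex \<Rightarrow> bool" where
  "off_poles d z \<longleftrightarrow> (\<forall>a\<in>{pmin d..pmax d}. z + of_nat a \<noteq> 0)"

definition pf_coeffs :: "slot \<Rightarrow> (nat \<Rightarrow> nat \<Rightarrow> complex) \<Rightarrow> bool" where
  "pf_coeffs d c \<longleftrightarrow> (\<forall>a s. c a s \<in> K) \<and> (\<not> allow1 d \<longrightarrow> (\<Sum>a=pmin d..pmax d. c a 1) = 0)"

text \<open>The identity is demanded at all complex points off the poles, not only at positive
  integers, because the symmetries evaluate the factors at points of the form - k + u.\<close>

definition pf_class :: "slot \<Rightarrow> (complex \<Rightarrow> complex) \<Rightarrow> bool" where
  "pf_class d f \<longleftrightarrow> (\<exists>c. pf_coeffs d c \<and> (\<forall>z. off_poles d z \<longrightarrow> f z = pf_sum d c z))"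

lemma pf_class_cong:
  "pf_class d f \<Longrightarrow> (\<And>z. off_poles d z \<Longrightarrow> g z = f z) \<Longrightarrow> pf_class d g"
  unfolding pf_class_def by metis

lemma pf_class_add:
  assumes "pf_class d f" "pf_class d g"
  shows "pf_class d (\<lambda>z. f z + g z)"
proof -
  obtain c where c: "pf_coeffs d c" "\<And>z. off_poles d z \<Longrightarrow> f z = pf_sum d c z"
    using assms(1) by (auto simp: pf_class_def)
  obtain c' where c': "pf_coeffs d c'" "\<And>z. off_poles d z \<Longrightarrow> g z = pf_sum d c' z"
    using assms(2) by (auto simp: pf_class_def)
  have "pf_sum d (\<lambda>a s. c a s + c' a s) z = pf_sum d c z + pf_sum d c' z" for z
    by (simp add: pf_sum_def add_divide_distrib sum.distrib)
  moreover have "pf_coeffs d (\<lambda>a s. c a s + c' a s)"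
    using c(1) c'(1) by (auto simp: pf_coeffs_def sum.distrib)
  ultimately show ?thesis
    unfolding pf_class_def using c(2) c'(2) by (intro exI[of _ "\<lambda>a s. c a s + c' a s"]) auto
qed

lemma pf_class_scale:
  assumes "pf_class d f" "k \<in> K"
  shows "pf_class d (\<lambda>z. k * f z)"
proof -
  obtain c where c: "pf_coeffs d c" "\<And>z. off_poles d z \<Longrightarrow> f z = pf_sum d c z"
    using assms(1) by (auto simp: pf_class_def)
  have "pf_sum d (\<lambda>a s. k * c a s) z = k * pf_sum d c z" for z
    by (simp add: pf_sum_def sum_distrib_left)
  moreover have "pf_coeffs d (\<lambda>a s. k * c a s)"
    using c(1) assms(2) by (auto simp: pf_coeffs_def simp flip: sum_distrib_left)
  ultimately show ?thesis
    unfolding pf_class_def using c(2) by (intro exI[of _ "\<lambda>a s. k * c a s"]) auto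
qed

lemma pf_class_0 [simp]: "pf_class d (\<lambda>z. 0)"
  unfolding pf_class_def
  by (intro exI[of _ "\<lambda>a s. 0"]) (auto simp: pf_coeffs_def pf_sum_def)

lemma pf_class_sum:
  "(\<And>i. i \<in> I \<Longrightarrow> pf_class d (f i)) \<Longrightarrow> pf_class d (\<lambda>z. \<Sum>i\<in>I. f i z)"
  by (induction I rule: infinite_finite_induct) (auto intro: pf_class_add)

lemma pf_class_pole:
  assumes "1 \<le> s" "s \<le> order_bd d" "pmin d \<le> a" "a \<le> pmax d" "s = 1 \<longrightarrow> allow1 d"
  shows "pf_class d (\<lambda>z. 1 / (z + of_nat a) ^ s)"
proof -
  let ?c = "\<lambda>b t::nat. if b = a then if t = s then 1 else 0 else 0 :: complex"
  have "(\<Sum>t=1..order_bd d. ?c b t / (z + of_nat b) ^ t) = (if b = a then 1 / (z + of_nat b) ^ s else 0)"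
    for b z
  proof -
    have "(\<Sum>t=1..order_bd d. ?c b t / (z + of_nat b) ^ t) =
        (\<Sum>t=1..order_bd d. if t = s then if b = a then 1 / (z + of_nat b) ^ t else 0 else 0)"
      by (rule sum.cong) auto
    also have "\<dots> = (if b = a then 1 / (z + of_nat b) ^ s else 0)"
      using assms(1,2) by (subst sum.delta) auto
    finally show ?thesis .
  qed
  then have "pf_sum d ?c z = 1 / (z + of_nat a) ^ s" for z
    using assms(3,4) by (simp add: pf_sum_def sum.delta)
  moreover have "pf_coeffs d ?c" using assms by (auto simp: pf_coeffs_def)
  ultimately show ?thesis unfolding pf_class_def by (intro exI[of _ ?c]) simp
qed

lemma pf_class_pole_diff:
  assumes "1 \<le> order_bd d" "pmin d \<le> a" "a \<le> pmax d" "pmin d \<le> b" "b \<le> pmax d"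
  shows "pf_class d (\<lambda>z. 1 / (z + of_nat a) - 1 / (z + of_nat b))"
proof -
  let ?c = "\<lambda>i t::nat. if t = 1 then (if i = a then 1 else 0) - (if i = b then 1 else 0) else 0 :: complex"
  have "pf_sum d ?c z = (\<Sum>i=pmin d..pmax d. (if i = a then 1 / (z + of_nat i) else 0) -
      (if i = b then 1 / (z + of_nat i) else 0))" for z
    unfolding pf_sum_def
  proof (intro sum.cong refl)
    fix i
    have "(\<Sum>t = 1..order_bd d. ?c i t / (z + of_nat i) ^ t) =
        (\<Sum>t = 1..order_bd d. if t = 1 then ?c i 1 / (z + of_nat i) ^ t else 0)"
      by (intro sum.cong) auto
    also have "\<dots> = ?c i 1 / (z + of_nat i)" using assms(1) by (subst sum.delta) auto
    finally show "(\<Sum>t = 1..order_bd d. ?c i t / (z + of_nat i) ^ t) =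
      (if i = a then 1 / (z + of_nat i) else 0) - (if i = b then 1 / (z + of_nat i) else 0)"
      by (auto simp: diff_divide_distrib)
  qed
  then have "pf_sum d ?c z = 1 / (z + of_nat a) - 1 / (z + of_nat b)" for z
    using assms by (simp add: sum_subtractf sum.delta)
  moreover have "pf_coeffs d ?c" using assms by (auto simp: pf_coeffs_def sum_subtractf)
  ultimately show ?thesis unfolding pf_class_def by (intro exI[of _ ?c]) simp
qed

text \<open>The residues of a product of two simple fractions add up to zero, since it decays
  quadratically.\<close>

lemma pf_class_pole_mult_distinct:
  assumes "a \<noteq> b" "a \<in> {lo..hi}" "b \<in> {lo..hi}" "s \<le> m" "t \<le> m" "s + t \<ge> 2"
  shows "pf_class (Slot m False lo hi) (\<lambda>z. 1 / (z + of_nat a) ^ s * (1 / (z + of_nat b) ^ t))"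
  using assms(4-6)
proof (induction "s + t" arbitrary: s t rule: less_induct)
  case less
  let ?d = "Slot m False lo hi"
  have ba: "(of_nat b - of_nat a :: complex) \<noteq> 0" using assms(1) by simp
  have K: "1 / (of_nat b - of_nat a :: complex) \<in> K" by (intro divide_closed diff_closed) auto
  have nz: "z + of_nat a \<noteq> 0 \<and> z + of_nat b \<noteq> 0" if "off_poles ?d z" for z
    using that assms(2,3) unfolding off_poles_def by auto
  \<comment> \<open>As \<open>s + t \<ge> 2\<close>, an exponent 0 leaves a pole of order at least
    2, which has no residue. Residues arise only from \<open>s = t = 1\<close>, as a pair of
    opposite ones.\<close>
  consider "s = 0" | "t = 0" | "s = 1" "t = 1" | "s \<ge> 1" "t \<ge> 1" "s + t > 2" using less.prems by linarith
  then show ?case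
  proof cases
    case 1
    then show ?thesis using pf_class_pole[of t ?d b] less.prems assms by simp
  next
    case 2
    then show ?thesis using pf_class_pole[of s ?d a] less.prems assms by simp
  next
    case 3
    have "pf_class ?d (\<lambda>z. 1 / (of_nat b - of_nat a) * (1 / (z + of_nat a) - 1 / (z + of_nat b)))"
      by (intro pf_class_scale pf_class_pole_diff K) (use less.prems 3 assms in auto)
    then show ?thesis
    proof (rule pf_class_cong)
      fix z assume "off_poles ?d z"
      with nz ba show "1 / (z + of_nat a) ^ s * (1 / (z + of_nat b) ^ t) =
          1 / (of_nat b - of_nat a) * (1 / (z + of_nat a) - 1 / (z + of_nat b))"
        unfolding 3 by (simp add: divide_simps)
    qed
  next
    case 4
    then obtain s' t' where st: "s = Suc s'" "t = Suc t'" by (metis Suc_le_D One_nat_def)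
    \<comment> \<open>The relation (z + b) - (z + a) = b - a replaces the product by two products
      whose total exponent is smaller by one.\<close>
    have "pf_class ?d (\<lambda>z. 1 / (of_nat b - of_nat a) *
       (1 / (z + of_nat a) ^ s * (1 / (z + of_nat b) ^ t') +
         (- 1) * (1 / (z + of_nat a) ^ s' * (1 / (z + of_nat b) ^ t))))"
      by (intro pf_class_scale pf_class_add less.hyps K) (use less.prems 4 st in auto)
    then show ?thesis
    proof (rule pf_class_cong)
      fix z assume "off_poles ?d z"
      note nz' = nz[OF this]
      define x y w where "x = z + of_nat a" and "y = z + of_nat b" and "w = (of_nat b - of_nat a :: complex)"
      have xy: "x \<noteq> 0" "y \<noteq> 0" "w \<noteq> 0" "y = x + w" using nz' ba by (auto simp: x_def y_def w_def)
      have "1 / x ^ s * (1 / y ^ t') + (- 1) * (1 / x ^ s' * (1 / y ^ t)) =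
          (y - x) / (x ^ s * y ^ t)"
        unfolding st using xy(1,2) by (simp add: field_simps)
      also have "\<dots> = w * (1 / x ^ s * (1 / y ^ t))" using xy(4) by simp
      finally show "1 / (z + of_nat a) ^ s * (1 / (z + of_nat b) ^ t) =
          1 / (of_nat b - of_nat a) * (1 / (z + of_nat a) ^ s * (1 / (z + of_nat b) ^ t') +
         (- 1) * (1 / (z + of_nat a) ^ s' * (1 / (z + of_nat b) ^ t)))"
        unfolding x_def[symmetric] y_def[symmetric] w_def[symmetric] using xy(3) by simp
    qed
  qed
qed

text \<open>Multiplying two sums of simple fractions gives quadratic decay, so the residues of the
  product add up to zero: a merged slot never allows the exponent 1. Orders add only at a common
  pole, which separation excludes.\<close>

definition merge_slots :: "bool \<Rightarrow> slot \<Rightarrow> slot \<Rightarrow> slot" where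
  "merge_slots b d d' = Slot (if b then max (order_bd d) (order_bd d') else order_bd d + order_bd d')
     False (min (pmin d) (pmin d')) (max (pmax d) (pmax d'))"

lemma pf_class_pole_mult:
  assumes "pf_class d' f" "1 \<le> s" "s \<le> order_bd d" "pmin d \<le> a" "a \<le> pmax d"
    and sep: "b \<longrightarrow> pmax d' < pmin d \<or> pmax d < pmin d'"
  shows "pf_class (merge_slots b d d') (\<lambda>z. 1 / (z + of_nat a) ^ s * f z)"
proof -
  let ?m = "merge_slots b d d'"
  obtain c where c: "pf_coeffs d' c" "\<And>z. off_poles d' z \<Longrightarrow> f z = pf_sum d' c z"
    using assms(1) by (auto simp: pf_class_def)
  have pp: "pf_class ?m (\<lambda>z. 1 / (z + of_nat a) ^ s * (1 / (z + of_nat e) ^ t))"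
    if et: "e \<in> {pmin d'..pmax d'}" "t \<in> {1..order_bd d'}" for e t
  proof (cases "a = e")
    case True
    then have "\<not> b" using sep assms(4,5) et by auto
    then have "pf_class ?m (\<lambda>z. 1 / (z + of_nat a) ^ (s + t))"
      using assms et by (intro pf_class_pole) (auto simp: merge_slots_def)
    then show ?thesis using True by (simp add: power_add)
  next
    case False
    then show ?thesis unfolding merge_slots_def
      by (intro pf_class_pole_mult_distinct) (use assms et in auto)
  qed
  have "pf_class ?m (\<lambda>z. \<Sum>e=pmin d'..pmax d'. \<Sum>t=1..order_bd d'.
      c e t * (1 / (z + of_nat a) ^ s * (1 / (z + of_nat e) ^ t)))"
    by (intro pf_class_sum pf_class_scale pp) (use c(1) in \<open>auto simp: pf_coeffs_def\<close>)
  then show ?thesis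
  proof (rule pf_class_cong)
    fix z assume "off_poles ?m z"
    then have "off_poles d' z"
      unfolding off_poles_def merge_slots_def by (simp add: min_le_iff_disj le_max_iff_disj)
    then show "1 / (z + of_nat a) ^ s * f z = (\<Sum>e=pmin d'..pmax d'. \<Sum>t=1..order_bd d'.
      c e t * (1 / (z + of_nat a) ^ s * (1 / (z + of_nat e) ^ t)))"
      by (simp add: c(2) pf_sum_def sum_distrib_left mult_ac)
  qed
qed

lemma off_poles_of_nat: "k > 0 \<Longrightarrow> off_poles d (of_nat k)"
  unfolding off_poles_def by (auto simp flip: of_nat_add)

text \<open>\<open>\<sigma> s\<close> collects the coefficients of order \<open>s\<close> over all
  poles. It is what remains of the factor once all its poles have been moved to one place.\<close>

definition slot_sig :: "slot \<Rightarrow> (nat \<Rightarrow> complex) \<Rightarrow> (nat \<Rightarrow> complex) \<Rightarrow> bool" where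
  "slot_sig d g \<sigma> \<longleftrightarrow> (\<exists>c. pf_coeffs d c \<and> (\<forall>k>0. g k = pf_sum d c (of_nat k)) \<and>
     \<sigma> = (\<lambda>s. \<Sum>a=pmin d..pmax d. c a s))"

definition slot_rep :: "slot \<Rightarrow> (nat \<Rightarrow> complex) \<Rightarrow> bool" where
  "slot_rep d g \<longleftrightarrow> (\<exists>f. pf_class d f \<and> (\<forall>k>0. g k = f (of_nat k)))"

lemma slot_rep_iff_sig: "slot_rep d g \<longleftrightarrow> (\<exists>\<sigma>. slot_sig d g \<sigma>)"
  unfolding slot_rep_def slot_sig_def pf_class_def using off_poles_of_nat by fastforce

lemma slot_rep_pole_mult:
  assumes "slot_rep d' g" "1 \<le> s" "s \<le> order_bd d" "pmin d \<le> a" "a \<le> pmax d"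
    and sep: "b \<longrightarrow> pmax d' < pmin d \<or> pmax d < pmin d'"
  shows "slot_rep (merge_slots b d d') (\<lambda>k. pole a s k * g k)"
proof -
  obtain f where "pf_class d' f" "\<forall>k>0. g k = f (of_nat k)" using assms(1) by (auto simp: slot_rep_def)
  then show ?thesis unfolding slot_rep_def
    using pf_class_pole_mult[of d' f s d a b] assms(2-) by (auto simp: pole_def)
qed

lemma pf_sum_bound: "\<exists>C. \<forall>k>0. norm (pf_sum d c (of_nat k)) \<le> C / real k"
proof -
  have "norm (pf_sum d c (of_nat k)) \<le> (\<Sum>a=pmin d..pmax d. \<Sum>s=1..order_bd d. norm (c a s)) / real k"
    if k: "k > 0" for k
  proof -
    have "norm (c a s / (of_nat k + of_nat a) ^ s) \<le> norm (c a s) * (1 / real k)" if "s \<ge> 1" for a s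
    proof -
      have "norm (c a s / (of_nat k + of_nat a) ^ s) = norm (c a s) * norm (pole a s k)"
        by (simp add: pole_def norm_mult norm_divide)
      also have "\<dots> \<le> norm (c a s) * (1 / real k)"
        by (intro mult_left_mono norm_pole_le) (use that k in auto)
      finally show ?thesis .
    qed
    then have "norm (pf_sum d c (of_nat k)) \<le>
        (\<Sum>a=pmin d..pmax d. \<Sum>s=1..order_bd d. norm (c a s) * (1 / real k))"
      unfolding pf_sum_def by (intro sum_norm_le) auto
    then show ?thesis by (simp add: sum_divide_distrib)
  qed
  then show ?thesis by blast
qed

lemma slot_rep_bound:
  assumes "slot_rep d g"
  shows "\<exists>C. \<forall>k>0. norm (g k) \<le> C / real k"
proof -
  obtain c where "\<forall>k>0. g k = pf_sum d c (of_nat k)"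
    using assms unfolding slot_rep_iff_sig slot_sig_def by blast
  then show ?thesis using pf_sum_bound[of d c] by simp
qed

section \<open>Products of simple fractions\<close>

text \<open>Decreasing order, and not just disjointness: this is the position of the intervals from
  \<open>r i\<close> to \<open>r i + n i\<close> under the hypothesis of condition (b), and also
  that of the poles belonging to multiple zeta values. Nonempty ranges are required so that
  \<open>sep_slots_pmin\<close> can count them.\<close>

definition sep_slots :: "slot list \<Rightarrow> bool" where
  "sep_slots ds \<longleftrightarrow> sorted_wrt (\<lambda>d d'. pmax d' < pmin d) ds \<and> (\<forall>d\<in>set ds. pmin d \<le> pmax d)"

definition regular :: "bool \<Rightarrow> slot list \<Rightarrow> bool" where
  "regular b ds \<longleftrightarrow> (b \<longrightarrow> sep_slots ds) \<and> (ds \<noteq> [] \<longrightarrow> \<not> allow1 (hd ds))"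

text \<open>Only neighbours are merged, so the hull of their ranges still lies between the ranges of
  the other slots; and a merged slot in first position does not allow the exponent 1.\<close>

lemma regular_merge:
  assumes "regular b (pre @ d # d' # post)"
  shows "regular b (pre @ merge_slots b d d' # post)"
proof -
  have "\<not> allow1 (hd (pre @ merge_slots b d d' # post))"
    using assms by (cases pre) (auto simp: regular_def merge_slots_def)
  then show ?thesis
    using assms by (auto simp: regular_def sep_slots_def sorted_wrt_append merge_slots_def)
qed

lemma regular_drop_last:
  assumes "regular b (pre @ [d])"
  shows "regular b pre"
  using assms by (cases pre) (auto simp: regular_def sep_slots_def sorted_wrt_append)

lemma adms_merge_subset: "adms b (pre @ merge_slots b d d' # post) \<subseteq> lower_adms b (pre @ d # d' # post)"
proof
  fix s assume s: "s \<in> adms b (pre @ merge_slots b d d' # post)"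
  then have "adm b (pre @ d # d' # post) s"
    by (intro adm_merge[of b pre "merge_slots b d d'"]) (auto simp: merge_slots_def)
  moreover have "length s \<le> length (pre @ merge_slots b d d' # post)" using s adm_length by blast
  ultimately show "s \<in> lower_adms b (pre @ d # d' # post)" by (auto simp: lower_adms_def)
qed

lemma adms_drop_last_subset: "adms b pre \<subseteq> lower_adms b (pre @ [d])"
  using adm_drop_last adm_length by (fastforce simp: lower_adms_def)

lemma merge_slots_commute: "merge_slots b d d' = merge_slots b d' d"
  by (auto simp: merge_slots_def max.commute min.commute)

lemma pole_in_K [simp]: "pole a s k \<in> K"
  unfolding pole_def by (intro divide_closed power_closed add_closed) auto

lemma pole_tendsto_0: "s \<ge> 1 \<Longrightarrow> (\<lambda>N. pole a s (Suc N)) \<longlonglongrightarrow> 0"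
proof (rule Lim_null_comparison)
  assume "s \<ge> 1"
  then have "norm (pole a s (Suc N)) \<le> 1 / real (Suc N)" for N by (rule norm_pole_le) simp
  then show "\<forall>\<^sub>F N in sequentially. norm (pole a s (Suc N)) \<le> 1 / real (Suc N)" by simp
  show "(\<lambda>N. 1 / real (Suc N)) \<longlonglongrightarrow> 0" using LIMSEQ_inverse_real_of_nat by (simp add: inverse_eq_divide)
qed

text \<open>The boundary term left by telescoping in the first variable: decay like 1/N against
  growth at most like the square root of N.\<close>

lemma pole_wsum_tendsto_0:
  assumes "s \<ge> 1" "list_all2 slot_rep ds fs"
  shows "(\<lambda>N. pole a s (Suc N) * wsum fs N) \<longlonglongrightarrow> 0"
proof -
  have "\<forall>f\<in>set fs. \<exists>C. \<forall>k>0. norm (f k) \<le> C / real k"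
    using assms(2) slot_rep_bound by (metis in_set_conv_nth list_all2_conv_all_nth)
  then obtain C where C: "C \<ge> 0" "\<And>N. norm (wsum fs N) \<le> C * sqrt (real N + 1)"
    using wsum_bound_sqrt by blast
  have *: "norm (pole a s (Suc N) * wsum fs N) \<le> C * (1 / sqrt (real (Suc N)))" for N
  proof -
    have "norm (pole a s (Suc N) * wsum fs N) \<le> 1 / real (Suc N) * (C * sqrt (real N + 1))"
      unfolding norm_mult using norm_pole_le[OF assms(1), of "Suc N" a] C by (intro mult_mono) auto
    also have "\<dots> = C * (sqrt (real (Suc N)) / real (Suc N))" by (simp add: add.commute)
    also have "sqrt (real (Suc N)) / real (Suc N) = 1 / sqrt (real (Suc N))"
      by (simp add: field_simps del: of_nat_Suc)
    finally show ?thesis .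
  qed
  have "(\<lambda>N. sqrt (1 / real (Suc N))) \<longlonglongrightarrow> sqrt 0"
    by (intro tendsto_real_sqrt) (use LIMSEQ_inverse_real_of_nat in \<open>simp add: inverse_eq_divide\<close>)
  then have "(\<lambda>N. C * (1 / sqrt (real (Suc N)))) \<longlonglongrightarrow> C * 0"
    by (intro tendsto_mult_left) (simp add: real_sqrt_divide)
  then have lim: "(\<lambda>N. C * (1 / sqrt (real (Suc N)))) \<longlonglongrightarrow> 0" by simp
  show ?thesis by (rule Lim_null_comparison[OF _ lim]) (use * in simp)
qed

section \<open>Moving poles at the cost of sums with fewer variables\<close>

definition reducible :: "bool \<Rightarrow> nat \<Rightarrow> bool" where
  "reducible b q \<longleftrightarrow> (\<forall>ds fs. length ds < q \<longrightarrow> regular b ds \<longrightarrow> list_all2 slot_rep ds fs \<longrightarrow>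
     lim_rep (adms b ds) (wsum fs))"

lemma reducibleD:
  "reducible b q \<Longrightarrow> length ds < q \<Longrightarrow> regular b ds \<Longrightarrow> list_all2 slot_rep ds fs \<Longrightarrow>
    lim_rep (adms b ds) (wsum fs)"
  by (simp add: reducible_def)

text \<open>Telescoping with \<open>u = pole a s\<close> hands the pole at \<open>a\<close> to the
  right neighbour and, since \<open>u (Suc k) = pole (Suc a) s k\<close>, the pole at
  \<open>Suc a\<close> to the left one. Both lie in the range of \<open>d\<close>, so they stay
  separated from the poles they are multiplied with, and each product is again a partial fraction
  sum for the merged slot.\<close>

lemma lim_rep_pole_Suc:
  assumes IH: "reducible b (length (dpre @ d # dpost))"
    and pre: "list_all2 slot_rep dpre fpre" and post: "list_all2 slot_rep dpost fpost"
    and reg: "regular b (dpre @ d # dpost)"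
    and s: "1 \<le> s" "s \<le> order_bd d" "pmin d \<le> a" "Suc a \<le> pmax d"
  shows "lim_rep (lower_adms b (dpre @ d # dpost))
    (wsum (fpre @ (\<lambda>k. pole a s k - pole (Suc a) s k) # fpost))"
    (is "lim_rep ?T (wsum (fpre @ ?g # fpost))")
proof -
  have tel: "?g k = pole a s k - pole a s (Suc k)" for k by (simp add: pole_def add_ac)
  have right: "lim_rep ?T (wsum (fpre @ (\<lambda>k. pole a s k * f k) # fpost'))"
    if dp: "dpost = e # dpost'" "fpost = f # fpost'" for e dpost' f fpost'
  proof (rule lim_rep_mono)
    show "adms b (dpre @ merge_slots b d e # dpost') \<subseteq> ?T"
      unfolding dp by (rule adms_merge_subset)
    have "regular b (dpre @ merge_slots b d e # dpost')"
      using reg unfolding dp by (rule regular_merge)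
    moreover have "slot_rep (merge_slots b d e) (\<lambda>k. pole a s k * f k)"
      by (rule slot_rep_pole_mult)
        (use s post reg in \<open>auto simp: dp regular_def sep_slots_def sorted_wrt_append\<close>)
    ultimately show "lim_rep (adms b (dpre @ merge_slots b d e # dpost'))
        (wsum (fpre @ (\<lambda>k. pole a s k * f k) # fpost'))"
      using pre post by (intro reducibleD[OF IH] list_all2_appendI) (auto simp: dp)
  qed
  have left: "lim_rep ?T (wsum (fpre' @ (\<lambda>k. pole a s (Suc k) * f k) # fpost))"
    if dp: "dpre = dpre' @ [e]" "fpre = fpre' @ [f]" for e dpre' f fpre'
  proof (rule lim_rep_mono)
    have pre': "list_all2 slot_rep dpre' fpre'" "slot_rep e f"
      using pre list_all2_lengthD[OF pre] by (auto simp: dp list_all2_append)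
    show "adms b (dpre' @ merge_slots b e d # dpost) \<subseteq> ?T"
      using adms_merge_subset[of b dpre' e d dpost] by (simp add: dp)
    have "regular b (dpre' @ merge_slots b e d # dpost)"
      using reg regular_merge[of b dpre' e d dpost] by (simp add: dp)
    moreover have "slot_rep (merge_slots b d e) (\<lambda>k. pole (Suc a) s k * f k)"
      by (rule slot_rep_pole_mult)
        (use s pre' reg in \<open>auto simp: dp regular_def sep_slots_def sorted_wrt_append\<close>)
    moreover have "pole (Suc a) s k = pole a s (Suc k)" for k by (simp add: pole_def add_ac)
    ultimately show "lim_rep (adms b (dpre' @ merge_slots b e d # dpost))
        (wsum (fpre' @ (\<lambda>k. pole a s (Suc k) * f k) # fpost))"
      using pre' post by (intro reducibleD[OF IH] list_all2_appendI) (auto simp: dp merge_slots_commute)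
  qed
  show ?thesis
  proof (cases fpost)
    case fNil: Nil
    then have dNil: "dpost = []" using post by simp
    \<comment> \<open>Without a right neighbour the variable starts at 1: the lower end contributes
      only the constant \<open>pole a s 1\<close> of \<open>K\<close>, and the slot
      disappears.\<close>
    have drop: "lim_rep ?T (wsum fpre)"
    proof (rule lim_rep_mono)
      show "adms b dpre \<subseteq> ?T" unfolding dNil by (rule adms_drop_last_subset)
      show "lim_rep (adms b dpre) (wsum fpre)"
        using IH reg pre unfolding dNil reducible_def by (auto dest: regular_drop_last)
    qed
    show ?thesis
    proof (cases fpre rule: rev_cases)
      case Nil
      have "wsum [?g] N = pole a s 1 * wsum fpre N - pole a s (Suc N)" for N
        unfolding Nil chain_sum.simps(1) mult_1_right by (rule wsum_telescope_last) (rule tel)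
      moreover have "lim_rep ?T (\<lambda>N. pole a s 1 * wsum fpre N - pole a s (Suc N))"
        by (intro lim_rep_diff lim_rep_scale drop lim_rep_0 pole_tendsto_0 s) simp
      ultimately have "lim_rep ?T (\<lambda>N. wsum [?g] N)" by (simp only:)
      then show ?thesis unfolding Nil fNil append_Nil .
    next
      case (snoc fpre' f)
      then obtain dpre' e where dp: "dpre = dpre' @ [e]" using pre by (cases dpre rule: rev_cases) auto
      have "wsum (fpre' @ [f, ?g]) N = pole a s 1 * wsum fpre N -
          wsum (fpre' @ [\<lambda>k. pole a s (Suc k) * f k]) N" for N
        unfolding snoc by (rule wsum_telescope_inner_last) (rule tel)
      moreover have "lim_rep ?T (\<lambda>N. pole a s 1 * wsum fpre N -
          wsum (fpre' @ [\<lambda>k. pole a s (Suc k) * f k]) N)"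
        using left[OF dp snoc] fNil by (intro lim_rep_diff lim_rep_scale drop) auto
      ultimately have "lim_rep ?T (\<lambda>N. wsum (fpre' @ [f, ?g]) N)" by (simp only:)
      then show ?thesis using snoc fNil by simp
    qed
  next
    case (Cons f fpost')
    then obtain e dpost' where dp: "dpost = e # dpost'" using post by (cases dpost) auto
    show ?thesis
    proof (cases fpre rule: rev_cases)
      case Nil
      have "wsum (?g # f # fpost') N = wsum ((\<lambda>k. pole a s k * f k) # fpost') N -
          pole a s (Suc N) * wsum (f # fpost') N" for N
        by (rule wsum_telescope) (rule tel)
      moreover have "lim_rep ?T (\<lambda>N. wsum ((\<lambda>k. pole a s k * f k) # fpost') N -
          pole a s (Suc N) * wsum (f # fpost') N)"
      proof (rule lim_rep_diff)
        show "lim_rep ?T (wsum ((\<lambda>k. pole a s k * f k) # fpost'))"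
          using right[OF dp Cons] unfolding Nil append_Nil .
        show "lim_rep ?T (\<lambda>N. pole a s (Suc N) * wsum (f # fpost') N)"
          by (rule lim_rep_0, rule pole_wsum_tendsto_0[OF s(1), of dpost]) (use post Cons in simp)
      qed
      ultimately have "lim_rep ?T (\<lambda>N. wsum (?g # f # fpost') N)" by (simp only:)
      then show ?thesis unfolding Nil Cons append_Nil .
    next
      case (snoc fpre' f')
      then obtain dpre' e' where dp': "dpre = dpre' @ [e']" using pre by (cases dpre rule: rev_cases) auto
      have "wsum (fpre' @ f' # ?g # f # fpost') N = wsum (fpre' @ f' # (\<lambda>k. pole a s k * f k) # fpost') N -
          wsum (fpre' @ (\<lambda>k. pole a s (Suc k) * f' k) # f # fpost') N" for N
        by (rule wsum_telescope_inner) (rule tel)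
      moreover have "lim_rep ?T (\<lambda>N. wsum (fpre' @ f' # (\<lambda>k. pole a s k * f k) # fpost') N -
          wsum (fpre' @ (\<lambda>k. pole a s (Suc k) * f' k) # f # fpost') N)"
        using right[OF dp Cons] left[OF dp' snoc] snoc Cons
        by (intro lim_rep_diff) auto
      ultimately have "lim_rep ?T (\<lambda>N. wsum (fpre' @ f' # ?g # f # fpost') N)" by (simp only:)
      then show ?thesis using snoc Cons by simp
    qed
  qed
qed

text \<open>A sum of unit shifts. Only the difference can be treated: for \<open>s = 1\<close> in
  the first slot the two sums may diverge separately.\<close>

lemma lim_rep_pole_diff:
  assumes IH: "reducible b (length (dpre @ d # dpost))"
    and pre: "list_all2 slot_rep dpre fpre" and post: "list_all2 slot_rep dpost fpost"
    and reg: "regular b (dpre @ d # dpost)"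
    and s: "1 \<le> s" "s \<le> order_bd d" "a \<in> {pmin d..pmax d}" "a' \<in> {pmin d..pmax d}"
  shows "lim_rep (lower_adms b (dpre @ d # dpost)) (wsum (fpre @ (\<lambda>k. pole a s k - pole a' s k) # fpost))"
proof -
  have *: "lim_rep (lower_adms b (dpre @ d # dpost)) (wsum (fpre @ (\<lambda>k. pole u s k - pole v s k) # fpost))"
    if "u \<le> v" "u \<in> {pmin d..pmax d}" "v \<in> {pmin d..pmax d}" for u v
  proof -
    have "(\<Sum>c=u..<v. pole c s k - pole (Suc c) s k) = pole u s k - pole v s k" for k
      using sum_Suc_diff'[OF that(1), of "\<lambda>c. - pole c s k"] by simp
    then have "(\<lambda>k. pole u s k - pole v s k) = (\<lambda>k. \<Sum>c=u..<v. pole c s k - pole (Suc c) s k)"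
      by simp
    moreover have "lim_rep (lower_adms b (dpre @ d # dpost))
        (\<lambda>N. \<Sum>c=u..<v. wsum (fpre @ (\<lambda>k. pole c s k - pole (Suc c) s k) # fpost) N)"
      by (intro lim_rep_sum lim_rep_pole_Suc IH pre post reg s) (use that in auto)
    ultimately show ?thesis by (simp only: wsum_sum_slot[abs_def])
  qed
  show ?thesis
  proof (cases "a \<le> a'")
    case False
    have "wsum (fpre @ (\<lambda>k. pole a s k - pole a' s k) # fpost) N =
        - 1 * wsum (fpre @ (\<lambda>k. pole a' s k - pole a s k) # fpost) N" for N
      using wsum_scale_slot[of fpre "- 1" "\<lambda>k. pole a' s k - pole a s k" fpost N] by simp
    moreover have "lim_rep (lower_adms b (dpre @ d # dpost))
        (\<lambda>N. - 1 * wsum (fpre @ (\<lambda>k. pole a' s k - pole a s k) # fpost) N)"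
      by (intro lim_rep_scale * s) (use False in auto)
    ultimately have "lim_rep (lower_adms b (dpre @ d # dpost))
        (\<lambda>N. wsum (fpre @ (\<lambda>k. pole a s k - pole a' s k) # fpost) N)" by (simp only:)
    then show ?thesis .
  qed (use * s in auto)
qed

text \<open>All poles of a slot are placed at the number of slots to its right. These are the
  positions in \<open>shifted_poles\<close>, for which the weak sum is a truncated multiple zeta
  value.\<close>

fun normalized :: "slot list \<Rightarrow> (nat \<Rightarrow> complex) list \<Rightarrow> (nat \<Rightarrow> complex) list" where
  "normalized (d # ds) (\<sigma> # \<sigma>s) =
     (\<lambda>k. \<Sum>s=1..order_bd d. \<sigma> s * pole (length ds) s k) # normalized ds \<sigma>s"
| "normalized _ _ = []"

fun normalized_slots :: "slot list \<Rightarrow> slot list" where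
  "normalized_slots [] = []"
| "normalized_slots (d # ds) = Slot (order_bd d) (allow1 d) (length ds) (length ds) # normalized_slots ds"

lemma length_normalized_slots [simp]: "length (normalized_slots ds) = length ds"
  by (induction ds) auto

lemma slot_le_normalized_slots:
  "list_all2 slot_le (normalized_slots ds) ds"
  by (induction ds) (auto simp: slot_le_def)

lemma sep_normalized_slots: "sep_slots (normalized_slots ds) \<and> (\<forall>d\<in>set (normalized_slots ds). pmax d < length ds)"
  by (induction ds) (auto simp: sep_slots_def)

lemma slot_sig_props:
  assumes "slot_sig d f \<sigma>"
  shows "\<sigma> s \<in> K" "\<not> allow1 d \<Longrightarrow> \<sigma> 1 = 0"
  using assms by (auto simp: slot_sig_def pf_coeffs_def)

lemma slot_rep_normalized:
  assumes "list_all2 (\<lambda>d (f, \<sigma>). slot_sig d f \<sigma>) ds fss"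
  shows "list_all2 slot_rep (normalized_slots ds) (normalized ds (map snd fss))"
  using assms
proof (induction ds fss rule: list_all2_induct)
  case (Cons d ds x fss)
  obtain f \<sigma> where x: "x = (f, \<sigma>)" by (cases x)
  then have sig: "slot_sig d f \<sigma>" using Cons by simp
  let ?d = "Slot (order_bd d) (allow1 d) (length ds) (length ds)"
  have "pf_class ?d (\<lambda>z. \<Sum>s=1..order_bd d. \<sigma> s * (1 / (z + of_nat (length ds)) ^ s))"
  proof (rule pf_class_sum)
    fix s assume s: "s \<in> {1..order_bd d}"
    show "pf_class ?d (\<lambda>z. \<sigma> s * (1 / (z + of_nat (length ds)) ^ s))"
    proof (cases "s = 1 \<and> \<not> allow1 d")
      case True
      then show ?thesis using slot_sig_props(2)[OF sig] by simp
    next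
      case False
      then show ?thesis
        by (intro pf_class_scale pf_class_pole slot_sig_props(1)[OF sig]) (use s in auto)
    qed
  qed
  then have "slot_rep ?d (\<lambda>k. \<Sum>s=1..order_bd d. \<sigma> s * pole (length ds) s k)"
    unfolding slot_rep_def pole_def by (intro exI conjI) auto
  then show ?case using Cons x by simp
qed simp

text \<open>Each slot to the right occupies at least one natural number below \<open>pmin d\<close>.
  So under separation the target position of a slot is never above its range.\<close>

lemma sep_slots_pmin: "sep_slots (d # ds) \<Longrightarrow> length ds \<le> pmin d"
proof (induction ds arbitrary: d)
  case (Cons e ds)
  then have "length ds \<le> pmin e" by (auto simp: sep_slots_def)
  also have "\<dots> \<le> pmax e" using Cons.prems by (auto simp: sep_slots_def)
  also have "\<dots> < pmin d" using Cons.prems by (auto simp: sep_slots_def)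
  finally show ?case by simp
qed simp

text \<open>Slots are normalized from the right: then the poles passed on while shifting a slot stay
  above those of the slots to its right.\<close>

lemma lim_rep_normalize:
  assumes IH: "reducible b (length (dpre @ ds))"
    and pre: "list_all2 slot_rep dpre fpre"
    and reg: "regular b (dpre @ ds)"
    and sig: "list_all2 (\<lambda>d (f, \<sigma>). slot_sig d f \<sigma>) ds fss"
  shows "lim_rep (lower_adms b (dpre @ ds))
    (\<lambda>N. wsum (fpre @ map fst fss) N - wsum (fpre @ normalized ds (map snd fss)) N)"
  using sig IH pre reg
proof (induction ds fss arbitrary: dpre fpre rule: list_all2_induct)
  case Nil
  then show ?case by (simp add: lim_rep_0)
next
  case (Cons d ds x fss)
  obtain f \<sigma> where x: "x = (f, \<sigma>)" by (cases x)
  then have sig: "slot_sig d f \<sigma>" using Cons by simp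
  let ?q = "length ds" and ?T = "lower_adms b (dpre @ d # ds)"
  let ?n = "normalized ds (map snd fss)"
  let ?h = "\<lambda>k. \<Sum>s=1..order_bd d. \<sigma> s * pole ?q s k"
  have "slot_rep d f" using sig slot_rep_iff_sig by blast
  then have "lim_rep (lower_adms b ((dpre @ [d]) @ ds))
      (\<lambda>N. wsum ((fpre @ [f]) @ map fst fss) N - wsum ((fpre @ [f]) @ ?n) N)"
    using Cons.prems by (intro Cons.IH) (auto intro: list_all2_appendI)
  then have rest: "lim_rep ?T (\<lambda>N. wsum (fpre @ f # map fst fss) N - wsum (fpre @ f # ?n) N)"
    by simp
  obtain c where c: "pf_coeffs d c" "\<And>k. k > 0 \<Longrightarrow> f k = pf_sum d c (of_nat k)"
    "\<sigma> = (\<lambda>s. \<Sum>a=pmin d..pmax d. c a s)"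
    using sig unfolding slot_sig_def by blast
  \<comment> \<open>The range is enlarged so as to contain the whole path from the poles of
    \<open>d\<close> to the target \<open>?q\<close>. Under separation it only grows downwards, and
    the slots to the right, already normalized, lie below \<open>?q\<close>.\<close>
  define d' where "d' = Slot (order_bd d) (allow1 d) (min (pmin d) ?q) (max (pmax d) ?q)"
  define ds' where "ds' = dpre @ d' # normalized_slots ds"
  have le: "list_all2 slot_le ds' (dpre @ d # ds)"
    unfolding ds'_def
    by (intro list_all2_appendI list_all2_Cons[THEN iffD2] conjI slot_le_normalized_slots)
      (auto simp: slot_le_def d'_def list_all2_same)
  have reg': "regular b ds'"
  proof -
    have "sep_slots ds'" if b
    proof -
      have sp: "sep_slots (dpre @ d # ds)" using Cons.prems(3) that by (simp add: regular_def)
      have "sep_slots (d # ds)" using sp by (auto simp: sep_slots_def sorted_wrt_append)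
      then have q: "?q \<le> pmin d" "pmin d \<le> pmax d" using sep_slots_pmin by (auto simp: sep_slots_def)
      have lt: "pmax e < ?q" if "e \<in> set (normalized_slots ds)" for e
        using sep_normalized_slots that by blast
      have "pmax e < pmin u" if "u \<in> set dpre" "e \<in> set (normalized_slots ds)" for u e
        using lt[OF that(2)] q sp that(1) by (auto simp: sep_slots_def sorted_wrt_append)
      then show ?thesis
        using sp q lt sep_normalized_slots[of ds] unfolding ds'_def d'_def
        by (auto simp: sep_slots_def sorted_wrt_append)
    qed
    moreover have "\<not> allow1 (hd ds')"
      using Cons.prems(3) by (cases dpre) (auto simp: regular_def ds'_def d'_def)
    ultimately show ?thesis by (simp add: regular_def)
  qed
  have diff: "lim_rep ?T (wsum (fpre @ (\<lambda>k. pole a s k - pole ?q s k) # ?n))"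
    if "a \<in> {pmin d..pmax d}" "s \<in> {1..order_bd d}" for a s
  proof (rule lim_rep_mono)
    show "lower_adms b ds' \<subseteq> ?T" by (rule lower_adms_mono[OF le])
    show "lim_rep (lower_adms b ds') (wsum (fpre @ (\<lambda>k. pole a s k - pole ?q s k) # ?n))"
      unfolding ds'_def
    proof (rule lim_rep_pole_diff)
      show "reducible b (length (dpre @ d' # normalized_slots ds))"
        using Cons.prems(1) by simp
      show "list_all2 slot_rep (normalized_slots ds) ?n"
        using Cons.hyps by (intro slot_rep_normalized)
    qed (use Cons.prems that reg' in \<open>auto simp: ds'_def d'_def\<close>)
  qed
  have fh: "f k - ?h k = (\<Sum>a=pmin d..pmax d. \<Sum>s=1..order_bd d. c a s * (pole a s k - pole ?q s k))"
    if "k > 0" for k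
  proof -
    have "?h k = (\<Sum>a=pmin d..pmax d. \<Sum>s=1..order_bd d. c a s * pole ?q s k)"
      unfolding c(3) sum_distrib_right by (rule sum.swap)
    then show ?thesis
      by (simp add: c(2)[OF that] pf_sum_def pole_def sum_subtractf right_diff_distrib)
  qed
  have "wsum (fpre @ f # ?n) N - wsum (fpre @ ?h # ?n) N =
      (\<Sum>a=pmin d..pmax d. \<Sum>s=1..order_bd d. c a s *
        wsum (fpre @ (\<lambda>k. pole a s k - pole ?q s k) # ?n) N)" for N
  proof -
    have "wsum (fpre @ f # ?n) N - wsum (fpre @ ?h # ?n) N = wsum (fpre @ (\<lambda>k. f k - ?h k) # ?n) N"
      by (rule wsum_diff_slot[symmetric])
    also have "\<dots> = wsum (fpre @ (\<lambda>k. \<Sum>a=pmin d..pmax d. \<Sum>s=1..order_bd d.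
        c a s * (pole a s k - pole ?q s k)) # ?n) N"
      by (subst wsum_cong_slot[OF fh]) auto
    finally show ?thesis by (simp only: wsum_sum_slot wsum_scale_slot)
  qed
  moreover have "lim_rep ?T (\<lambda>N. \<Sum>a=pmin d..pmax d. \<Sum>s=1..order_bd d. c a s *
        wsum (fpre @ (\<lambda>k. pole a s k - pole ?q s k) # ?n) N)"
    by (intro lim_rep_sum lim_rep_scale diff) (use c(1) in \<open>auto simp: pf_coeffs_def\<close>)
  ultimately have "lim_rep ?T (\<lambda>N. wsum (fpre @ f # ?n) N - wsum (fpre @ ?h # ?n) N)"
    by (simp only:)
  from lim_rep_add[OF rest this] show ?case by (simp add: x)
qed

fun exponents :: "slot list \<Rightarrow> nat list set" where
  "exponents [] = {[]}"
| "exponents (d # ds) = (\<lambda>(x, xs). x # xs) ` ({1..order_bd d} \<times> exponents ds)"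

fun weight :: "(nat \<Rightarrow> complex) list \<Rightarrow> nat list \<Rightarrow> complex" where
  "weight (\<sigma> # \<sigma>s) (x # xs) = \<sigma> x * weight \<sigma>s xs"
| "weight _ _ = 1"

lemma finite_exponents [simp]: "finite (exponents ds)"
  by (induction ds) auto

lemma exponents_iff: "s \<in> exponents ds \<longleftrightarrow> list_all2 (\<lambda>x d. 1 \<le> x \<and> x \<le> order_bd d) s ds"
  by (induction ds arbitrary: s) (auto simp: list_all2_Cons2 image_iff)

lemma wsum_normalized:
  assumes "length \<sigma>s = length ds"
  shows "wsum (normalized ds \<sigma>s) N = (\<Sum>s\<in>exponents ds. weight \<sigma>s s * wsum (shifted_poles s) N)"
  using assms
proof (induction ds \<sigma>s arbitrary: N rule: normalized.induct)
  case (1 d ds \<sigma> \<sigma>s)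
  have len: "length s = length ds" if "s \<in> exponents ds" for s
    using that by (auto simp: exponents_iff dest: list_all2_lengthD)
  have "wsum (normalized (d # ds) (\<sigma> # \<sigma>s)) N = (\<Sum>k=1..N. \<Sum>x=1..order_bd d. \<Sum>s\<in>exponents ds.
      \<sigma> x * pole (length ds) x k * (weight \<sigma>s s * wsum (shifted_poles s) k))"
    using 1 by (simp add: sum_product)
  also have "\<dots> = (\<Sum>x=1..order_bd d. \<Sum>s\<in>exponents ds. \<Sum>k=1..N.
      \<sigma> x * pole (length ds) x k * (weight \<sigma>s s * wsum (shifted_poles s) k))"
    by (subst sum.swap, intro sum.cong refl, rule sum.swap)
  also have "\<dots> = (\<Sum>x=1..order_bd d. \<Sum>s\<in>exponents ds.
      weight (\<sigma> # \<sigma>s) (x # s) * wsum (shifted_poles (x # s)) N)"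
    by (intro sum.cong refl) (simp add: sum_distrib_left len mult_ac)
  also have "\<dots> = (\<Sum>s\<in>exponents (d # ds). weight (\<sigma> # \<sigma>s) s * wsum (shifted_poles s) N)"
    unfolding exponents.simps sum.cartesian_product
    by (subst sum.reindex) (auto simp: inj_on_def case_prod_unfold)
  finally show ?case .
qed auto

text \<open>Every slot forms a block of its own. A nonzero weight rules out the exponent 1 wherever
  the sum of residues is zero; applied to the first slot, this gives the first exponent at least
  2.\<close>

lemma exponents_adm:
  assumes "s \<in> exponents ds" "weight \<sigma>s s \<noteq> 0" "ds \<noteq> [] \<longrightarrow> \<not> allow1 (hd ds)"
    "list_all2 (\<lambda>d \<sigma>. \<not> allow1 d \<longrightarrow> \<sigma> 1 = 0) ds \<sigma>s"
  shows "adm b ds s"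
proof -
  have 1: "list_all2 (\<lambda>x d. 1 \<le> x \<and> x \<le> order_bd d \<and> (x = 1 \<longrightarrow> allow1 d)) s ds"
    using assms(4,1,2)
  proof (induction ds \<sigma>s arbitrary: s rule: list_all2_induct)
    case (Cons d ds \<sigma> \<sigma>s)
    then show ?case by (auto; metis)
  qed simp
  then have "length (filter ((=) 1) s) \<le> length (filter allow1 ds)"
    by (induction rule: list_all2_induct) auto
  moreover have "list_all2 (block_ok b) s (map (\<lambda>d. [d]) ds)"
    using 1 by (auto simp: list_all2_conv_all_nth block_ok_def)
  moreover have "concat (map (\<lambda>d. [d]) ds) = ds" "[] \<notin> set (map (\<lambda>d. [d]) ds)" by (auto simp: concat_map_singleton)
  moreover have "0 \<notin> set s" using 1 by (fastforce simp: list_all2_conv_all_nth in_set_conv_nth)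
  moreover have "s ! 0 \<ge> 2" if ne: "s \<noteq> []"
  proof -
    obtain x xs where s: "s = x # xs" using ne by (cases s) auto
    then obtain d ds' where d: "ds = d # ds'" "1 \<le> x" "x = 1 \<longrightarrow> allow1 d"
      using 1 by (auto simp: list_all2_Cons1)
    then have "x \<noteq> 1" using assms(3) by auto
    then show ?thesis using d(2) s by simp
  qed
  ultimately show ?thesis unfolding adm_def by blast
qed

lemma weight_in_K:
  assumes "\<forall>\<sigma>\<in>set \<sigma>s. \<forall>s. \<sigma> s \<in> K"
  shows "weight \<sigma>s s \<in> K"
  using assms by (induction \<sigma>s s rule: weight.induct) auto

definition top_value :: "slot list \<Rightarrow> (nat \<Rightarrow> complex) list \<Rightarrow> complex" where
  "top_value ds \<sigma>s = (\<Sum>s\<in>exponents ds. weight \<sigma>s s * mzv s)"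

lemma wsum_normalized_tendsto:
  assumes "ds \<noteq> [] \<longrightarrow> \<not> allow1 (hd ds)" "list_all2 (\<lambda>d \<sigma>. \<not> allow1 d \<longrightarrow> \<sigma> 1 = 0) ds \<sigma>s"
  shows "wsum (normalized ds \<sigma>s) \<longlonglongrightarrow> top_value ds \<sigma>s"
proof -
  have "(\<lambda>N. \<Sum>s\<in>exponents ds. weight \<sigma>s s * wsum (shifted_poles s) N) \<longlonglongrightarrow> top_value ds \<sigma>s"
    unfolding top_value_def
  proof (rule tendsto_sum)
    fix s assume s: "s \<in> exponents ds"
    show "(\<lambda>N. weight \<sigma>s s * wsum (shifted_poles s) N) \<longlonglongrightarrow> weight \<sigma>s s * mzv s"
    proof (cases "weight \<sigma>s s = 0")
      case False
      have "adm True ds s" by (rule exponents_adm[OF s False assms])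
      then show ?thesis
        by (intro tendsto_mult_left wsum_shifted_poles_tendsto) (auto simp: adm_def)
    qed simp
  qed
  moreover have "wsum (normalized ds \<sigma>s) =
      (\<lambda>N. \<Sum>s\<in>exponents ds. weight \<sigma>s s * wsum (shifted_poles s) N)"
    by (rule ext, rule wsum_normalized) (use list_all2_lengthD[OF assms(2)] in simp)
  ultimately show ?thesis by (simp only:)
qed

text \<open>The full depth term is kept in explicit form for the symmetry argument, separately from
  the error. The induction on the number of variables needs only that both together lie in the span
  of the admissible values.\<close>

lemma lim_rep_reduce:
  assumes IH: "reducible b (length ds)" and reg: "regular b ds"
    and sig: "list_all2 (\<lambda>d (f, \<sigma>). slot_sig d f \<sigma>) ds fss"
  shows "lim_rep (lower_adms b ds) (\<lambda>N. wsum (map fst fss) N - top_value ds (map snd fss))"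
    and "top_value ds (map snd fss) \<in> zspan (adms b ds)"
proof -
  have flags: "list_all2 (\<lambda>d \<sigma>. \<not> allow1 d \<longrightarrow> \<sigma> 1 = 0) ds (map snd fss)"
    using sig by (induction rule: list_all2_induct) (auto dest: slot_sig_props(2))
  have hd: "ds \<noteq> [] \<longrightarrow> \<not> allow1 (hd ds)" using reg by (simp add: regular_def)
  have "lim_rep (lower_adms b ds) (\<lambda>N. wsum (map fst fss) N - wsum (normalized ds (map snd fss)) N)"
    using lim_rep_normalize[of b "[]" ds "[]" fss] IH reg sig by simp
  moreover have "lim_rep (lower_adms b ds)
      (\<lambda>N. wsum (normalized ds (map snd fss)) N - top_value ds (map snd fss))"
    by (rule lim_rep_0) (use wsum_normalized_tendsto[OF hd flags] in \<open>simp add: LIM_zero_iff\<close>)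
  ultimately have "lim_rep (lower_adms b ds)
    (\<lambda>N. (wsum (map fst fss) N - wsum (normalized ds (map snd fss)) N) +
      (wsum (normalized ds (map snd fss)) N - top_value ds (map snd fss)))" by (rule lim_rep_add)
  then show "lim_rep (lower_adms b ds) (\<lambda>N. wsum (map fst fss) N - top_value ds (map snd fss))"
    by simp
  have K: "\<forall>\<sigma>\<in>set (map snd fss). \<forall>s. \<sigma> s \<in> K"
    using sig by (induction rule: list_all2_induct) (auto dest: slot_sig_props(1))
  show "top_value ds (map snd fss) \<in> zspan (adms b ds)"
    unfolding top_value_def
  proof (rule zspan_sum)
    fix s assume s: "s \<in> exponents ds"
    show "weight (map snd fss) s * mzv s \<in> zspan (adms b ds)"
    proof (cases "weight (map snd fss) s = 0")
      case False
      then show ?thesis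
        using exponents_adm[OF s False hd flags, of b] by (intro zspan_scale zspan_mzv weight_in_K K) simp
    qed simp
  qed
qed

lemma lower_adms_subset: "lower_adms b ds \<subseteq> adms b ds"
  by (auto simp: lower_adms_def)

lemma reducible: "reducible b q"
proof (induction q)
  case (Suc q)
  show ?case unfolding reducible_def
  proof (intro allI impI)
    fix ds fs assume ds: "length ds < Suc q" and reg: "regular b ds" and "list_all2 slot_rep ds fs"
    then obtain \<sigma> where sig: "list_all2 (\<lambda>d (f, \<sigma>). slot_sig d f \<sigma>) ds (map (\<lambda>(d, f). (f, \<sigma> d f)) (zip ds fs))"
      and len: "length ds = length fs"
    proof -
      assume rep: "list_all2 slot_rep ds fs"
      define \<sigma> where "\<sigma> d f = (SOME \<sigma>. slot_sig d f \<sigma>)" for d f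
      have "slot_sig d f (\<sigma> d f)" if "slot_rep d f" for d f
        using that unfolding slot_rep_iff_sig \<sigma>_def by (rule someI_ex)
      then have "list_all2 (\<lambda>d (f, \<sigma>). slot_sig d f \<sigma>) ds (map (\<lambda>(d, f). (f, \<sigma> d f)) (zip ds fs))"
        using rep by (auto simp: list_all2_conv_all_nth)
      then show ?thesis using that rep list_all2_lengthD by blast
    qed
    let ?fss = "map (\<lambda>(d, f). (f, \<sigma> d f)) (zip ds fs)"
    have fs: "map fst ?fss = fs" using len by (intro nth_equalityI) auto
    have red: "reducible b (length ds)" using Suc ds unfolding reducible_def by auto
    have "lim_rep (adms b ds) (\<lambda>N. wsum (map fst ?fss) N - top_value ds (map snd ?fss))"
      by (rule lim_rep_mono[OF lim_rep_reduce(1)[OF red reg sig] lower_adms_subset])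
    moreover have "lim_rep (adms b ds) (\<lambda>N. top_value ds (map snd ?fss))"
      using lim_rep_reduce(2)[OF red reg sig] unfolding lim_rep_def by blast
    ultimately have "lim_rep (adms b ds) (\<lambda>N. (wsum (map fst ?fss) N - top_value ds (map snd ?fss)) +
        top_value ds (map snd ?fss))" by (rule lim_rep_add)
    then show "lim_rep (adms b ds) (wsum fs)" unfolding fs by simp
  qed
qed (simp add: reducible_def)

section \<open>Polynomial parts\<close>

definition K_poly :: "complex poly \<Rightarrow> bool" where
  "K_poly q \<longleftrightarrow> (\<forall>i. poly.coeff q i \<in> K)"

lemma K_poly_0 [simp]: "K_poly 0"
  by (simp add: K_poly_def)

lemma K_poly_pCons [simp]: "K_poly (pCons a q) \<longleftrightarrow> a \<in> K \<and> K_poly q"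
  unfolding K_poly_def by (auto simp: Polynomial.coeff_pCons split: nat.splits)

lemma K_poly_1 [simp]: "K_poly 1"
  by (simp add: one_pCons)

lemma K_poly_add: "K_poly p \<Longrightarrow> K_poly q \<Longrightarrow> K_poly (p + q)"
  by (auto simp: K_poly_def)

lemma K_poly_diff: "K_poly p \<Longrightarrow> K_poly q \<Longrightarrow> K_poly (p - q)"
  by (auto simp: K_poly_def)

lemma K_poly_smult: "c \<in> K \<Longrightarrow> K_poly q \<Longrightarrow> K_poly (Polynomial.smult c q)"
  by (auto simp: K_poly_def)

lemma K_poly_mult: "K_poly p \<Longrightarrow> K_poly q \<Longrightarrow> K_poly (p * q)"
  unfolding K_poly_def Polynomial.coeff_mult by auto

lemma K_poly_power: "K_poly p \<Longrightarrow> K_poly (p ^ n)"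
  by (induction n) (auto intro: K_poly_mult)

section \<open>Summation of polynomials\<close>

definition summatory :: "complex poly \<Rightarrow> complex poly \<Rightarrow> bool" where
  "summatory q' q \<longleftrightarrow> K_poly q' \<and> (\<forall>k::nat. poly q' (of_nat k) = (\<Sum>j=1..k. poly q (of_nat j)))"

text \<open>For the rising factorial (x)_t = x (x+1) ... (x+t-1), the sum of (j)_t over j from 1 to
  k is (k)_(t+1) / (t+1), and t+1 is invertible in \<open>K\<close>.\<close>

lemma summatory_pochhammer:
  "\<exists>q'. summatory q' (pochhammer [:0, 1:] t)"
proof -
  let ?p = "\<lambda>t. pochhammer [:0, 1 :: complex:] t"
  have P: "poly (?p t) x = pochhammer x t" for t x
    by (induction t) (auto simp: pochhammer_Suc)
  have K: "K_poly (?p t)" for t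
    by (induction t) (auto simp: pochhammer_Suc of_nat_poly intro!: K_poly_add K_poly_smult)
  have "pochhammer (of_nat k) (Suc t) / of_nat (Suc t) = (\<Sum>j=1..k. pochhammer (of_nat j :: complex) t)" for k
  proof (induction k)
    case 0
    show ?case by (simp add: pochhammer_rec)
  next
    case (Suc k)
    define x where "x = pochhammer (of_nat (Suc k) :: complex) t"
    have 1: "pochhammer (of_nat k :: complex) (Suc t) = of_nat k * x"
      by (simp add: x_def pochhammer_rec add.commute)
    have "of_nat (Suc k) + of_nat t = of_nat k + (of_nat (Suc t) :: complex)" by simp
    then have 2: "pochhammer (of_nat (Suc k) :: complex) (Suc t) = x * (of_nat k + of_nat (Suc t))"
      by (simp only: x_def pochhammer_Suc)
    have "x * (of_nat k + of_nat (Suc t)) / of_nat (Suc t) = of_nat k * x / of_nat (Suc t) + x"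
      by (simp add: distrib_left add_divide_distrib mult.commute del: of_nat_Suc)
    then have "pochhammer (of_nat (Suc k) :: complex) (Suc t) / of_nat (Suc t) =
        pochhammer (of_nat k) (Suc t) / of_nat (Suc t) + pochhammer (of_nat (Suc k)) t"
      unfolding 1 2 x_def .
    then show ?case using Suc by simp
  qed
  then have "summatory (Polynomial.smult (1 / of_nat (Suc t)) (?p (Suc t))) (?p t)"
    unfolding summatory_def using K by (auto simp: P simp del: of_nat_Suc intro!: K_poly_smult divide_closed)
  then show ?thesis by blast
qed

lemma summatory_linear:
  assumes "summatory p' p" "summatory q' q" "c \<in> K"
  shows "summatory (Polynomial.smult c p' + q') (Polynomial.smult c p + q)"
  using assms
  by (auto simp: summatory_def sum.distrib sum_distrib_left intro!: K_poly_add K_poly_smult)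

lemma ex_summatory:
  assumes "K_poly q"
  shows "\<exists>q'. summatory q' q"
proof -
  \<comment> \<open>The additional factor (X)_t makes the induction over coefficients work: X (X)_t
    = (X)_(t+1) - t (X)_t expresses the polynomial through rising factorials.\<close>
  have "\<exists>q'. summatory q' (pochhammer [:0, 1:] t * q)" for t
    using assms
  proof (induction q arbitrary: t)
    case 0
    have "summatory 0 0" by (simp add: summatory_def)
    then show ?case by auto
  next
    case (pCons a q)
    let ?p = "\<lambda>t. pochhammer [:0, 1 :: complex:] t"
    have K: "a \<in> K" "K_poly q" using pCons.prems by auto
    have "?p (Suc t) = ?p t * ([:0, 1:] + of_nat t)" by (rule pochhammer_Suc)
    then have X: "[:0, 1:] * ?p t = Polynomial.smult (- of_nat t) (?p t) + ?p (Suc t)"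
      by (simp add: algebra_simps of_nat_poly)
    have "?p t * pCons a q = Polynomial.smult a (?p t) + ([:0, 1:] * ?p t) * q"
      by (simp add: algebra_simps)
    also have "\<dots> = Polynomial.smult a (?p t) + (Polynomial.smult (- of_nat t) (?p t * q) + ?p (Suc t) * q)"
      unfolding X by (simp add: algebra_simps)
    finally have eq: "?p t * pCons a q = Polynomial.smult a (?p t) + (Polynomial.smult (- of_nat t) (?p t * q) + ?p (Suc t) * q)" .
    obtain u v w where "summatory u (?p t)" "summatory v (?p t * q)" "summatory w (?p (Suc t) * q)"
      using summatory_pochhammer pCons.IH[OF K(2)] by metis
    moreover have "- of_nat t \<in> K" by auto
    ultimately have "summatory (Polynomial.smult a u + (Polynomial.smult (- of_nat t) v + w)) (?p t * pCons a q)"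
      unfolding eq using K by (intro summatory_linear)
    then show ?case by blast
  qed
  from this[of 0] show ?thesis by simp
qed

section \<open>Functions that are a polynomial plus partial fractions\<close>

definition free_slot :: "slot \<Rightarrow> slot" where
  "free_slot d = Slot (order_bd d) True (pmin d) (pmax d)"

lemma off_poles_free [simp]: "off_poles (free_slot d) = off_poles d"
  by (simp add: off_poles_def free_slot_def fun_eq_iff)

lemma pf_class_free: "pf_class d f \<Longrightarrow> pf_class (free_slot d) f"
  unfolding pf_class_def off_poles_free by (auto simp: pf_coeffs_def pf_sum_def free_slot_def)

definition quasi_pf :: "slot \<Rightarrow> (complex \<Rightarrow> complex) \<Rightarrow> bool" where
  "quasi_pf d f \<longleftrightarrow> (\<exists>q g. K_poly q \<and> pf_class (free_slot d) g \<and>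
     (\<forall>z. off_poles d z \<longrightarrow> f z = poly q z + g z))"

lemma quasi_pf_cong:
  "quasi_pf d f \<Longrightarrow> (\<And>z. off_poles d z \<Longrightarrow> g z = f z) \<Longrightarrow> quasi_pf d g"
  unfolding quasi_pf_def by metis

lemma quasi_pf_pf: "pf_class (free_slot d) f \<Longrightarrow> quasi_pf d f"
  unfolding quasi_pf_def by (intro exI[of _ 0] exI[of _ f]) auto

lemma quasi_pf_poly: "K_poly q \<Longrightarrow> quasi_pf d (poly q)"
  unfolding quasi_pf_def by (intro exI[of _ q] exI[of _ "\<lambda>z. 0"]) auto

lemma quasi_pf_const: "c \<in> K \<Longrightarrow> quasi_pf d (\<lambda>z. c)"
  by (rule quasi_pf_cong[OF quasi_pf_poly[of "[:c:]"]]) auto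

lemma quasi_pf_add:
  assumes "quasi_pf d f" "quasi_pf d f'"
  shows "quasi_pf d (\<lambda>z. f z + f' z)"
proof -
  obtain q g where 1: "K_poly q" "pf_class (free_slot d) g" "\<And>z. off_poles d z \<Longrightarrow> f z = poly q z + g z"
    using assms(1) by (auto simp: quasi_pf_def)
  obtain q' g' where 2: "K_poly q'" "pf_class (free_slot d) g'" "\<And>z. off_poles d z \<Longrightarrow> f' z = poly q' z + g' z"
    using assms(2) by (auto simp: quasi_pf_def)
  show ?thesis unfolding quasi_pf_def
    by (intro exI[of _ "q + q'"] exI[of _ "\<lambda>z. g z + g' z"])
      (use 1 2 in \<open>auto intro: K_poly_add pf_class_add\<close>)
qed

lemma quasi_pf_scale:
  assumes "quasi_pf d f" "c \<in> K"
  shows "quasi_pf d (\<lambda>z. c * f z)"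
proof -
  obtain q g where 1: "K_poly q" "pf_class (free_slot d) g" "\<And>z. off_poles d z \<Longrightarrow> f z = poly q z + g z"
    using assms(1) by (auto simp: quasi_pf_def)
  show ?thesis unfolding quasi_pf_def
    by (intro exI[of _ "Polynomial.smult c q"] exI[of _ "\<lambda>z. c * g z"])
      (use 1 assms(2) in \<open>auto intro: K_poly_smult pf_class_scale simp: distrib_left\<close>)
qed

lemma quasi_pf_sum:
  "(\<And>i. i \<in> I \<Longrightarrow> quasi_pf d (f i)) \<Longrightarrow> quasi_pf d (\<lambda>z. \<Sum>i\<in>I. f i z)"
  by (induction I rule: infinite_finite_induct) (auto intro: quasi_pf_add quasi_pf_const)

text \<open>Writing z = (z + a) - a lowers the order of a pole by one and leaves a multiple of the
  old fraction; from a simple pole the lowered term is a constant and joins the polynomial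
  part.\<close>

lemma quasi_pf_times_var:
  assumes "quasi_pf d f"
  shows "quasi_pf d (\<lambda>z. z * f z)"
proof -
  obtain q g where 1: "K_poly q" "pf_class (free_slot d) g" "\<And>z. off_poles d z \<Longrightarrow> f z = poly q z + g z"
    using assms(1) by (auto simp: quasi_pf_def)
  obtain c where c: "pf_coeffs (free_slot d) c" "\<And>z. off_poles d z \<Longrightarrow> g z = pf_sum (free_slot d) c z"
    using 1(2) by (auto simp: pf_class_def)
  have simple: "quasi_pf d (\<lambda>z. z * (1 / (z + of_nat a) ^ s))"
    if as: "a \<in> {pmin d..pmax d}" "s \<in> {1..order_bd d}" for a s
  proof -
    have "quasi_pf d (\<lambda>z. 1 / (z + of_nat a) ^ (s - 1))"
    proof (cases "s = 1")
      case True
      then show ?thesis using quasi_pf_const[OF one_closed, of d] by simp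
    next
      case False
      then show ?thesis
        by (intro quasi_pf_pf pf_class_pole) (use as in \<open>auto simp: free_slot_def\<close>)
    qed
    moreover have "quasi_pf d (\<lambda>z. 1 / (z + of_nat a) ^ s)"
      by (intro quasi_pf_pf pf_class_pole) (use as in \<open>auto simp: free_slot_def\<close>)
    moreover have "- of_nat a \<in> K" by auto
    ultimately have "quasi_pf d (\<lambda>z. 1 / (z + of_nat a) ^ (s - 1) + (- of_nat a) * (1 / (z + of_nat a) ^ s))"
      by (intro quasi_pf_add quasi_pf_scale)
    then show ?thesis
    proof (rule quasi_pf_cong)
      fix z assume "off_poles d z"
      then have nz: "z + of_nat a \<noteq> 0" using as by (auto simp: off_poles_def)
      obtain s' where s: "s = Suc s'" using as by (cases s) auto
      show "z * (1 / (z + of_nat a) ^ s) =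
          1 / (z + of_nat a) ^ (s - 1) + (- of_nat a) * (1 / (z + of_nat a) ^ s)"
      proof -
        define w u where "w = z + of_nat a" and "u = w ^ s'"
        have z: "z = w - of_nat a" by (simp add: w_def)
        have "w / (w * u) = 1 / u" using nz by (simp add: w_def)
        then show ?thesis
          unfolding s diff_Suc_1 power_Suc w_def[symmetric] u_def[symmetric] unfolding z
          by (simp add: diff_divide_distrib)
      qed
    qed
  qed
  have "quasi_pf d (\<lambda>z. poly (pCons 0 q) z + (\<Sum>a=pmin d..pmax d. \<Sum>s=1..order_bd d.
      c a s * (z * (1 / (z + of_nat a) ^ s))))"
    by (intro quasi_pf_add quasi_pf_poly quasi_pf_sum quasi_pf_scale simple)
      (use 1 c in \<open>auto simp: pf_coeffs_def\<close>)
  then show ?thesis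
  proof (rule quasi_pf_cong)
    fix z assume z: "off_poles d z"
    have "z * g z = (\<Sum>a=pmin d..pmax d. \<Sum>s=1..order_bd d. c a s * (z * (1 / (z + of_nat a) ^ s)))"
      by (simp add: c(2)[OF z] pf_sum_def free_slot_def sum_distrib_left mult_ac)
    then show "z * f z = poly (pCons 0 q) z + (\<Sum>a=pmin d..pmax d. \<Sum>s=1..order_bd d.
      c a s * (z * (1 / (z + of_nat a) ^ s)))"
      by (simp add: 1(3)[OF z] distrib_left)
  qed
qed

lemma quasi_pf_times_poly:
  assumes "quasi_pf d f" "K_poly q"
  shows "quasi_pf d (\<lambda>z. poly q z * f z)"
  using assms(2)
proof (induction q)
  case 0
  show ?case using quasi_pf_const[of 0 d] by simp
next
  case (pCons a q)
  then have "quasi_pf d (\<lambda>z. a * f z + z * (poly q z * f z))"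
    by (intro quasi_pf_add quasi_pf_scale quasi_pf_times_var assms(1)) auto
  then show ?case by (simp add: distrib_right mult.assoc)
qed

text \<open>The new pole \<open>r + Suc n\<close> lies above the previous ones, so the separated
  form of merging applies and the order stays \<open>A\<close>. The flag is set back to
  \<open>True\<close> to match the shape of the induction hypothesis.\<close>

lemma pf_class_inverse_prod:
  assumes "A \<ge> 1"
  shows "pf_class (Slot A True r (r + n)) (\<lambda>z. \<Prod>i\<le>n. 1 / (z + of_nat (r + i)) ^ A)"
proof (induction n)
  case 0
  show ?case using pf_class_pole[of A "Slot A True r r" r] assms by simp
next
  case (Suc n)
  let ?f = "\<lambda>z. \<Prod>i\<le>n. 1 / (z + of_nat (r + i)) ^ A"
  let ?d = "Slot A False (r + Suc n) (r + Suc n)"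
  have mult: "pf_class (merge_slots True ?d (Slot A True r (r + n)))
      (\<lambda>z. 1 / (z + of_nat (r + Suc n)) ^ A * ?f z)"
    by (rule pf_class_pole_mult[OF Suc.IH]) (use assms in auto)
  have free: "free_slot (merge_slots True ?d (Slot A True r (r + n))) = Slot A True r (r + Suc n)"
    by (simp add: merge_slots_def free_slot_def)
  from pf_class_free[OF mult]
  have "pf_class (Slot A True r (r + Suc n)) (\<lambda>z. 1 / (z + of_nat (r + Suc n)) ^ A * ?f z)"
    unfolding free .
  then show ?case by (simp only: prod.atMost_Suc mult.commute)
qed

lemma quasi_pf_pochhammer:
  "quasi_pf (Slot A u r (r + n)) (\<lambda>z. z ^ e / pochhammer (z + of_nat r) (n + 1) ^ A)"
proof -
  let ?d = "Slot A u r (r + n)"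
  have poch: "pochhammer (z + of_nat r) (n + 1) = (\<Prod>i\<le>n. z + of_nat (r + i))" for z :: complex
    by (simp add: pochhammer_prod atLeast0AtMost lessThan_Suc_atMost atLeast0LessThan add.assoc)
  have "quasi_pf ?d (\<lambda>z. \<Prod>i\<le>n. 1 / (z + of_nat (r + i)) ^ A)"
  proof (cases "A = 0")
    case True
    then show ?thesis using quasi_pf_const[OF one_closed, of ?d] by simp
  next
    case False
    then show ?thesis
      by (intro quasi_pf_pf) (use pf_class_inverse_prod[of A r n] in \<open>simp add: free_slot_def\<close>)
  qed
  then have "quasi_pf ?d (\<lambda>z. poly ([:0, 1:] ^ e) z * (\<Prod>i\<le>n. 1 / (z + of_nat (r + i)) ^ A))"
    by (rule quasi_pf_times_poly) (intro K_poly_power, simp)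
  then show ?thesis
    unfolding poch by (simp add: prod_dividef prod_power_distrib)
qed

end

lemma poly_tendsto_0_imp_0:
  fixes q :: "complex poly"
  assumes "(\<lambda>k. poly q (of_nat k)) \<longlonglongrightarrow> 0"
  shows "q = 0"
proof (cases "Polynomial.degree q = 0")
  case True
  then obtain a where "q = [:a:]" by (metis degree_eq_zeroE)
  then show ?thesis using assms LIMSEQ_const_iff[of a 0] by simp
next
  case False
  then have "filterlim (poly q) at_infinity at_infinity"
    by (intro filterlim_poly_at_infinity) simp
  from filterlim_compose[OF this tendsto_of_nat]
  have "filterlim (\<lambda>k. poly q (of_nat k)) at_infinity sequentially" .
  from not_tendsto_and_filterlim_at_infinity[OF _ assms this] show ?thesis by simp
qed

lemma tendsto_0_if_le_inverse:
  fixes F :: "nat \<Rightarrow> complex"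
  assumes "\<And>k. norm (F k) \<le> C * (1 / real (Suc k))"
  shows "F \<longlonglongrightarrow> 0"
proof (rule Lim_null_comparison)
  show "\<forall>\<^sub>F k in sequentially. norm (F k) \<le> C * (1 / real (Suc k))"
    using assms by (intro always_eventually allI)
  have "(\<lambda>k. C * (1 / real (Suc k))) \<longlonglongrightarrow> C * 0"
    using LIMSEQ_inverse_real_of_nat by (intro tendsto_mult_left) (simp add: inverse_eq_divide)
  then show "(\<lambda>k. C * (1 / real (Suc k))) \<longlonglongrightarrow> 0" by simp
qed

lemma surplus_bounded_append:
  "surplus_bounded D (xs @ ys) \<longleftrightarrow> surplus_bounded D xs \<and> surplus_bounded (D + sum_list xs + int (length xs)) ys"
  by (induction xs arbitrary: D) (auto simp: algebra_simps)

context complex_subfield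
begin

text \<open>\<open>\<delta>\<close> bounds the order of growth; exponent 1 can arise only for \<open>\<delta> \<ge> - 1\<close>.\<close>

definition mixed_sig :: "slot \<Rightarrow> int \<Rightarrow> (nat \<Rightarrow> complex) \<Rightarrow> (nat \<Rightarrow> complex) \<Rightarrow> bool" where
  "mixed_sig d \<delta> f \<sigma> \<longleftrightarrow> (allow1 d \<longleftrightarrow> \<delta> \<ge> -1) \<and> (\<exists>C. \<forall>k>0. norm (f k) \<le> C * real k powi \<delta>) \<and>
     (\<exists>q c. K_poly q \<and> (\<forall>a s. c a s \<in> K) \<and> (\<forall>a s. order_bd d < s \<longrightarrow> c a s = 0) \<and>
       (\<forall>k>0. f k = poly q (of_nat k) + pf_sum d c (of_nat k)) \<and>
       \<sigma> = (\<lambda>s. \<Sum>a=pmin d..pmax d. c a s))"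

definition mixed :: "slot \<times> int \<Rightarrow> (nat \<Rightarrow> complex) \<Rightarrow> bool" where
  "mixed x f \<longleftrightarrow> (\<exists>\<sigma>. mixed_sig (fst x) (snd x) f \<sigma>)"

lemma quasi_pf_coeffs:
  assumes "quasi_pf d f"
  shows "\<exists>q c. K_poly q \<and> (\<forall>a s. c a s \<in> K) \<and> (\<forall>a s. order_bd d < s \<longrightarrow> c a s = 0) \<and>
    (\<forall>z. off_poles d z \<longrightarrow> f z = poly q z + pf_sum d c z)"
proof -
  obtain q g where 1: "K_poly q" "pf_class (free_slot d) g" "\<And>z. off_poles d z \<Longrightarrow> f z = poly q z + g z"
    using assms(1) by (auto simp: quasi_pf_def)
  obtain c where c: "pf_coeffs (free_slot d) c" "\<And>z. off_poles d z \<Longrightarrow> g z = pf_sum (free_slot d) c z"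
    using 1(2) by (auto simp: pf_class_def)
  let ?c = "\<lambda>a s. if s \<le> order_bd d then c a s else 0"
  have "pf_sum (free_slot d) c z = pf_sum d ?c z" for z
    by (auto simp: pf_sum_def free_slot_def intro!: sum.cong)
  then show ?thesis
    using 1 c by (intro exI[of _ q] exI[of _ ?c]) (auto simp: pf_coeffs_def)
qed

lemma mixedI:
  assumes "quasi_pf d F" "\<And>k. k > 0 \<Longrightarrow> f k = F (of_nat k)"
    "\<And>k. k > 0 \<Longrightarrow> norm (f k) \<le> C * real k powi \<delta>" "allow1 d \<longleftrightarrow> \<delta> \<ge> -1"
  shows "mixed (d, \<delta>) f"
proof -
  obtain q c where qc: "K_poly q" "\<forall>a s. c a s \<in> K" "\<forall>a s. order_bd d < s \<longrightarrow> c a s = 0"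
    "\<forall>z. off_poles d z \<longrightarrow> F z = poly q z + pf_sum d c z"
    using quasi_pf_coeffs[OF assms(1)] by blast
  have "\<forall>k>0. f k = poly q (of_nat k) + pf_sum d c (of_nat k)"
    using qc(4) assms(2) off_poles_of_nat by simp
  then show ?thesis using qc assms(3,4) unfolding mixed_def mixed_sig_def by (auto; blast)
qed

lemma mixed_quasi_pf:
  assumes "mixed x f"
  shows "\<exists>F. quasi_pf (fst x) F \<and> (\<forall>k>0. f k = F (of_nat k))"
proof -
  obtain q c where qc: "K_poly q" "\<forall>a s. c a s \<in> K"
    "\<forall>k>0. f k = poly q (of_nat k) + pf_sum (fst x) c (of_nat k)"
    using assms unfolding mixed_def mixed_sig_def by blast
  have "pf_class (free_slot (fst x)) (pf_sum (fst x) c)"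
    unfolding pf_class_def using qc(2)
    by (intro exI[of _ c]) (auto simp: pf_coeffs_def pf_sum_def free_slot_def)
  then have "quasi_pf (fst x) (\<lambda>z. poly q z + pf_sum (fst x) c z)"
    unfolding quasi_pf_def using qc(1) by blast
  then show ?thesis using qc(3) by blast
qed

lemma of_nat_times_pole_tendsto:
  assumes "s \<ge> 1"
  shows "(\<lambda>k. of_nat (Suc k) * pole a s (Suc k)) \<longlonglongrightarrow> (if s = 1 then 1 else 0)"
proof (cases "s = 1")
  case True
  have "of_nat (Suc k) * pole a s (Suc k) = 1 - of_nat a * pole a 1 (Suc k)" for k
  proof -
    have "of_nat (Suc k) + of_nat a \<noteq> (0 :: complex)"
      by (metis add_is_0 nat.distinct(1) of_nat_add of_nat_eq_0_iff)
    then show ?thesis unfolding True pole_def power_one_right by (simp add: divide_simps del: of_nat_Suc)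
  qed
  moreover have "(\<lambda>k. 1 - of_nat a * pole a 1 (Suc k)) \<longlonglongrightarrow> 1 - of_nat a * 0"
    by (intro tendsto_intros pole_tendsto_0) simp
  ultimately show ?thesis using True by simp
next
  case False
  then obtain t where t: "s = Suc t" "t \<ge> 1" using assms by (cases s) auto
  have "norm (of_nat (Suc k) * pole a s (Suc k)) \<le> 1 * (1 / real (Suc k))" for k
  proof -
    have n: "norm (of_nat (Suc k) + of_nat a :: complex) = real (Suc k) + real a"
      by (metis norm_of_nat of_nat_add)
    have "norm (of_nat (Suc k) * pole a s (Suc k)) =
        real (Suc k) / (real (Suc k) + real a) * norm (pole a t (Suc k))"
      unfolding t pole_def power_Suc norm_mult norm_divide norm_power n norm_of_nat norm_one by simp
    also have "\<dots> \<le> 1 * (1 / real (Suc k))"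
      by (intro mult_mono norm_pole_le) (use t in auto)
    finally show ?thesis .
  qed
  then have "(\<lambda>k. of_nat (Suc k) * pole a s (Suc k)) \<longlonglongrightarrow> 0"
    by (rule tendsto_0_if_le_inverse)
  then show ?thesis using False by simp
qed

text \<open>Multiplied by k, the partial fraction sum tends to the sum of the residues, while the
  growth bound forces the limit 0. If no order is available, \<open>pf_sum\<close> does not see
  \<open>c a 1\<close>; the last hypothesis covers that case.\<close>

lemma residue_sum_0:
  assumes "\<And>k. k > 0 \<Longrightarrow> norm (pf_sum d c (of_nat k)) \<le> C * real k powi \<delta>" "\<delta> \<le> -2"
    "order_bd d < 1 \<longrightarrow> (\<forall>a. c a 1 = 0)"
  shows "(\<Sum>a=pmin d..pmax d. c a 1) = 0"
proof (cases "order_bd d \<ge> 1")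
  case True
  have "(\<lambda>k. \<Sum>a=pmin d..pmax d. \<Sum>s=1..order_bd d. c a s * (of_nat (Suc k) * pole a s (Suc k)))
      \<longlonglongrightarrow> (\<Sum>a=pmin d..pmax d. \<Sum>s=1..order_bd d. c a s * (if s = 1 then 1 else 0))"
    by (intro tendsto_sum tendsto_mult_left of_nat_times_pole_tendsto) auto
  moreover have "(\<Sum>s=1..order_bd d. c a s * (if s = 1 then 1 else 0)) = c a 1" for a
  proof -
    have "(\<Sum>s=1..order_bd d. c a s * (if s = 1 then 1 else 0)) = (\<Sum>s=1..order_bd d. if s = 1 then c a s else 0)"
      by (rule sum.cong) auto
    then show ?thesis using True by (simp add: sum.delta)
  qed
  moreover have "(\<Sum>a=pmin d..pmax d. \<Sum>s=1..order_bd d. c a s * (of_nat (Suc k) * pole a s (Suc k))) =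
      of_nat (Suc k) * pf_sum d c (of_nat (Suc k))" for k
    unfolding pf_sum_def pole_def sum_distrib_left by (intro sum.cong refl) (simp add: mult_ac)
  ultimately have lim: "(\<lambda>k. of_nat (Suc k) * pf_sum d c (of_nat (Suc k))) \<longlonglongrightarrow> (\<Sum>a=pmin d..pmax d. c a 1)"
    by (simp only:)
  have "norm (of_nat (Suc k) * pf_sum d c (of_nat (Suc k))) \<le> \<bar>C\<bar> * (1 / real (Suc k))" for k
  proof -
    have "real (Suc k) powi \<delta> \<le> real (Suc k) powi (-2)"
      by (rule power_int_increasing) (use assms(2) in auto)
    have "norm (of_nat (Suc k) * pf_sum d c (of_nat (Suc k))) \<le> real (Suc k) * (C * real (Suc k) powi \<delta>)"
      unfolding norm_mult norm_of_nat by (intro mult_left_mono assms(1)) auto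
    also have "\<dots> \<le> real (Suc k) * (\<bar>C\<bar> * real (Suc k) powi (-2))"
      by (intro mult_left_mono mult_mono \<open>real (Suc k) powi \<delta> \<le> real (Suc k) powi (-2)\<close>) auto
    also have "\<dots> = \<bar>C\<bar> * (1 / real (Suc k))"
      by (simp add: power_int_minus power2_eq_square divide_simps del: of_nat_Suc)
    finally show ?thesis .
  qed
  then have "(\<lambda>k. of_nat (Suc k) * pf_sum d c (of_nat (Suc k))) \<longlonglongrightarrow> 0"
    by (rule tendsto_0_if_le_inverse)
  from LIMSEQ_unique[OF lim this] show ?thesis .
qed (use assms(3) in auto)

text \<open>The growth order bounds both parts. For \<open>\<delta> \<le> -1\<close> the polynomial
  tends to zero along the integers, hence vanishes; for \<open>\<delta> \<ge> 0\<close> the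
  fractions are bounded by a multiple of 1/k, so the polynomial inherits the bound. Thus removing
  the polynomial does not spoil the exponents on which convergence rests.\<close>

lemma mixed_split:
  assumes "mixed_sig d \<delta> f \<sigma>"
  shows "\<exists>q g. K_poly q \<and> (\<forall>k>0. f k = poly q (of_nat k) + g k) \<and> slot_sig d g \<sigma> \<and> mixed_sig d \<delta> g \<sigma> \<and>
    (q \<noteq> 0 \<longrightarrow> \<delta> \<ge> 0 \<and> (\<exists>C. \<forall>k>0. norm (poly q (of_nat k)) \<le> C * real k powi \<delta>))"
proof -
  obtain C where C: "\<And>k. k > 0 \<Longrightarrow> norm (f k) \<le> C * real k powi \<delta>"
    using assms unfolding mixed_sig_def by blast
  obtain q c where qc: "K_poly q" "\<forall>a s. c a s \<in> K" "\<forall>a s. order_bd d < s \<longrightarrow> c a s = 0"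
    "\<And>k. k > 0 \<Longrightarrow> f k = poly q (of_nat k) + pf_sum d c (of_nat k)"
    "\<sigma> = (\<lambda>s. \<Sum>a=pmin d..pmax d. c a s)"
    using assms unfolding mixed_sig_def by blast
  have flag: "allow1 d \<longleftrightarrow> \<delta> \<ge> -1" using assms unfolding mixed_sig_def by blast
  let ?g = "\<lambda>k::nat. pf_sum d c (of_nat k)"
  obtain C' where C': "\<And>k. k > 0 \<Longrightarrow> norm (?g k) \<le> C' / real k" using pf_sum_bound by blast
  have poly0: "q = 0" if "\<delta> \<le> -1"
  proof -
    have "norm (poly q (of_nat (Suc k))) \<le> (\<bar>C\<bar> + C') * (1 / real (Suc k))" for k
    proof -
      have "real (Suc k) powi \<delta> \<le> real (Suc k) powi (-1)"
        by (rule power_int_increasing) (use that in auto)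
      then have "C * real (Suc k) powi \<delta> \<le> \<bar>C\<bar> * real (Suc k) powi (-1)"
        by (intro mult_mono) auto
      then have "norm (f (Suc k)) \<le> \<bar>C\<bar> * real (Suc k) powi (-1)"
        using C[of "Suc k"] by simp
      moreover have "norm (poly q (of_nat (Suc k))) \<le> norm (f (Suc k)) + norm (?g (Suc k))"
        using qc(4)[of "Suc k"] norm_triangle_ineq4[of "f (Suc k)" "?g (Suc k)"] by simp
      moreover have "real (Suc k) powi (-1) = 1 / real (Suc k)"
        by (simp add: power_int_minus divide_inverse del: of_nat_Suc)
      ultimately show ?thesis using C'[of "Suc k"]
        by (simp add: distrib_right add_divide_distrib del: of_nat_Suc)
    qed
    then have "(\<lambda>k. poly q (of_nat (Suc k))) \<longlonglongrightarrow> 0"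
      by (rule tendsto_0_if_le_inverse)
    then show ?thesis by (intro poly_tendsto_0_imp_0) (rule LIMSEQ_imp_Suc)
  qed
  have inv: "1 / real k \<le> real k powi \<delta>" if "\<delta> \<ge> 0" "k > 0" for k
    using power_int_increasing[of "-1" \<delta> "real k"] that by (simp add: power_int_minus divide_inverse)
  have gbound: "\<exists>C. \<forall>k>0. norm (?g k) \<le> C * real k powi \<delta>"
  proof (cases "\<delta> \<ge> 0")
    case True
    have "norm (?g k) \<le> \<bar>C'\<bar> * real k powi \<delta>" if "k > 0" for k
    proof -
      have "norm (?g k) \<le> \<bar>C'\<bar> * (1 / real k)" using C'[OF that] that by (simp add: divide_simps)
      also have "\<dots> \<le> \<bar>C'\<bar> * real k powi \<delta>" by (intro mult_left_mono inv True that) auto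
      finally show ?thesis .
    qed
    then show ?thesis by blast
  next
    case False
    then show ?thesis using poly0 C qc(4) by auto
  qed
  have qbound: "\<exists>C. \<forall>k>0. norm (poly q (of_nat k)) \<le> C * real k powi \<delta>"
  proof -
    obtain B where B: "\<And>k. k > 0 \<Longrightarrow> norm (?g k) \<le> B * real k powi \<delta>" using gbound by blast
    have "norm (poly q (of_nat k)) \<le> (C + B) * real k powi \<delta>" if "k > 0" for k
      using C[OF that] B[OF that] qc(4)[OF that] norm_triangle_ineq4[of "f k" "?g k"]
      by (simp add: distrib_right)
    then show ?thesis by blast
  qed
  have "(\<Sum>a=pmin d..pmax d. c a 1) = 0" if "\<not> allow1 d"
  proof -
    obtain B where "\<And>k. k > 0 \<Longrightarrow> norm (?g k) \<le> B * real k powi \<delta>" using gbound by blast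
    then show ?thesis by (rule residue_sum_0) (use that flag qc(3) in auto)
  qed
  then have "slot_sig d ?g \<sigma>"
    unfolding slot_sig_def using qc(2,5) by (intro exI[of _ c]) (auto simp: pf_coeffs_def)
  moreover have "mixed_sig d \<delta> ?g \<sigma>"
    unfolding mixed_sig_def using flag gbound
    by (intro conjI, simp, simp, intro exI[of _ 0] exI[of _ c]) (use qc(2,3,5) in auto)
  moreover have "\<delta> \<ge> 0" if "q \<noteq> 0" using poly0 that by linarith
  ultimately show ?thesis using qc(1,4) qbound by (intro exI[of _ q] exI[of _ ?g]) auto
qed

definition mixed_reducible :: "bool \<Rightarrow> nat \<Rightarrow> bool" where
  "mixed_reducible b q \<longleftrightarrow> (\<forall>xs fs. length xs < q \<longrightarrow> surplus_bounded 1 (map snd xs) \<longrightarrow>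
     (b \<longrightarrow> sep_slots (map fst xs)) \<longrightarrow> list_all2 mixed xs fs \<longrightarrow>
     lim_rep (adms b (map fst xs)) (wsum fs))"

lemma mixed_reducibleD:
  "mixed_reducible b q \<Longrightarrow> length xs < q \<Longrightarrow> surplus_bounded 1 (map snd xs) \<Longrightarrow>
    (b \<longrightarrow> sep_slots (map fst xs)) \<Longrightarrow> list_all2 mixed xs fs \<Longrightarrow> lim_rep (adms b (map fst xs)) (wsum fs)"
  by (simp add: mixed_reducible_def)

definition raise_slot :: "slot \<Rightarrow> int \<Rightarrow> slot" where
  "raise_slot d \<delta> = Slot (order_bd d) (\<delta> \<ge> -1) (pmin d) (pmax d)"

lemma mixed_times_poly:
  assumes "mixed (e, x) f" "K_poly q" "\<And>k. k > 0 \<Longrightarrow> u k = poly q (of_nat k)"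
    "\<And>k. k > 0 \<Longrightarrow> norm (u k) \<le> C * real k powi y"
  shows "mixed (raise_slot e (x + y), x + y) (\<lambda>k. u k * f k)"
proof -
  obtain F where F: "quasi_pf e F" "\<And>k. k > 0 \<Longrightarrow> f k = F (of_nat k)"
    using mixed_quasi_pf[OF assms(1)] by auto
  obtain B where B: "\<And>k. k > 0 \<Longrightarrow> norm (f k) \<le> B * real k powi x"
    using assms(1) unfolding mixed_def mixed_sig_def by auto
  show ?thesis
  proof (rule mixedI)
    have eq: "quasi_pf (raise_slot e (x + y)) = quasi_pf e"
      by (simp add: quasi_pf_def raise_slot_def free_slot_def off_poles_def fun_eq_iff)
    show "quasi_pf (raise_slot e (x + y)) (\<lambda>z. poly q z * F z)"
      unfolding eq by (rule quasi_pf_times_poly[OF F(1) assms(2)])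
    show "norm (u k * f k) \<le> C * B * real k powi (x + y)" if "k > 0" for k
    proof -
      have "0 \<le> C * real k powi y" using assms(4)[OF that] norm_ge_zero order_trans by blast
      then have "norm (u k * f k) \<le> (C * real k powi y) * (B * real k powi x)"
        unfolding norm_mult using assms(4)[OF that] B[OF that] by (intro mult_mono) auto
      also have "\<dots> = C * B * real k powi (x + y)" using that by (simp add: power_int_add)
      finally show ?thesis .
    qed
  qed (use assms(3) F(2) in \<open>auto simp: raise_slot_def\<close>)
qed

text \<open>Raising the growth order may switch on the flag of the neighbour \<open>e\<close>. The
  flag of the removed slot \<open>d\<close> pays for it, so the number of flags does not
  increase.\<close>

lemma adms_raise_subset:
  assumes "allow1 d"
  shows "adms b (pre @ raise_slot e \<delta> # post) \<subseteq> lower_adms b (pre @ e # d # post)"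
    "adms b (pre @ raise_slot e \<delta> # post) \<subseteq> lower_adms b (pre @ d # e # post)"
proof -
  have key: "adm b (pre @ e # d # post) s \<and> adm b (pre @ d # e # post) s \<and>
      length s < Suc (Suc (length pre + length post))"
    if "adm b (pre @ raise_slot e \<delta> # post) s" for s
    using that assms adm_length[OF that]
    by (intro conjI adm_merge[OF that]) (auto simp: raise_slot_def)
  then show "adms b (pre @ raise_slot e \<delta> # post) \<subseteq> lower_adms b (pre @ e # d # post)"
    "adms b (pre @ raise_slot e \<delta> # post) \<subseteq> lower_adms b (pre @ d # e # post)"
    by (auto simp: lower_adms_def dest!: key)
qed

text \<open>Summing a factor of growth order \<open>\<delta>\<close> over its variable multiplies a
  neighbour by a polynomial of order \<open>\<delta> + 1\<close>. In the surplus condition each slot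
  contributes its order plus 1, so replacing orders x and \<delta> by x + \<delta> + 1 preserves the
  later partial sums and only omits an intermediate one. The poles of the neighbour do not
  change.\<close>

lemma lim_rep_poly_slot:
  assumes IH: "mixed_reducible b (length (xpre @ (d, \<delta>) # xpost))"
    and pre: "list_all2 mixed xpre fpre" and post: "list_all2 mixed xpost fpost"
    and sur: "surplus_bounded 1 (map snd (xpre @ (d, \<delta>) # xpost))"
    and sep: "b \<longrightarrow> sep_slots (map fst (xpre @ (d, \<delta>) # xpost))"
    and q: "K_poly q" "\<And>k. k > 0 \<Longrightarrow> norm (poly q (of_nat k)) \<le> C * real k powi \<delta>" "\<delta> \<ge> 0" "allow1 d"
  shows "lim_rep (lower_adms b (map fst (xpre @ (d, \<delta>) # xpost)))
    (wsum (fpre @ (\<lambda>k. poly q (of_nat k)) # fpost))" (is "lim_rep ?T (wsum (fpre @ ?g # fpost))")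
proof -
  \<comment> \<open>The first growth order is at most -2, so a polynomial part always has a left
    neighbour.\<close>
  have "xpre \<noteq> []" using sur q(3) by auto
  then obtain xpre' e x fpre' f where xpre: "xpre = xpre' @ [(e, x)]" "fpre = fpre' @ [f]"
    using pre by (cases xpre rule: rev_cases; cases fpre rule: rev_cases) auto
  then have pre': "list_all2 mixed xpre' fpre'" "mixed (e, x) f"
    using pre list_all2_lengthD[OF pre] by (auto simp: list_all2_append)
  obtain q' where q': "summatory q' q" using ex_summatory[OF q(1)] by blast
  \<comment> \<open>\<open>v k\<close> is minus the sum of \<open>q\<close> over 1, ..., k - 1. This
    normalization gives \<open>v 1 = 0\<close>, so that no constant term remains when there is no
    right neighbour.\<close>
  define v where "v = (\<lambda>k::nat. poly (q - q') (of_nat k))"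
  have v: "v k = - (\<Sum>j=1..<k. poly q (of_nat j))" if "k > 0" for k
  proof -
    obtain k' where "k = Suc k'" using \<open>k > 0\<close> by (cases k) auto
    then show ?thesis using q' by (simp add: v_def summatory_def atLeastLessThanSuc_atLeastAtMost)
  qed
  have vSuc: "v (Suc k) = poly (- q') (of_nat k)" for k
    using v[of "Suc k"] q' by (simp add: summatory_def atLeastLessThanSuc_atLeastAtMost)
  have tel: "?g k = v k - v (Suc k)" if "k > 0" for k
    using vSuc[of k] by (simp add: v_def)
  have C0: "C \<ge> 0" using order_trans[OF norm_ge_zero q(2)[of 1]] by simp
  have bd: "norm (\<Sum>j=1..<m. poly q (of_nat j)) \<le> C * real k powi (\<delta> + 1)" if "m \<le> Suc k" "k > 0" for m k
  proof -
    have "norm (\<Sum>j=1..<m. poly q (of_nat j)) \<le> (\<Sum>j=1..<m. C * real k powi \<delta>)"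
    proof (rule sum_norm_le)
      fix j assume j: "j \<in> {1..<m}"
      have "norm (poly q (of_nat j)) \<le> C * real j powi \<delta>" using q(2) j by auto
      also have "\<dots> \<le> C * real k powi \<delta>"
        using C0 q(3) j that by (intro mult_left_mono power_int_mono) auto
      finally show "norm (poly q (of_nat j)) \<le> C * real k powi \<delta>" .
    qed
    also have "\<dots> = real (m - 1) * (C * real k powi \<delta>)" by simp
    also have "\<dots> \<le> real k * (C * real k powi \<delta>)"
      using that C0 by (intro mult_right_mono) auto
    also have "\<dots> = C * real k powi (\<delta> + 1)" using that by (simp add: power_int_add)
    finally show ?thesis .
  qed
  have vb: "norm (v k) \<le> C * real k powi (\<delta> + 1)" "norm (v (Suc k)) \<le> C * real k powi (\<delta> + 1)" if "k > 0" for k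
    using bd[of k k] bd[of "Suc k" k] that
    unfolding v[OF that] v[OF zero_less_Suc] norm_minus_cancel by simp_all
  have K: "K_poly (q - q')" "K_poly (- q')"
    using q(1) q' K_poly_diff[of 0 q'] K_poly_diff[of q q'] by (auto simp: summatory_def)
  have left: "lim_rep ?T (wsum (fpre' @ (\<lambda>k. v (Suc k) * f k) # fpost))"
  proof (rule lim_rep_mono)
    let ?e = "raise_slot e (x + (\<delta> + 1))"
    let ?xs = "xpre' @ (?e, x + (\<delta> + 1)) # xpost"
    show "adms b (map fst ?xs) \<subseteq> ?T"
      using adms_raise_subset(1)[OF q(4), of b "map fst xpre'" e "x + (\<delta> + 1)" "map fst xpost"]
      by (simp add: xpre)
    have "mixed (?e, x + (\<delta> + 1)) (\<lambda>k. v (Suc k) * f k)"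
      by (rule mixed_times_poly[OF pre'(2) K(2) vSuc vb(2)])
    then show "lim_rep (adms b (map fst ?xs)) (wsum (fpre' @ (\<lambda>k. v (Suc k) * f k) # fpost))"
      using pre' post sur sep
      by (intro mixed_reducibleD[OF IH] list_all2_appendI)
        (auto simp: xpre surplus_bounded_append sep_slots_def sorted_wrt_append raise_slot_def algebra_simps)
  qed
  show ?thesis
  proof (cases fpost)
    case Nil
    have "wsum (fpre' @ [f, ?g]) N = v 1 * wsum (fpre' @ [f]) N - wsum (fpre' @ [\<lambda>k. v (Suc k) * f k]) N" for N
      by (rule wsum_telescope_inner_last) (rule tel)
    moreover have "v 1 = 0" using v[of 1] by simp
    moreover have "lim_rep ?T (\<lambda>N. 0 - wsum (fpre' @ [\<lambda>k. v (Suc k) * f k]) N)"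
      by (rule lim_rep_diff[OF lim_rep_0 left[unfolded Nil]]) simp
    ultimately have "lim_rep ?T (\<lambda>N. wsum (fpre' @ [f, ?g]) N)" by (simp only: mult_zero_left)
    then show ?thesis unfolding xpre Nil by simp
  next
    case (Cons f' fpost')
    then obtain e' z xpost' where xpost: "xpost = (e', z) # xpost'"
      using post by (cases xpost) auto
    have post': "mixed (e', z) f'" "list_all2 mixed xpost' fpost'" using post Cons xpost by auto
    have right: "lim_rep ?T (wsum (fpre @ (\<lambda>k. v k * f' k) # fpost'))"
    proof (rule lim_rep_mono)
      let ?e = "raise_slot e' (z + (\<delta> + 1))"
      let ?xs = "xpre @ (?e, z + (\<delta> + 1)) # xpost'"
      show "adms b (map fst ?xs) \<subseteq> ?T"
        using adms_raise_subset(2)[OF q(4), of b "map fst xpre" e' "z + (\<delta> + 1)" "map fst xpost'"]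
        by (simp add: xpost)
      have "v k = poly (q - q') (of_nat k)" for k by (simp add: v_def)
      then have "mixed (?e, z + (\<delta> + 1)) (\<lambda>k. v k * f' k)"
        by (intro mixed_times_poly[OF post'(1) K(1) _ vb(1)])
      then show "lim_rep (adms b (map fst ?xs)) (wsum (fpre @ (\<lambda>k. v k * f' k) # fpost'))"
        using pre post' sur sep
        by (intro mixed_reducibleD[OF IH] list_all2_appendI)
          (auto simp: xpost surplus_bounded_append sep_slots_def sorted_wrt_append raise_slot_def algebra_simps)
    qed
    have "wsum (fpre' @ f # ?g # f' # fpost') N = wsum (fpre' @ f # (\<lambda>k. v k * f' k) # fpost') N -
        wsum (fpre' @ (\<lambda>k. v (Suc k) * f k) # f' # fpost') N" for N
      by (rule wsum_telescope_inner) (rule tel)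
    moreover have "lim_rep ?T (\<lambda>N. wsum (fpre' @ f # (\<lambda>k. v k * f' k) # fpost') N -
        wsum (fpre' @ (\<lambda>k. v (Suc k) * f k) # f' # fpost') N)"
    proof (rule lim_rep_diff)
      show "lim_rep ?T (wsum (fpre' @ f # (\<lambda>k. v k * f' k) # fpost'))"
        using right unfolding xpre by simp
      show "lim_rep ?T (wsum (fpre' @ (\<lambda>k. v (Suc k) * f k) # f' # fpost'))"
        using left unfolding Cons .
    qed
    ultimately have "lim_rep ?T (\<lambda>N. wsum (fpre' @ f # ?g # f' # fpost') N)" by (simp only:)
    then show ?thesis unfolding xpre Cons by simp
  qed
qed

text \<open>Polynomial parts are removed from left to right, \<open>fpre\<close> being the factors
  already treated. The signatures \<open>\<sigma>\<close> ignore polynomials, so they serve for the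
  new factors \<open>gs\<close> as well and the full depth term is unaffected.\<close>

lemma lim_rep_drop_polys:
  assumes IH: "mixed_reducible b (length (xpre @ xs))"
    and pre: "list_all2 mixed xpre fpre"
    and sur: "surplus_bounded 1 (map snd (xpre @ xs))"
    and sep: "b \<longrightarrow> sep_slots (map fst (xpre @ xs))"
    and sig: "list_all2 (\<lambda>(d, \<delta>) (f, \<sigma>). mixed_sig d \<delta> f \<sigma>) xs fss"
  shows "\<exists>gs. list_all2 (\<lambda>d (g, \<sigma>). slot_sig d g \<sigma>) (map fst xs) (zip gs (map snd fss)) \<and>
    length gs = length xs \<and>
    lim_rep (lower_adms b (map fst (xpre @ xs))) (\<lambda>N. wsum (fpre @ map fst fss) N - wsum (fpre @ gs) N)"
  using sig IH pre sur sep
proof (induction xs fss arbitrary: xpre fpre rule: list_all2_induct)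
  case Nil
  then show ?case by (simp add: lim_rep_0)
next
  case (Cons x xs y fss)
  obtain d \<delta> f \<sigma> where xy: "x = (d, \<delta>)" "y = (f, \<sigma>)" by (cases x; cases y)
  then have "mixed_sig d \<delta> f \<sigma>" using Cons by simp
  then obtain q g where qg: "K_poly q" "\<And>k. k > 0 \<Longrightarrow> f k = poly q (of_nat k) + g k" "slot_sig d g \<sigma>"
    "mixed_sig d \<delta> g \<sigma>" "q \<noteq> 0 \<Longrightarrow> \<delta> \<ge> 0"
    "q \<noteq> 0 \<Longrightarrow> \<exists>C. \<forall>k>0. norm (poly q (of_nat k)) \<le> C * real k powi \<delta>"
    using mixed_split by metis
  let ?T = "lower_adms b (map fst (xpre @ x # xs))"
  have "mixed x g" using qg(4) xy by (auto simp: mixed_def)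
  then have "list_all2 mixed (xpre @ [x]) (fpre @ [g])" using Cons.prems(2) by (simp add: list_all2_appendI)
  from Cons.IH[OF _ this] obtain gs where gs:
    "list_all2 (\<lambda>d (g, \<sigma>). slot_sig d g \<sigma>) (map fst xs) (zip gs (map snd fss))" "length gs = length xs"
    "lim_rep ?T (\<lambda>N. wsum (fpre @ g # map fst fss) N - wsum (fpre @ g # gs) N)"
    using Cons.prems by auto
  have rest: "list_all2 mixed xs (map fst fss)"
    using Cons.hyps(2) by (induction rule: list_all2_induct) (auto simp: mixed_def)
  have "lim_rep ?T (wsum (fpre @ (\<lambda>k. poly q (of_nat k)) # map fst fss))"
  proof (cases "q = 0")
    case True
    then show ?thesis by (intro lim_rep_0) (simp add: wsum_zero_slot[abs_def])
  next
    case False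
    then obtain C where C: "\<And>k. k > 0 \<Longrightarrow> norm (poly q (of_nat k)) \<le> C * real k powi \<delta>"
      using qg(6) by blast
    have "allow1 d" using qg(4) qg(5)[OF False] by (auto simp: mixed_sig_def)
    then show ?thesis unfolding xy
      by (intro lim_rep_poly_slot[OF _ Cons.prems(2) rest _ _ qg(1) C qg(5)[OF False]])
        (use Cons.prems xy in auto)
  qed
  moreover have "wsum (fpre @ f # map fst fss) N = wsum (fpre @ (\<lambda>k. poly q (of_nat k)) # map fst fss) N +
      wsum (fpre @ g # map fst fss) N" for N
    using wsum_cong_slot[where f = f and g = "\<lambda>k. poly q (of_nat k) + g k", OF qg(2)]
    by (simp add: wsum_add_slot)
  ultimately have "lim_rep ?T (\<lambda>N. wsum (fpre @ f # map fst fss) N - wsum (fpre @ g # map fst fss) N)"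
    by simp
  from lim_rep_add[OF this gs(3)]
  have "lim_rep ?T (\<lambda>N. wsum (fpre @ map fst (y # fss)) N - wsum (fpre @ g # gs) N)"
    by (simp add: xy)
  then show ?case using gs(1,2) qg(3) xy by (intro exI[of _ "g # gs"]) auto
qed

lemma lim_rep_mixed:
  assumes IH: "mixed_reducible b (length xs)"
    and sur: "surplus_bounded 1 (map snd xs)"
    and sep: "b \<longrightarrow> sep_slots (map fst xs)"
    and sig: "list_all2 (\<lambda>(d, \<delta>) (f, \<sigma>). mixed_sig d \<delta> f \<sigma>) xs fss"
  shows "lim_rep (lower_adms b (map fst xs)) (\<lambda>N. wsum (map fst fss) N - top_value (map fst xs) (map snd fss))"
    and "top_value (map fst xs) (map snd fss) \<in> zspan (adms b (map fst xs))"
proof -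
  obtain gs where gs: "list_all2 (\<lambda>d (g, \<sigma>). slot_sig d g \<sigma>) (map fst xs) (zip gs (map snd fss))"
    "length gs = length xs"
    "lim_rep (lower_adms b (map fst xs)) (\<lambda>N. wsum (map fst fss) N - wsum gs N)"
    using lim_rep_drop_polys[of b "[]" xs "[]" fss] assms by auto
  have len: "length gs = length (map snd fss)" using gs(2) sig by (auto dest: list_all2_lengthD)
  have reg: "regular b (map fst xs)"
  proof -
    have "\<not> allow1 (hd (map fst xs))" if ne: "xs \<noteq> []"
    proof -
      obtain d \<delta> xs' where xs: "xs = (d, \<delta>) # xs'" using ne by (cases xs) auto
      then have "\<delta> \<le> -2" using sur by simp
      moreover have "allow1 d \<longleftrightarrow> \<delta> \<ge> -1" using sig unfolding xs by (auto simp: list_all2_Cons1 mixed_sig_def)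
      ultimately show ?thesis using xs by auto
    qed
    then show ?thesis using sep by (auto simp: regular_def)
  qed
  note r = lim_rep_reduce[OF reducible reg gs(1)]
  have "lim_rep (lower_adms b (map fst xs)) (\<lambda>N. wsum gs N - top_value (map fst xs) (map snd fss))"
    using r(1) len by simp
  from lim_rep_add[OF gs(3) this]
  show "lim_rep (lower_adms b (map fst xs)) (\<lambda>N. wsum (map fst fss) N - top_value (map fst xs) (map snd fss))"
    by simp
  show "top_value (map fst xs) (map snd fss) \<in> zspan (adms b (map fst xs))"
    using r(2) len by simp
qed

lemma mixed_reducible: "mixed_reducible b q"
proof (induction q)
  case (Suc q)
  show ?case unfolding mixed_reducible_def
  proof (intro allI impI)
    fix xs fs
    assume xs: "length xs < Suc q" and sur: "surplus_bounded 1 (map snd xs)"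
      and sep: "b \<longrightarrow> sep_slots (map fst xs)" and rep: "list_all2 mixed xs fs"
    define \<sigma> where "\<sigma> x f = (SOME \<sigma>. mixed_sig (fst x) (snd x) f \<sigma>)" for x f
    let ?fss = "map (\<lambda>(x, f). (f, \<sigma> x f)) (zip xs fs)"
    have "mixed_sig (fst x) (snd x) f (\<sigma> x f)" if "mixed x f" for x f
      using that unfolding mixed_def \<sigma>_def by (rule someI_ex)
    then have sig: "list_all2 (\<lambda>(d, \<delta>) (f, \<sigma>). mixed_sig d \<delta> f \<sigma>) xs ?fss"
      using rep by (auto simp: list_all2_conv_all_nth case_prod_unfold)
    have fs: "map fst ?fss = fs" using list_all2_lengthD[OF rep] by (intro nth_equalityI) auto
    have red: "mixed_reducible b (length xs)" using Suc xs unfolding mixed_reducible_def by auto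
    have "lim_rep (adms b (map fst xs)) (\<lambda>N. wsum (map fst ?fss) N - top_value (map fst xs) (map snd ?fss))"
      by (rule lim_rep_mono[OF lim_rep_mixed(1)[OF red sur sep sig] lower_adms_subset])
    moreover have "lim_rep (adms b (map fst xs)) (\<lambda>N. top_value (map fst xs) (map snd ?fss))"
      using lim_rep_mixed(2)[OF red sur sep sig] unfolding lim_rep_def by blast
    ultimately have "lim_rep (adms b (map fst xs))
      (\<lambda>N. (wsum (map fst ?fss) N - top_value (map fst xs) (map snd ?fss)) +
        top_value (map fst xs) (map snd ?fss))" by (rule lim_rep_add)
    then show "lim_rep (adms b (map fst xs)) (wsum fs)" unfolding fs by simp
  qed
qed (simp add: mixed_reducible_def)

end

section \<open>Uniqueness of partial fractions\<close>

lemma eventually_of_nat_add_neq_0: "\<forall>\<^sub>F k in sequentially. of_nat k + b \<noteq> (0 :: complex)"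
proof (cases "\<exists>k0. of_nat k0 + b = 0")
  case True
  then obtain k0 where k0: "of_nat k0 + b = 0" by blast
  have "of_nat k + b \<noteq> 0" if "k > k0" for k
  proof
    assume "of_nat k + b = 0"
    with k0 have "(of_nat k :: complex) = of_nat k0" by (metis add_right_imp_eq)
    then show False using that by simp
  qed
  then show ?thesis using eventually_gt_at_top[of k0] by (rule eventually_mono[rotated])
qed auto

lemma poly_eventually_0:
  fixes q :: "complex poly"
  assumes "\<forall>\<^sub>F k in sequentially. poly q (of_nat k) = 0"
  shows "q = 0"
proof (rule ccontr)
  assume "q \<noteq> 0"
  obtain N where N: "\<And>k. k \<ge> N \<Longrightarrow> poly q (of_nat k) = 0"
    using assms by (auto simp: eventually_sequentially)
  have "of_nat ` {N..} \<subseteq> {z. poly q z = 0}" using N by auto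
  moreover have "infinite (of_nat ` {N..} :: complex set)"
    using infinite_Ici[of N] finite_imageD[of "of_nat :: nat \<Rightarrow> complex" "{N..}"] by (auto simp: inj_on_def)
  ultimately show False using poly_roots_finite[OF \<open>q \<noteq> 0\<close>] finite_subset by blast
qed

text \<open>Clearing denominators gives a polynomial that vanishes at all large integers, hence
  identically. Its value at the pole \<open>- b\<close> isolates the nonzero coefficient of highest
  order \<open>s\<close> there.\<close>

lemma partial_fractions_unique:
  fixes \<gamma> :: "complex \<times> nat \<Rightarrow> complex"
  assumes "finite A" "\<forall>x\<in>A. snd x \<ge> 1"
    and zero: "\<forall>\<^sub>F k in sequentially. poly q (of_nat k) + (\<Sum>x\<in>A. \<gamma> x / (of_nat k + fst x) ^ snd x) = 0"
    and "y \<in> A"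
  shows "\<gamma> y = 0"
proof (rule ccontr)
  assume "\<gamma> y \<noteq> 0"
  define b where "b = fst y"
  define B where "B = {x\<in>A. \<gamma> x \<noteq> 0}"
  define Y where "Y = {x\<in>B. fst x \<noteq> b}"
  define s where "s = Max (snd ` (B - Y))"
  define l where "l = (\<lambda>x :: complex \<times> nat. [:fst x, 1:] ^ snd x)"
  have fin: "finite B" "finite Y" using assms(1) by (auto simp: B_def Y_def)
  have ne: "snd ` (B - Y) \<noteq> {}" using assms(4) \<open>\<gamma> y \<noteq> 0\<close> by (auto simp: B_def Y_def b_def)
  then have "s \<in> snd ` (B - Y)" unfolding s_def using fin by (intro Max_in) auto
  then have bs: "(b, s) \<in> B" "s \<ge> 1" using assms(2) by (auto simp: Y_def B_def)
  have le: "snd x \<le> s" if "x \<in> B" "fst x = b" for x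
    unfolding s_def using fin that by (intro Max_ge) (auto simp: Y_def)
  \<comment> \<open>\<open>D\<close> vanishes at \<open>- b\<close> to order exactly
    \<open>s\<close>. Each term with another pole contributes its own factor, even if poles
    coincide, so that the cofactor \<open>E x\<close> is obtained by omitting one factor.\<close>
  define D where "D = [:b, 1:] ^ s * prod l Y"
  define E where "E x = (if fst x = b then [:b, 1:] ^ (s - snd x) * prod l Y
    else [:b, 1:] ^ s * prod l (Y - {x}))" for x
  have DE: "D = E x * l x" if "x \<in> B" for x
  proof (cases "fst x = b")
    case True
    then have "[:b, 1:] ^ s = [:b, 1:] ^ (s - snd x) * l x"
      unfolding l_def using le[OF that True] by (simp flip: power_add)
    then show ?thesis using True by (simp add: D_def E_def)
  next
    case False
    then have "prod l Y = l x * prod l (Y - {x})" using that fin by (intro prod.remove) (auto simp: Y_def)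
    then show ?thesis using False by (simp add: D_def E_def)
  qed
  define F where "F = q * D + (\<Sum>x\<in>B. [:\<gamma> x:] * E x)"
  have "\<forall>\<^sub>F k in sequentially. \<forall>x\<in>B. of_nat k + fst x \<noteq> 0"
    by (intro eventually_ball_finite fin ballI eventually_of_nat_add_neq_0)
  with zero have "\<forall>\<^sub>F k in sequentially. poly F (of_nat k) = 0"
  proof eventually_elim
    case (elim k)
    have "poly (E x) (of_nat k) = poly D (of_nat k) / (of_nat k + fst x) ^ snd x" if "x \<in> B" for x
      using elim(2) that by (simp add: DE[OF that] l_def add.commute)
    then have "poly F (of_nat k) = poly D (of_nat k) *
        (poly q (of_nat k) + (\<Sum>x\<in>B. \<gamma> x / (of_nat k + fst x) ^ snd x))"
      by (simp add: F_def poly_sum distrib_left sum_distrib_left mult_ac)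
    also have "(\<Sum>x\<in>B. \<gamma> x / (of_nat k + fst x) ^ snd x) = (\<Sum>x\<in>A. \<gamma> x / (of_nat k + fst x) ^ snd x)"
      by (rule sum.mono_neutral_left) (use assms(1) in \<open>auto simp: B_def\<close>)
    finally show ?case using elim(1) by simp
  qed
  then have "F = 0" by (rule poly_eventually_0)
  have E0: "poly (E x) (- b) = 0" if "x \<in> B" "x \<noteq> (b, s)" for x
  proof (cases "fst x = b")
    case True
    then have "snd x < s" using le[OF that(1) True] that(2) by (cases x) auto
    then show ?thesis using True by (simp add: E_def zero_power)
  next
    case False
    then show ?thesis using bs(2) by (simp add: E_def zero_power)
  qed
  have "0 = poly F (- b)" using \<open>F = 0\<close> by simp
  also have "\<dots> = (\<Sum>x\<in>B. \<gamma> x * poly (E x) (- b))"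
    using bs(2) by (simp add: F_def D_def poly_sum zero_power)
  also have "\<dots> = (\<Sum>x\<in>B. if x = (b, s) then \<gamma> x * poly (E x) (- b) else 0)"
    by (intro sum.cong refl) (auto simp: E0)
  also have "\<dots> = \<gamma> (b, s) * poly (prod l Y) (- b)"
    using bs(1) fin by (simp add: sum.delta E_def)
  finally have "poly (prod l Y) (- b) = 0" using bs(1) by (simp add: B_def)
  then show False using fin by (auto simp: poly_prod l_def Y_def)
qed

text \<open>\<open>\<sigma>\<close> is what the passage to formal zeta values retains of a factor \<open>F\<close>; the elements of \<open>A\<close> are
  pairs of a negated pole and an order.\<close>

definition has_sig :: "(nat \<Rightarrow> complex) \<Rightarrow> (nat \<Rightarrow> complex) \<Rightarrow> bool" where
  "has_sig F \<sigma> \<longleftrightarrow> (\<exists>q A \<gamma>. finite A \<and> (\<forall>x\<in>A. snd x \<ge> 1) \<and>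
     (\<forall>\<^sub>F k in sequentially. F k = poly q (of_nat k) + (\<Sum>x\<in>A. \<gamma> x / (of_nat k + fst x) ^ snd x)) \<and>
     \<sigma> = (\<lambda>s. \<Sum>x\<in>A. if snd x = s then \<gamma> x else 0))"

lemma has_sig_cong:
  assumes "has_sig F \<sigma>" "\<forall>\<^sub>F k in sequentially. G k = F k"
  shows "has_sig G \<sigma>"
proof -
  obtain q A \<gamma> where F: "finite A" "\<forall>x\<in>A. snd x \<ge> 1"
    "\<forall>\<^sub>F k in sequentially. F k = poly q (of_nat k) + (\<Sum>x\<in>A. \<gamma> x / (of_nat k + fst x) ^ snd x)"
    "\<sigma> = (\<lambda>s. \<Sum>x\<in>A. if snd x = s then \<gamma> x else 0)"
    using assms(1) unfolding has_sig_def by blast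
  have "\<forall>\<^sub>F k in sequentially. G k = poly q (of_nat k) + (\<Sum>x\<in>A. \<gamma> x / (of_nat k + fst x) ^ snd x)"
    using assms(2) F(3) by eventually_elim simp
  then show ?thesis unfolding has_sig_def using F(1,2,4) by blast
qed

lemma has_sig_0:
  assumes "has_sig F \<sigma>" "\<forall>\<^sub>F k in sequentially. F k = 0"
  shows "\<sigma> s = 0"
proof -
  obtain q A \<gamma> where F: "finite A" "\<forall>x\<in>A. snd x \<ge> 1"
    "\<forall>\<^sub>F k in sequentially. F k = poly q (of_nat k) + (\<Sum>x\<in>A. \<gamma> x / (of_nat k + fst x) ^ snd x)"
    "\<sigma> = (\<lambda>s. \<Sum>x\<in>A. if snd x = s then \<gamma> x else 0)"
    using assms(1) unfolding has_sig_def by blast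
  have "\<forall>\<^sub>F k in sequentially. poly q (of_nat k) + (\<Sum>x\<in>A. \<gamma> x / (of_nat k + fst x) ^ snd x) = 0"
    using assms(2) F(3) by eventually_elim simp
  then have "\<gamma> x = 0" if "x \<in> A" for x
    using partial_fractions_unique[OF F(1,2)] that by blast
  then show ?thesis unfolding F(4) by (intro sum.neutral) auto
qed

lemma has_sig_poly: "has_sig (\<lambda>k. poly q (of_nat k)) (\<lambda>s. 0)"
  unfolding has_sig_def by (intro exI[of _ q] exI[of _ "{}"]) auto

lemma has_sig_fraction:
  assumes "s \<ge> 1"
  shows "has_sig (\<lambda>k. c / (of_nat k + b) ^ s) (\<lambda>t. if t = s then c else 0)"
  unfolding has_sig_def
  by (intro exI[of _ 0] exI[of _ "{(b, s)}"] exI[of _ "\<lambda>x. c"]) (use assms in auto)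

lemma has_sig_scale:
  assumes "has_sig F \<sigma>"
  shows "has_sig (\<lambda>k. c * F k) (\<lambda>s. c * \<sigma> s)"
proof -
  obtain q A \<gamma> where F: "finite A" "\<forall>x\<in>A. snd x \<ge> 1"
    "\<forall>\<^sub>F k in sequentially. F k = poly q (of_nat k) + (\<Sum>x\<in>A. \<gamma> x / (of_nat k + fst x) ^ snd x)"
    "\<sigma> = (\<lambda>s. \<Sum>x\<in>A. if snd x = s then \<gamma> x else 0)"
    using assms unfolding has_sig_def by blast
  have "\<forall>\<^sub>F k in sequentially. c * F k = poly ([:c:] * q) (of_nat k) +
      (\<Sum>x\<in>A. (c * \<gamma> x) / (of_nat k + fst x) ^ snd x)"
    using F(3) by eventually_elim (simp add: distrib_left sum_distrib_left)
  moreover have "(\<lambda>s. c * \<sigma> s) = (\<lambda>s. \<Sum>x\<in>A. if snd x = s then c * \<gamma> x else 0)"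
    unfolding F(4) sum_distrib_left by (intro ext sum.cong) auto
  ultimately show ?thesis unfolding has_sig_def using F(1,2)
    by (intro exI[of _ "[:c:] * q"] exI[of _ A] exI[of _ "\<lambda>x. c * \<gamma> x"]) auto
qed

lemma has_sig_add:
  assumes "has_sig F \<sigma>" "has_sig G \<tau>"
  shows "has_sig (\<lambda>k. F k + G k) (\<lambda>s. \<sigma> s + \<tau> s)"
proof -
  obtain q A \<gamma> where F: "finite A" "\<forall>x\<in>A. snd x \<ge> 1"
    "\<forall>\<^sub>F k in sequentially. F k = poly q (of_nat k) + (\<Sum>x\<in>A. \<gamma> x / (of_nat k + fst x) ^ snd x)"
    "\<sigma> = (\<lambda>s. \<Sum>x\<in>A. if snd x = s then \<gamma> x else 0)"
    using assms(1) unfolding has_sig_def by blast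
  obtain q' A' \<gamma>' where G: "finite A'" "\<forall>x\<in>A'. snd x \<ge> 1"
    "\<forall>\<^sub>F k in sequentially. G k = poly q' (of_nat k) + (\<Sum>x\<in>A'. \<gamma>' x / (of_nat k + fst x) ^ snd x)"
    "\<tau> = (\<lambda>s. \<Sum>x\<in>A'. if snd x = s then \<gamma>' x else 0)"
    using assms(2) unfolding has_sig_def by blast
  let ?U = "A \<union> A'"
  define \<delta> where "\<delta> x = (if x \<in> A then \<gamma> x else 0) + (if x \<in> A' then \<gamma>' x else 0)" for x
  have U: "(\<Sum>x\<in>A. \<gamma> x * f x) + (\<Sum>x\<in>A'. \<gamma>' x * f x) = (\<Sum>x\<in>?U. \<delta> x * f x)" for f :: "complex \<times> nat \<Rightarrow> complex"
  proof -
    have "(\<Sum>x\<in>A. \<gamma> x * f x) = (\<Sum>x\<in>?U. (if x \<in> A then \<gamma> x else 0) * f x)"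
      by (rule sum.mono_neutral_cong_left) (use F G in auto)
    moreover have "(\<Sum>x\<in>A'. \<gamma>' x * f x) = (\<Sum>x\<in>?U. (if x \<in> A' then \<gamma>' x else 0) * f x)"
      by (rule sum.mono_neutral_cong_left) (use F G in auto)
    ultimately show ?thesis by (simp add: \<delta>_def distrib_right sum.distrib)
  qed
  have "\<forall>\<^sub>F k in sequentially. F k + G k = poly (q + q') (of_nat k) +
      (\<Sum>x\<in>?U. \<delta> x / (of_nat k + fst x) ^ snd x)"
    using F(3) G(3)
  proof eventually_elim
    case (elim k)
    show ?case using U[of "\<lambda>x. 1 / (of_nat k + fst x) ^ snd x"] elim by simp
  qed
  moreover have "(\<lambda>s. \<sigma> s + \<tau> s) = (\<lambda>s. \<Sum>x\<in>?U. if snd x = s then \<delta> x else 0)"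
  proof
    fix s
    show "\<sigma> s + \<tau> s = (\<Sum>x\<in>?U. if snd x = s then \<delta> x else 0)"
      using U[of "\<lambda>x. if snd x = s then 1 else 0"] unfolding F(4) G(4)
      by (simp add: if_distrib[of "\<lambda>y. _ * y"] cong: if_cong)
  qed
  ultimately show ?thesis unfolding has_sig_def using F(1,2) G(1,2)
    by (intro exI[of _ "q + q'"] exI[of _ ?U] exI[of _ \<delta>]) auto
qed

lemma has_sig_sum:
  assumes "finite I" "\<And>i. i \<in> I \<Longrightarrow> has_sig (F i) (\<sigma> i)"
  shows "has_sig (\<lambda>k. \<Sum>i\<in>I. F i k) (\<lambda>s. \<Sum>i\<in>I. \<sigma> i s)"
  using assms
proof (induction I rule: finite_induct)
  case empty
  show ?case using has_sig_poly[of 0] by simp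
next
  case (insert i I)
  then show ?case using has_sig_add[of "F i" "\<sigma> i"] by simp
qed

text \<open>Replacing one variable after the other by its signature.\<close>

lemma tensor_sig:
  fixes F :: "'m \<Rightarrow> 'j \<Rightarrow> nat \<Rightarrow> complex"
  assumes "finite J" "finite M"
    and "\<And>m j. m \<in> M \<Longrightarrow> j \<in> J \<Longrightarrow> has_sig (F m j) (\<sigma> m j)"
    and "\<And>k. (\<And>j. j \<in> J \<Longrightarrow> N \<le> k j) \<Longrightarrow> (\<Sum>m\<in>M. w m * (\<Prod>j\<in>J. F m j (k j))) = 0"
  shows "(\<Sum>m\<in>M. w m * (\<Prod>j\<in>J. \<sigma> m j (s j))) = 0"
  using assms(1,3,4)
proof (induction J arbitrary: w rule: finite_induct)
  case (insert i J)
  have "(\<Sum>m\<in>M. (w m * \<sigma> m i (s i)) * (\<Prod>j\<in>J. F m j (k j))) = 0"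
    if k: "\<And>j. j \<in> J \<Longrightarrow> N \<le> k j" for k
  proof -
    \<comment> \<open>With the other variables frozen at large integers, this function of one
      variable has a signature and vanishes for large \<open>u\<close>, so its signature is
      zero.\<close>
    let ?G = "\<lambda>u. \<Sum>m\<in>M. (w m * (\<Prod>j\<in>J. F m j (k j))) * F m i u"
    have sig: "has_sig ?G (\<lambda>t. \<Sum>m\<in>M. (w m * (\<Prod>j\<in>J. F m j (k j))) * \<sigma> m i t)"
      by (intro has_sig_sum assms(2) has_sig_scale insert.prems(1)) auto
    have "?G u = 0" if "u \<ge> N" for u
    proof -
      have "(\<Sum>m\<in>M. w m * (\<Prod>j\<in>insert i J. F m j ((k(i := u)) j))) = 0"
        by (rule insert.prems(2)) (use k that in auto)
      moreover have "(\<Prod>j\<in>J. F m j ((k(i := u)) j)) = (\<Prod>j\<in>J. F m j (k j))" for m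
        by (intro prod.cong) (use insert.hyps in auto)
      ultimately show ?thesis using insert.hyps by (simp add: mult_ac)
    qed
    then have "\<forall>\<^sub>F u in sequentially. ?G u = 0" unfolding eventually_sequentially by blast
    from has_sig_0[OF sig this, of "s i"] show ?thesis by (simp add: mult_ac)
  qed
  from insert.IH[OF _ this] insert.prems(1)
  have "(\<Sum>m\<in>M. (w m * \<sigma> m i (s i)) * (\<Prod>j\<in>J. \<sigma> m j (s j))) = 0" by simp
  then show ?case using insert.hyps by (simp add: mult_ac)
qed simp

context complex_subfield
begin

text \<open>As e^2 = 1, e k + u + a = e (k + e (u + a)): the pole moves and e^(-s) = e^s comes out.
  Hence neither \<open>u\<close> nor the positions of the poles matter for the signature. The value
  0 at \<open>s = 0\<close> reflects that orders start at 1.\<close>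

lemma has_sig_affine:
  fixes e u :: complex
  assumes F: "\<And>z. off_poles d z \<Longrightarrow> F z = poly q z + pf_sum d c z"
    and e: "e = 1 \<or> e = -1" and c0: "\<And>a s. order_bd d < s \<Longrightarrow> c a s = 0"
  shows "has_sig (\<lambda>k. F (e * of_nat k + u)) (\<lambda>s. if s = 0 then 0 else e ^ s * (\<Sum>a=pmin d..pmax d. c a s))"
    and "\<forall>\<^sub>F k in sequentially. off_poles d (e * of_nat k + u)"
proof -
  have ee: "e * e = 1" "e \<noteq> 0" using e by auto
  have eq: "e * of_nat k + u + of_nat a = e * (of_nat k + e * (u + of_nat a))" for k a :: nat
    using ee(1) by (simp add: distrib_left add.assoc flip: mult.assoc)
  have "\<forall>\<^sub>F k in sequentially. \<forall>a\<in>{pmin d..pmax d}. of_nat k + e * (u + of_nat a) \<noteq> 0"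
    by (intro eventually_ball_finite ballI eventually_of_nat_add_neq_0) auto
  then show off: "\<forall>\<^sub>F k in sequentially. off_poles d (e * of_nat k + u)"
    unfolding off_poles_def by eventually_elim (simp add: eq ee(2))
  let ?S = "\<lambda>s. \<Sum>a=pmin d..pmax d. \<Sum>t=1..order_bd d. if s = t then e ^ t * c a t else 0"
  have "has_sig (\<lambda>k. poly (pcompose q [:u, e:]) (of_nat k) + (\<Sum>a=pmin d..pmax d. \<Sum>t=1..order_bd d.
      (e ^ t * c a t) / (of_nat k + e * (u + of_nat a)) ^ t)) (\<lambda>s. 0 + ?S s)"
    by (intro has_sig_add has_sig_poly has_sig_sum has_sig_fraction) auto
  moreover have "\<forall>\<^sub>F k in sequentially. F (e * of_nat k + u) =
     poly (pcompose q [:u, e:]) (of_nat k) + (\<Sum>a=pmin d..pmax d. \<Sum>t=1..order_bd d.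
      (e ^ t * c a t) / (of_nat k + e * (u + of_nat a)) ^ t)"
    using off
  proof eventually_elim
    case (elim k)
    have inv: "1 / e ^ t = e ^ t" for t using e by (auto simp: minus_one_power_iff)
    have "c a t / (e * of_nat k + u + of_nat a) ^ t = (e ^ t * c a t) / (of_nat k + e * (u + of_nat a)) ^ t" for a t
    proof -
      have "c a t / (e * of_nat k + u + of_nat a) ^ t = c a t * (1 / e ^ t) / (of_nat k + e * (u + of_nat a)) ^ t"
        unfolding eq power_mult_distrib by simp
      then show ?thesis unfolding inv by (simp add: mult.commute)
    qed
    then show ?case unfolding F[OF elim] pf_sum_def by (simp add: poly_pcompose add.commute mult.commute)
  qed
  moreover have "0 + ?S s = (if s = 0 then 0 else e ^ s * (\<Sum>a=pmin d..pmax d. c a s))" for s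
  proof -
    have "(\<Sum>t=1..order_bd d. if s = t then e ^ t * c a t else 0) = (if s = 0 then 0 else e ^ s * c a s)" for a
      using c0[of s a] by (cases "s \<in> {1..order_bd d}") (auto simp: sum.delta)
    then show ?thesis by (simp add: sum_distrib_left)
  qed
  ultimately show "has_sig (\<lambda>k. F (e * of_nat k + u))
      (\<lambda>s. if s = 0 then 0 else e ^ s * (\<Sum>a=pmin d..pmax d. c a s))"
    using has_sig_cong by (simp only:)
qed

end

section \<open>The series and its symmetries\<close>

lemma complex_subfieldI:
  assumes "subfield K (ring_of_type_algebra :: complex ring)"
  shows "complex_subfield K"
proof -
  let ?R = "ring_of_type_algebra :: complex ring"
  note sub = subringE[OF subfieldE(1)[OF assms]]
  have simps: "\<zero>\<^bsub>?R\<^esub> = 0" "\<one>\<^bsub>?R\<^esub> = 1" "\<And>x y. x \<otimes>\<^bsub>?R\<^esub> y = x * y" "\<And>x y. x \<oplus>\<^bsub>?R\<^esub> y = x + y"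
    "carrier ?R = UNIV"
    by (simp_all add: ring_of_type_algebra_def)
  interpret R: ring ?R by (rule ring_from_type_algebra)
  have neg: "\<ominus>\<^bsub>?R\<^esub> x = - x" for x
    using R.r_neg[of x] by (simp add: simps eq_neg_iff_add_eq_0 add.commute)
  show ?thesis
  proof
    show "inverse x \<in> K" if "x \<in> K" for x
    proof (cases "x = 0")
      case False
      then have "x \<in> Units (?R\<lparr>carrier := K\<rparr>)"
        using subfield.subfield_Units[OF assms] that by (simp add: simps)
      then obtain y where "y \<in> K" "y * x = 1" by (auto simp: Units_def simps)
      then show ?thesis by (metis inverse_unique mult.commute)
    qed (use that in simp)
  qed (use sub(2,3,5-7) in \<open>simp_all add: simps neg\<close>)
qed

section \<open>Evaluation of polynomials at complex points\<close>

lemma poly_value_PConst [simp]: "poly_value x (PConst c) = c"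
  by (simp add: PConst_def poly_eval_single)

lemma poly_value_PVar [simp]: "poly_value x (PVar i) = x i"
  by (simp add: PVar_def poly_eval_single)

lemma poly_value_1 [simp]: "poly_value x 1 = 1"
  using poly_value_PConst[of x 1] by simp

lemma poly_value_sum: "poly_value x (\<Sum>j\<in>J. f j) = (\<Sum>j\<in>J. poly_value x (f j))"
  by (rule poly_eval_sum) simp_all

lemma poly_value_prod: "poly_value x (\<Prod>j\<in>J. f j) = (\<Prod>j\<in>J. poly_value x (f j))"
  by (induction J rule: infinite_finite_induct) (simp_all add: poly_value_mult)

lemma poly_value_power: "poly_value x (f ^ k) = poly_value x f ^ k"
  by (induction k) (simp_all add: poly_value_mult)

lemma poly_value_of_nat [simp]: "poly_value x (of_nat k) = of_nat k"
  by (induction k) (simp_all add: poly_value_add)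

lemma poly_value_diff: "poly_value x (f - g) = poly_value x f - poly_value x g"
  using poly_value_add[of x "f - g" g] by (simp add: algebra_simps)

lemma poly_value_uminus: "poly_value x (- f) = - poly_value x f"
  using poly_value_diff[of x 0 f] by simp

lemma poly_value_of_int [simp]: "poly_value x (of_int k) = of_int k"
  by (cases k rule: int_cases2) (simp_all add: poly_value_uminus)

lemma poly_value_subst:
  "poly_value x (poly_subst y f) = poly_value (\<lambda>i. poly_value x (y i)) f"
  unfolding poly_eval_def[of PConst y f] poly_value_sum poly_value_mult poly_value_prod poly_value_power
    poly_value_PConst
  by (simp add: poly_eval_def)

lemma poly_value_pochhammer: "poly_value x (pochhammer f k) = pochhammer (poly_value x f) k"
  by (simp add: pochhammer_prod poly_value_prod poly_value_add)

lemma poly_value_ser_denom: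
  "poly_value x (ser_denom p A n r) = (\<Prod>i=1..p. pochhammer (x i + of_nat (r i)) (n i + 1) ^ A i)"
  by (simp add: ser_denom_def poly_value_prod poly_value_power poly_value_pochhammer poly_value_add)

lemma poly_value_polys_over:
  assumes "P \<in> polys_over K p"
  shows "poly_value x P = (\<Sum>m\<in>Poly_Mapping.keys P. Poly_Mapping.lookup P m * (\<Prod>i=1..p. x i ^ Poly_Mapping.lookup m i))"
  unfolding poly_eval_def
  by (intro sum.cong refl arg_cong2[of _ _ _ _ "(*)"] monom_eval_superset)
    (use assms in \<open>auto simp: polys_over_def\<close>)

lemma surplus_boundedI:
  assumes "\<And>j. j < length xs \<Longrightarrow> D + (\<Sum>i\<le>j. xs ! i) + int j + 1 \<le> 0"
  shows "surplus_bounded D xs"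
  using assms
proof (induction xs arbitrary: D)
  case (Cons d xs)
  have "D + d + 1 \<le> 0" using Cons.prems[of 0] by simp
  moreover have "surplus_bounded (D + d + 1) xs"
  proof (rule Cons.IH)
    fix j assume "j < length xs"
    then show "D + d + 1 + (\<Sum>i\<le>j. xs ! i) + int j + 1 \<le> 0"
      using Cons.prems[of "Suc j"] by (simp add: sum.atMost_Suc_shift del: sum.atMost_Suc)
  qed
  ultimately show ?case by simp
qed simp

lemma has_sum_finite_sum:
  fixes f :: "'i \<Rightarrow> 'a \<Rightarrow> complex"
  assumes "finite I" "\<And>i. i \<in> I \<Longrightarrow> (f i has_sum S i) B"
  shows "((\<lambda>x. \<Sum>i\<in>I. f i x) has_sum (\<Sum>i\<in>I. S i)) B"
  using assms by (induction I rule: finite_induct) (auto intro: has_sum_add)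

text \<open>The number of variables in the first \<open>j\<close> blocks;
  \<open>offset bs j + 1\<close> is the index \<ell>_j of condition (a).\<close>

definition offset :: "'a list list \<Rightarrow> nat \<Rightarrow> nat" where
  "offset bs j = length (concat (take j bs))"

lemma offset_Suc: "j < length bs \<Longrightarrow> offset bs (Suc j) = offset bs j + length (bs ! j)"
  by (simp add: offset_def take_Suc_conv_app_nth)

lemma concat_nth_offset:
  assumes "j < length bs" "i < length (bs ! j)"
  shows "concat bs ! (offset bs j + i) = bs ! j ! i"
proof -
  have "concat bs = concat (take j bs) @ bs ! j @ concat (drop (Suc j) bs)"
    by (metis assms(1) concat.simps(2) concat_append id_take_nth_drop)
  then show ?thesis using assms(2) by (simp add: offset_def nth_append)
qed

lemma offset_mono: "i \<le> j \<Longrightarrow> offset bs i \<le> offset bs j"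
proof -
  assume "i \<le> j"
  then have "take j bs = take i bs @ take (j - i) (drop i bs)"
    by (metis le_add_diff_inverse take_add)
  then show ?thesis by (simp add: offset_def)
qed

lemma sum_list_block:
  fixes f :: "'a \<Rightarrow> nat"
  assumes bs: "concat bs = map F [1..<p + 1]" and j: "j < length bs"
  shows "sum_list (map f (bs ! j)) = (\<Sum>i\<in>{offset bs j + 1..offset bs (Suc j)}. f (F i))"
proof -
  have le: "offset bs (Suc j) \<le> p"
    using offset_mono[of "Suc j" "length bs" bs] j arg_cong[OF bs, of length]
    by (simp add: offset_def del: upt_Suc)
  have "bs ! j ! i = F (offset bs j + i + 1)" if "i < length (bs ! j)" for i
  proof -
    have "offset bs j + i < p" using that le offset_Suc[OF j] by simp
    then show ?thesis using concat_nth_offset[OF j that] unfolding bs by (simp del: upt_Suc)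
  qed
  then have "sum_list (map f (bs ! j)) = (\<Sum>i<length (bs ! j). f (F (offset bs j + i + 1)))"
    by (simp add: sum_list_sum_nth atLeast0LessThan)
  also have "\<dots> = (\<Sum>i\<in>{offset bs j + 1..<offset bs j + 1 + length (bs ! j)}. f (F i))"
    by (rule sum.reindex_bij_witness[of _ "\<lambda>i. i - (offset bs j + 1)" "\<lambda>i. offset bs j + i + 1"]) auto
  also have "{offset bs j + 1..<offset bs j + 1 + length (bs ! j)} = {offset bs j + 1..offset bs (Suc j)}"
    using offset_Suc[OF j] by auto
  finally show ?thesis .
qed

section \<open>From admissible exponents to conditions (a) and (b)\<close>

locale mzv_series = complex_subfield K for K +
  fixes p :: nat and A n r :: "nat \<Rightarrow> nat" and P :: cpoly
  assumes p1: "p \<ge> 1" and P_over: "P \<in> polys_over K p"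
    and deg: "\<forall>j\<in>{1..p}. (\<Sum>i=1..j. deg_in i P)
           \<le> ereal ((\<Sum>i=1..j. real (A i) * (real (n i) + 1)) - real j - 1)"
begin

definition large_deg :: "nat \<Rightarrow> bool" where
  "large_deg i \<longleftrightarrow> ereal (real (A i) * (real (n i) + 1) - 1) \<le> deg_in i P"

definition slots :: "(nat \<Rightarrow> bool) \<Rightarrow> slot list" where
  "slots u = map (\<lambda>i. Slot (A i) (u i) (r i) (r i + n i)) [1..<p + 1]"

definition separated :: bool where
  "separated \<longleftrightarrow> (\<forall>i. 1 \<le> i \<and> i \<le> p - 1 \<longrightarrow> r i \<ge> r (i + 1) + n (i + 1) + 1)"

lemma length_slots [simp]: "length (slots u) = p"
  by (simp add: slots_def)

lemma adm_block_bound: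
  assumes "adm b (slots u) s" "s \<noteq> []"
  shows "block_bound p A s"
proof -
  obtain bs where bs: "concat bs = slots u" "[] \<notin> set bs" "list_all2 (block_ok b) s bs"
    using assms by (auto simp: adm_def)
  have len: "length s = length bs" using bs(3) by (rule list_all2_lengthD)
  have end_: "offset bs (length bs) = p"
    using arg_cong[OF bs(1), of length] by (simp add: offset_def)
  let ?l = "\<lambda>j. offset bs j + 1"
  have "?l (j - 1) < ?l j \<and> s ! (j - 1) \<le> (\<Sum>i=?l (j - 1)..?l j - 1. A i)" if j: "j \<in> {1..length s}" for j
  proof -
    obtain j' where j': "j = Suc j'" "j' < length bs" using j len by (cases j) auto
    have "bs ! j' \<noteq> []" using j' bs(2) by (metis nth_mem)
    then have 1: "?l (j - 1) < ?l j" using offset_Suc[OF j'(2)] j'(1) by simp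
    have "block_ok b (s ! j') (bs ! j')" using bs(3) j' len by (simp add: list_all2_nthD)
    then have "s ! j' \<le> sum_list (map order_bd (bs ! j'))"
      by (auto simp: block_ok_def split: if_splits intro: order_trans[OF _ member_le_sum_list])
    also have "\<dots> = (\<Sum>i\<in>{offset bs j' + 1..offset bs (Suc j')}. A i)"
      using sum_list_block[OF bs(1)[unfolded slots_def] j'(2), of order_bd] by simp
    finally show ?thesis using 1 j'(1) by simp
  qed
  moreover have "?l 0 = 1" "?l (length s) = p + 1" using end_ len by (simp_all add: offset_def)
  ultimately show ?thesis unfolding block_bound_def Let_def by (intro exI[of _ ?l]) simp
qed

lemma card_shift:
  fixes k :: nat
  shows "card {i\<in>{1..k}. Q (i - 1)} = card {i. i < k \<and> Q i}"
proof -
  have "bij_betw Suc {i. i < k \<and> Q i} {i\<in>{1..k}. Q (i - 1)}"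
    by (rule bij_betw_byWitness[where f' = "\<lambda>i. i - 1"]) auto
  then show ?thesis by (rule bij_betw_same_card[symmetric])
qed

text \<open>Each block supplies one slot whose order bounds the exponent, and the positions of these
  slots increase because the blocks are consecutive. The bound on the number of ones comes from the
  flags, which here mark the variables of large degree.\<close>

lemma adm_separated_bound:
  assumes adm: "adm True (slots large_deg) s" and "s \<noteq> []"
  shows "separated_bound p A n P s"
proof -
  obtain bs where bs: "concat bs = slots large_deg" "[] \<notin> set bs" "list_all2 (block_ok True) s bs"
    using assms by (auto simp: adm_def)
  have len: "length s = length bs" using bs(3) by (rule list_all2_lengthD)
  have end_: "offset bs (length bs) = p"
    using arg_cong[OF bs(1), of length] by (simp add: offset_def)
  have "\<exists>i<length (bs ! j). s ! j \<le> order_bd (bs ! j ! i)" if "j < length s" for j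
    using list_all2_nthD[OF bs(3) that] by (auto simp: block_ok_def in_set_conv_nth)
  then obtain c where c: "\<And>j. j < length s \<Longrightarrow> c j < length (bs ! j) \<and> s ! j \<le> order_bd (bs ! j ! c j)"
    by metis
  let ?i = "\<lambda>l. offset bs (l - 1) + c (l - 1) + 1"
  have up: "?i l \<le> offset bs l" if l: "l \<in> {1..length s}" for l
  proof -
    obtain j where "l = Suc j" "j < length s" using l by (cases l) auto
    then show ?thesis using c[of j] offset_Suc[of j bs] len by simp
  qed
  have le_p: "offset bs l \<le> p" if "l \<in> {1..length s}" for l
    using offset_mono[of l "length bs" bs] end_ len that by simp
  have "strict_mono_on {1..length s} ?i"
  proof (rule strict_mono_onI)
    fix l l' assume l: "l \<in> {1..length s}" "l' \<in> {1..length s}" "l < l'"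
    have "?i l \<le> offset bs l" by (rule up[OF l(1)])
    also have "\<dots> \<le> offset bs (l' - 1)" by (rule offset_mono) (use l in auto)
    also have "\<dots> < ?i l'" by simp
    finally show "?i l < ?i l'" .
  qed
  moreover have "?i ` {1..length s} \<subseteq> {1..p}"
  proof safe
    fix l assume l: "l \<in> {1..length s}"
    then show "?i l \<in> {1..p}" using order_trans[OF up[OF l] le_p[OF l]] by simp
  qed
  moreover have "1 \<le> s ! (l - 1) \<and> s ! (l - 1) \<le> A (?i l)" if l: "l \<in> {1..length s}" for l
  proof -
    have j: "l - 1 < length s" using l by auto
    then have "s ! (l - 1) \<noteq> 0" using adm by (metis adm_def nth_mem)
    moreover have "s ! (l - 1) \<le> order_bd (concat bs ! (offset bs (l - 1) + c (l - 1)))"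
      using c[OF j] concat_nth_offset[of "l - 1" bs "c (l - 1)"] j len by simp
    moreover have "offset bs (l - 1) + c (l - 1) < p" using up[OF l] le_p[OF l] by simp
    then have "order_bd (concat bs ! (offset bs (l - 1) + c (l - 1))) = A (?i l)"
      unfolding bs(1) slots_def by (simp del: upt_Suc)
    ultimately show ?thesis by simp
  qed
  moreover have "card {l\<in>{1..length s}. s ! (l - 1) = 1} \<le>
      card {i\<in>{1..p}. deg_in i P \<ge> ereal (real (A i) * (real (n i) + 1) - 1)}"
  proof -
    have "{i. i < length s \<and> s ! i = 1} = {i. i < length s \<and> 1 = s ! i}" by auto
    then have "card {l\<in>{1..length s}. s ! (l - 1) = 1} = length (filter ((=) 1) s)"
      unfolding length_filter_conv_card using card_shift[of "length s" "\<lambda>i. s ! i = 1"]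
      by (simp only:)
    also have "\<dots> \<le> length (filter allow1 (slots large_deg))" using assms by (simp add: adm_def)
    also have "\<dots> = card {i. i < p \<and> large_deg (Suc i)}"
      unfolding length_filter_conv_card length_slots
      by (intro arg_cong[of _ _ card]) (auto simp: slots_def simp del: upt_Suc)
    also have "\<dots> = card {i\<in>{1..p}. large_deg (Suc (i - 1))}" by (rule card_shift[symmetric])
    also have "{i\<in>{1..p}. large_deg (Suc (i - 1))} = {i\<in>{1..p}. large_deg i}" by auto
    finally show ?thesis unfolding large_deg_def .
  qed
  ultimately show ?thesis unfolding separated_bound_def Let_def by (intro conjI exI[of _ ?i]) auto
qed

section \<open>The contribution of a single monomial\<close>

definition factor :: "nat \<Rightarrow> nat \<Rightarrow> complex \<Rightarrow> complex" where
  "factor i e z = z ^ e / pochhammer (z + of_nat (r i)) (n i + 1) ^ A i"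

definition pslot :: "nat \<Rightarrow> slot" where
  "pslot i = Slot (A i) True (r i) (r i + n i)"

definition expansion :: "nat \<Rightarrow> nat \<Rightarrow> complex poly \<times> (nat \<Rightarrow> nat \<Rightarrow> complex) \<Rightarrow> bool" where
  "expansion i e x \<longleftrightarrow> K_poly (fst x) \<and> (\<forall>a s. snd x a s \<in> K) \<and> (\<forall>a s. A i < s \<longrightarrow> snd x a s = 0) \<and>
     (\<forall>z. off_poles (pslot i) z \<longrightarrow> factor i e z = poly (fst x) z + pf_sum (pslot i) (snd x) z)"

text \<open>The expansion is fixed once for each variable and exponent, so that the evaluation of
  the series and the symmetry argument refer to the same numbers \<open>sig\<close>.\<close>

definition coeffs_of :: "nat \<Rightarrow> nat \<Rightarrow> complex poly \<times> (nat \<Rightarrow> nat \<Rightarrow> complex)" where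
  "coeffs_of i e = (SOME x. expansion i e x)"

lemma expansion: "expansion i e (coeffs_of i e)"
proof -
  have "quasi_pf (pslot i) (factor i e)"
    unfolding pslot_def factor_def by (rule quasi_pf_pochhammer)
  from quasi_pf_coeffs[OF this] have "\<exists>x. expansion i e x"
    by (auto simp: expansion_def pslot_def)
  then show ?thesis unfolding coeffs_of_def by (rule someI_ex)
qed

definition sig :: "nat \<Rightarrow> nat \<Rightarrow> nat \<Rightarrow> complex" where
  "sig i e s = (\<Sum>a=r i..r i + n i. snd (coeffs_of i e) a s)"

lemma sig_in_K: "sig i e s \<in> K"
  unfolding sig_def using expansion[of i e] by (auto simp: expansion_def)

lemma sig_eq_0: "A i < s \<Longrightarrow> sig i e s = 0"
  unfolding sig_def using expansion[of i e] by (auto simp: expansion_def)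

definition order_at :: "nat \<Rightarrow> nat \<Rightarrow> int" where
  "order_at i e = int e - int (A i * (n i + 1))"

lemma real_order_at: "real_of_int (order_at i e) = real e - real (A i) * (real (n i) + 1)"
  by (simp add: order_at_def distrib_left)

lemma factor_bound:
  assumes "k > 0"
  shows "norm (factor i e (of_nat k)) \<le> 1 * real k powi order_at i e"
proof -
  have "real k ^ (n i + 1) = (\<Prod>j=0..<n i + 1. real k)" by simp
  also have "\<dots> \<le> (\<Prod>j=0..<n i + 1. norm (of_nat k + of_nat (r i) + of_nat j :: complex))"
  proof (rule prod_mono, safe)
    fix j
    have "norm (of_nat k + of_nat (r i) + of_nat j :: complex) = real (k + r i + j)"
      by (metis norm_of_nat of_nat_add)
    then show "real k \<le> norm (of_nat k + of_nat (r i) + of_nat j :: complex)" by simp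
  qed simp
  also have "\<dots> = norm (pochhammer (of_nat k + of_nat (r i)) (n i + 1) :: complex)"
    by (simp add: pochhammer_prod prod_norm)
  finally have lower: "(real k ^ (n i + 1)) ^ A i \<le> norm (pochhammer (of_nat k + of_nat (r i)) (n i + 1) :: complex) ^ A i"
    by (rule power_mono) simp
  have "norm (factor i e (of_nat k)) \<le> real k ^ e / (real k ^ (n i + 1)) ^ A i"
    unfolding factor_def norm_divide norm_power norm_of_nat
    using assms lower by (intro divide_left_mono lower mult_pos_pos less_le_trans[OF _ lower]) auto
  also have "(real k ^ (n i + 1)) ^ A i = real k ^ (A i * (n i + 1))"
    by (simp only: power_mult[symmetric] mult.commute)
  also have "real k ^ e / real k ^ (A i * (n i + 1)) = real k powi order_at i e"
    using assms unfolding order_at_def by (subst power_int_diff) (simp_all only: power_int_of_nat of_nat_0_less_iff less_irrefl, auto)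
  finally show ?thesis by simp
qed

text \<open>Flags and growth orders are those of one monomial, tied together as
  \<open>mixed_sig\<close> requires; the flags of \<open>slots large_deg\<close>, read off the
  degrees of \<open>P\<close>, only dominate them.\<close>

definition mon_slots :: "(nat \<Rightarrow>\<^sub>0 nat) \<Rightarrow> (slot \<times> int) list" where
  "mon_slots m = map (\<lambda>i. (Slot (A i) (order_at i (Poly_Mapping.lookup m i) \<ge> -1) (r i) (r i + n i),
     order_at i (Poly_Mapping.lookup m i))) [1..<p + 1]"

definition mon_factors :: "(nat \<Rightarrow>\<^sub>0 nat) \<Rightarrow> ((nat \<Rightarrow> complex) \<times> (nat \<Rightarrow> complex)) list" where
  "mon_factors m = map (\<lambda>i. (\<lambda>k. factor i (Poly_Mapping.lookup m i) (of_nat k), sig i (Poly_Mapping.lookup m i))) [1..<p + 1]"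

lemma mon_factors_mixed_sig:
  "list_all2 (\<lambda>(d, \<delta>) (f, \<sigma>). mixed_sig d \<delta> f \<sigma>) (mon_slots m) (mon_factors m)"
proof -
  have "mixed_sig (Slot (A i) (order_at i e \<ge> -1) (r i) (r i + n i)) (order_at i e)
      (\<lambda>k. factor i e (of_nat k)) (sig i e)" (is "mixed_sig ?d _ _ _") for i e
  proof -
    have "factor i e (of_nat k) = poly (fst (coeffs_of i e)) (of_nat k) + pf_sum ?d (snd (coeffs_of i e)) (of_nat k)"
      if "k > 0" for k
      using expansion[of i e] off_poles_of_nat[OF that, of "pslot i"]
      by (simp add: expansion_def pf_sum_def pslot_def)
    then show ?thesis
      unfolding mixed_sig_def using factor_bound[of _ i e] expansion[of i e]
      by (intro conjI exI[of _ 1] exI[of _ "fst (coeffs_of i e)"] exI[of _ "snd (coeffs_of i e)"])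
        (auto simp: sig_def[abs_def] expansion_def)
  qed
  then show ?thesis by (simp add: mon_slots_def mon_factors_def list_all2_conv_all_nth del: upt_Suc)
qed

lemma deg_in_ge: "m \<in> Poly_Mapping.keys P \<Longrightarrow> ereal (real (Poly_Mapping.lookup m i)) \<le> deg_in i P"
  unfolding deg_in_def by (rule SUP_upper)

lemma surplus_mon_slots:
  assumes m: "m \<in> Poly_Mapping.keys P"
  shows "surplus_bounded 1 (map snd (mon_slots m))"
proof (rule surplus_boundedI)
  fix j assume "j < length (map snd (mon_slots m))"
  then have j: "j < p" by (simp add: mon_slots_def del: upt_Suc)
  have "ereal (\<Sum>i=1..Suc j. real (Poly_Mapping.lookup m i)) \<le> (\<Sum>i=1..Suc j. deg_in i P)"
    unfolding sum_ereal[symmetric] by (intro sum_mono deg_in_ge m)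
  also have "\<dots> \<le> ereal ((\<Sum>i=1..Suc j. real (A i) * (real (n i) + 1)) - real (Suc j) - 1)"
    using deg j by (intro bspec[OF deg]) auto
  finally have "(\<Sum>i=1..Suc j. real (Poly_Mapping.lookup m i)) \<le> (\<Sum>i=1..Suc j. real (A i) * (real (n i) + 1)) - real (Suc j) - 1"
    by simp
  \<comment> \<open>Here \<open>j\<close> counts from 0: the first j + 1 orders add up to at most -
    (j + 1) - 1.\<close>
  then have "(\<Sum>i=1..Suc j. real_of_int (order_at i (Poly_Mapping.lookup m i))) + real j + 2 \<le> 0"
    by (simp add: real_order_at sum_subtractf)
  then have "real_of_int ((\<Sum>i=1..Suc j. order_at i (Poly_Mapping.lookup m i)) + int j + 2) \<le> real_of_int 0" by simp
  then have "(\<Sum>i=1..Suc j. order_at i (Poly_Mapping.lookup m i)) + int j + 2 \<le> 0" by linarith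
  moreover have "(\<Sum>i\<le>j. map snd (mon_slots m) ! i) = (\<Sum>i\<le>j. order_at (Suc i) (Poly_Mapping.lookup m (Suc i)))"
    using j by (intro sum.cong) (auto simp: mon_slots_def simp del: upt_Suc)
  moreover have "\<dots> = (\<Sum>i=1..Suc j. order_at i (Poly_Mapping.lookup m i))"
    by (rule sum.reindex_bij_witness[of _ "\<lambda>i. i - 1" Suc]) auto
  ultimately show "1 + (\<Sum>i\<le>j. map snd (mon_slots m) ! i) + int j + 1 \<le> 0" by simp
qed

lemma separated_less:
  assumes separated "1 \<le> i" "i < j" "j \<le> p"
  shows "r j + n j < r i"
  using assms(3,4)
proof (induction j)
  case (Suc j)
  have step: "r (Suc j) + n (Suc j) < r j"
    using assms(1,2) Suc.prems by (auto simp: separated_def dest!: spec[of _ j])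
  show ?case
  proof (cases "i = j")
    case False
    then have "r j + n j < r i" using Suc by simp
    then show ?thesis using step by simp
  qed (use step in simp)
qed simp

lemma sep_mon_slots: "separated \<longrightarrow> sep_slots (map fst (mon_slots m))"
  using separated_less
  by (auto simp: sep_slots_def mon_slots_def sorted_wrt_iff_nth_less simp del: upt_Suc)

lemma mon_slots_le: "m \<in> Poly_Mapping.keys P \<Longrightarrow> list_all2 slot_le (map fst (mon_slots m)) (slots large_deg)"
proof -
  assume m: "m \<in> Poly_Mapping.keys P"
  have "large_deg i" if "order_at i (Poly_Mapping.lookup m i) \<ge> -1" for i
  proof -
    have "real_of_int (order_at i (Poly_Mapping.lookup m i)) \<ge> -1" using that by linarith
    then have "real (A i) * (real (n i) + 1) - 1 \<le> real (Poly_Mapping.lookup m i)"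
      unfolding real_order_at by simp
    then have "ereal (real (A i) * (real (n i) + 1) - 1) \<le> ereal (real (Poly_Mapping.lookup m i))" by simp
    also have "\<dots> \<le> deg_in i P" by (rule deg_in_ge[OF m])
    finally show ?thesis by (simp add: large_deg_def)
  qed
  then show ?thesis
    by (simp add: mon_slots_def slots_def slot_le_def list_all2_conv_all_nth del: upt_Suc)
qed

definition expo :: "nat list set" where
  "expo = exponents (slots large_deg)"

lemma expo_iff: "s \<in> expo \<longleftrightarrow> length s = p \<and> (\<forall>i\<in>{1..p}. 1 \<le> s ! (i - 1) \<and> s ! (i - 1) \<le> A i)"
proof -
  have "(\<forall>i<p. 1 \<le> s ! i \<and> s ! i \<le> A (Suc i)) \<longleftrightarrow> (\<forall>i\<in>{1..p}. 1 \<le> s ! (i - 1) \<and> s ! (i - 1) \<le> A i)"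
    by (metis (no_types, lifting) Suc_le_D Suc_le_eq Suc_pred' atLeastAtMost_iff diff_Suc_1 One_nat_def zero_less_Suc)
  then show ?thesis
    by (auto simp: expo_def exponents_iff slots_def list_all2_conv_all_nth simp del: upt_Suc)
qed

lemma exponents_mon_slots: "exponents (map fst (mon_slots m)) = expo"
proof (rule Set.set_eqI)
  fix s
  show "s \<in> exponents (map fst (mon_slots m)) \<longleftrightarrow> s \<in> expo"
    by (auto simp: expo_def exponents_iff slots_def mon_slots_def list_all2_conv_all_nth simp del: upt_Suc)
qed

lemma weight_mon_factors:
  assumes "length s = p"
  shows "weight (map snd (mon_factors m)) s = (\<Prod>i=1..p. sig i (Poly_Mapping.lookup m i) (s ! (i - 1)))"
proof -
  have "weight \<sigma>s s = (\<Prod>i<length s. (\<sigma>s ! i) (s ! i))" if "length \<sigma>s = length s" for \<sigma>s s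
    using that
  proof (induction \<sigma>s s rule: list_induct2)
    case (Cons \<sigma> \<sigma>s x s)
    then show ?case by (simp add: prod.lessThan_Suc_shift del: prod.lessThan_Suc)
  qed simp
  then have "weight (map snd (mon_factors m)) s = (\<Prod>i<p. (map snd (mon_factors m) ! i) (s ! i))"
    using assms by (simp add: mon_factors_def)
  also have "\<dots> = (\<Prod>i<p. sig (Suc i) (Poly_Mapping.lookup m (Suc i)) (s ! i))"
    by (intro prod.cong) (auto simp: mon_factors_def simp del: upt_Suc)
  also have "\<dots> = (\<Prod>i=1..p. sig i (Poly_Mapping.lookup m i) (s ! (i - 1)))"
    by (rule prod.reindex_bij_witness[of _ "\<lambda>i. i - 1" Suc]) auto
  finally show ?thesis .
qed

text \<open>These are the coefficients of the element \<open>x\<close> of the theorem.\<close>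

definition fcoeff :: "nat list \<Rightarrow> complex" where
  "fcoeff s = (if length s = p \<and> 0 \<notin> set s
     then \<Sum>m\<in>Poly_Mapping.keys P. Poly_Mapping.lookup P m * (\<Prod>i=1..p. sig i (Poly_Mapping.lookup m i) (s ! (i - 1))) else 0)"

lemma fcoeff_in_K: "fcoeff s \<in> K"
proof -
  have "Poly_Mapping.lookup P m \<in> K" for m using P_over by (simp add: polys_over_def)
  then show ?thesis unfolding fcoeff_def by (auto intro!: sum_closed mult_closed prod_closed sig_in_K)
qed

text \<open>A nonzero coefficient receives a nonzero contribution from some monomial. For that
  monomial the residues add up to zero in every slot that does not allow the exponent 1, in
  particular in the first one.\<close>

lemma fcoeff_support:
  assumes "fcoeff s \<noteq> 0"
  shows "s \<in> expo" "adm separated (slots large_deg) s"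
proof -
  have s: "length s = p" "0 \<notin> set s" using assms by (auto simp: fcoeff_def split: if_splits)
  obtain m where m: "m \<in> Poly_Mapping.keys P" "(\<Prod>i=1..p. sig i (Poly_Mapping.lookup m i) (s ! (i - 1))) \<noteq> 0"
    using assms s unfolding fcoeff_def by (metis (no_types, lifting) mult_zero_right sum.neutral)
  have "1 \<le> s ! (i - 1) \<and> s ! (i - 1) \<le> A i" if i: "i \<in> {1..p}" for i
  proof -
    have "s ! (i - 1) \<in> set s" using i s(1) by (intro nth_mem) auto
    then have "s ! (i - 1) \<noteq> 0" using s(2) by metis
    moreover have "sig i (Poly_Mapping.lookup m i) (s ! (i - 1)) \<noteq> 0" using m(2) i by auto
    then have "s ! (i - 1) \<le> A i" using sig_eq_0 not_le by blast
    ultimately show ?thesis by simp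
  qed
  then show "s \<in> expo" using s by (simp add: expo_iff)
  then have ex: "s \<in> exponents (map fst (mon_slots m))" by (simp add: exponents_mon_slots)
  have "list_all2 (\<lambda>(d, \<delta>) \<sigma>. \<not> allow1 d \<longrightarrow> \<sigma> 1 = 0) (mon_slots m) (map snd (mon_factors m))"
    using mon_factors_mixed_sig[of m]
  proof (induction rule: list_all2_induct)
    case (Cons x xs y ys)
    obtain d \<delta> f \<sigma> where "x = (d, \<delta>)" "y = (f, \<sigma>)" by (cases x; cases y)
    then show ?case using Cons mixed_split[of d \<delta> f \<sigma>] slot_sig_props(2)[of d _ \<sigma>] by auto
  qed simp
  then have flags: "list_all2 (\<lambda>d \<sigma>. \<not> allow1 d \<longrightarrow> \<sigma> 1 = 0) (map fst (mon_slots m)) (map snd (mon_factors m))"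
    by (simp add: list_all2_map1 case_prod_unfold)
  have hd: "\<not> allow1 (hd (map fst (mon_slots m)))"
  proof -
    have "[1..<p + 1] = 1 # [Suc 1..<p + 1]" by (rule upt_conv_Cons) (use p1 in simp)
    then show ?thesis using surplus_mon_slots[OF m(1)] by (simp add: mon_slots_def del: upt_Suc)
  qed
  have "adm separated (map fst (mon_slots m)) s"
    by (rule exponents_adm[OF ex _ _ flags]) (use m(2) hd weight_mon_factors[OF s(1)] in auto)
  then show "adm separated (slots large_deg) s" by (rule adm_mono[OF _ mon_slots_le[OF m(1)]])
qed

lemma finite_expo: "finite expo"
  by (simp add: expo_def)

lemma sum_top_value:
  "(\<Sum>m\<in>Poly_Mapping.keys P. Poly_Mapping.lookup P m * top_value (map fst (mon_slots m)) (map snd (mon_factors m))) =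
    (\<Sum>s\<in>expo. fcoeff s * mzv s)"
proof -
  have "(\<Sum>m\<in>Poly_Mapping.keys P. Poly_Mapping.lookup P m * top_value (map fst (mon_slots m)) (map snd (mon_factors m))) =
      (\<Sum>m\<in>Poly_Mapping.keys P. \<Sum>s\<in>expo. Poly_Mapping.lookup P m * (\<Prod>i=1..p. sig i (Poly_Mapping.lookup m i) (s ! (i - 1))) * mzv s)"
    unfolding top_value_def exponents_mon_slots sum_distrib_left
    by (intro sum.cong refl) (simp add: weight_mon_factors expo_iff)
  also have "\<dots> = (\<Sum>s\<in>expo. (\<Sum>m\<in>Poly_Mapping.keys P. Poly_Mapping.lookup P m * (\<Prod>i=1..p. sig i (Poly_Mapping.lookup m i) (s ! (i - 1)))) * mzv s)"
    by (subst sum.swap) (simp add: sum_distrib_right)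
  also have "\<dots> = (\<Sum>s\<in>expo. fcoeff s * mzv s)"
  proof (rule sum.cong[OF refl])
    fix s assume s: "s \<in> expo"
    have "0 \<notin> set s"
    proof
      assume "0 \<in> set s"
      then obtain j where "j < p" "s ! j = 0" using s by (auto simp: in_set_conv_nth expo_iff)
      then show False using s[unfolded expo_iff] by (auto dest!: bspec[of _ _ "Suc j"])
    qed
    then show "(\<Sum>m\<in>Poly_Mapping.keys P. Poly_Mapping.lookup P m * (\<Prod>i=1..p. sig i (Poly_Mapping.lookup m i) (s ! (i - 1)))) * mzv s =
        fcoeff s * mzv s"
      using s by (simp add: fcoeff_def expo_iff)
  qed
  finally show ?thesis .
qed

lemma value_ratio:
  assumes off: "\<And>i. i \<in> {1..p} \<Longrightarrow> off_poles (pslot i) (x i)"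
  shows "poly_value x (ser_denom p A n r) \<noteq> 0"
    and "poly_value x P / poly_value x (ser_denom p A n r) =
      (\<Sum>m\<in>Poly_Mapping.keys P. Poly_Mapping.lookup P m * (\<Prod>i=1..p. factor i (Poly_Mapping.lookup m i) (x i)))"
proof -
  have "pochhammer (x i + of_nat (r i)) (n i + 1) \<noteq> 0" if i: "i \<in> {1..p}" for i
  proof -
    have "x i + of_nat (r i) + of_nat j \<noteq> 0" if "j \<le> n i" for j
      using off[OF i] that by (auto simp: off_poles_def pslot_def add.assoc dest!: bspec[of _ _ "r i + j"])
    then show ?thesis by (auto simp: pochhammer_prod)
  qed
  then show "poly_value x (ser_denom p A n r) \<noteq> 0" by (auto simp: poly_value_ser_denom)
  show "poly_value x P / poly_value x (ser_denom p A n r) =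
      (\<Sum>m\<in>Poly_Mapping.keys P. Poly_Mapping.lookup P m * (\<Prod>i=1..p. factor i (Poly_Mapping.lookup m i) (x i)))"
    unfolding poly_value_polys_over[OF P_over] poly_value_ser_denom factor_def
    by (simp add: sum_divide_distrib prod_dividef)
qed

lemma ser_term_eq:
  assumes k: "k \<in> weak_chains p"
  shows "ser_term (Fract P (ser_denom p A n r)) k =
    (\<Sum>m\<in>Poly_Mapping.keys P. Poly_Mapping.lookup P m * (\<Prod>j<length (map fst (mon_factors m)). (map fst (mon_factors m) ! j) (k ! j)))"
proof -
  have "k ! (i - 1) > 0" if "i \<in> {1..p}" for i
  proof -
    have "k ! (i - 1) \<in> set k" using k that by (intro nth_mem) (auto simp: weak_chains_def)
    then show ?thesis using k by (metis (mono_tags, lifting) gr0I mem_Collect_eq weak_chains_def)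
  qed
  note v = value_ratio[of "\<lambda>i. of_nat (k ! (i - 1))", OF off_poles_of_nat[OF this]]
  have "(\<Prod>j<length (map fst (mon_factors m)). (map fst (mon_factors m) ! j) (k ! j)) =
      (\<Prod>i=1..p. factor i (Poly_Mapping.lookup m i) (of_nat (k ! (i - 1))))" for m
  proof -
    have "(\<Prod>j<length (map fst (mon_factors m)). (map fst (mon_factors m) ! j) (k ! j)) =
        (\<Prod>j<p. factor (Suc j) (Poly_Mapping.lookup m (Suc j)) (of_nat (k ! j)))"
      by (intro prod.cong) (auto simp: mon_factors_def simp del: upt_Suc)
    also have "\<dots> = (\<Prod>i=1..p. factor i (Poly_Mapping.lookup m i) (of_nat (k ! (i - 1))))"
      by (rule prod.reindex_bij_witness[of _ "\<lambda>i. i - 1" Suc]) auto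
    finally show ?thesis .
  qed
  then show ?thesis
    using v by (simp add: ser_term_def ratfun_value_Fract del: upt_Suc)
qed

text \<open>The degree hypothesis bounds every monomial of \<open>P\<close>, so each monomial has a
  summable series of its own and the infinite sum may be split.\<close>

lemma series_value:
  shows "ser_term (Fract P (ser_denom p A n r)) summable_on weak_chains p"
    and "(\<Sum>\<^sub>\<infinity>k\<in>weak_chains p. ser_term (Fract P (ser_denom p A n r)) k) - (\<Sum>s\<in>expo. fcoeff s * mzv s)
      \<in> zspan (lower_adms separated (slots large_deg))"
proof -
  let ?f = "\<lambda>m k. \<Prod>j<length (map fst (mon_factors m)). (map fst (mon_factors m) ! j) (k ! j)"
  let ?S = "\<lambda>m. infsum (?f m) (weak_chains p)"
  have len: "length (map fst (mon_factors m)) = p" for m by (simp add: mon_factors_def)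
  have "list_all2 (\<lambda>f d. \<exists>C. \<forall>k>0. norm (f k) \<le> C * real k powi d) (map fst (mon_factors m)) (map snd (mon_slots m))" for m
    using factor_bound
    by (auto simp: mon_factors_def mon_slots_def list_all2_conv_all_nth simp del: upt_Suc intro!: exI[of _ 1])
  from summable_on_weak_chains[OF surplus_mon_slots this]
  have summ: "?f m summable_on weak_chains p" if "m \<in> Poly_Mapping.keys P" for m
    using that unfolding len by blast
  then have hs: "(?f m has_sum ?S m) (weak_chains p)" if "m \<in> Poly_Mapping.keys P" for m
    using that by (intro has_sum_infsum)
  have "((\<lambda>k. \<Sum>m\<in>Poly_Mapping.keys P. Poly_Mapping.lookup P m * ?f m k) has_sum (\<Sum>m\<in>Poly_Mapping.keys P. Poly_Mapping.lookup P m * ?S m)) (weak_chains p)"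
    by (intro has_sum_finite_sum has_sum_cmult_right hs) auto
  then have total: "(ser_term (Fract P (ser_denom p A n r)) has_sum (\<Sum>m\<in>Poly_Mapping.keys P. Poly_Mapping.lookup P m * ?S m)) (weak_chains p)"
    by (subst has_sum_cong[OF ser_term_eq]) auto
  then show "ser_term (Fract P (ser_denom p A n r)) summable_on weak_chains p"
    by (rule has_sum_imp_summable)
  let ?t = "\<lambda>m. top_value (map fst (mon_slots m)) (map snd (mon_factors m))"
  have "?S m - ?t m \<in> zspan (lower_adms separated (slots large_deg))" if m: "m \<in> Poly_Mapping.keys P" for m
  proof -
    obtain v where v: "v \<in> zspan (lower_adms separated (map fst (mon_slots m)))"
      "(\<lambda>N. wsum (map fst (mon_factors m)) N - ?t m) \<longlonglongrightarrow> v"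
      using lim_rep_mixed(1)[OF mixed_reducible surplus_mon_slots[OF m] sep_mon_slots mon_factors_mixed_sig]
      unfolding lim_rep_def by blast
    have "(?f m has_sum ?S m) {k. length k = length (map fst (mon_factors m)) \<and> sorted_wrt (\<ge>) k \<and> 0 \<notin> set k}"
      using hs[OF m] unfolding len weak_chains_def .
    then have "wsum (map fst (mon_factors m)) \<longlonglongrightarrow> ?S m"
      by (rule has_sum_chains_tendsto[rotated 2]) auto
    then have "(\<lambda>N. wsum (map fst (mon_factors m)) N - ?t m) \<longlonglongrightarrow> ?S m - ?t m"
      by (intro tendsto_intros)
    with v(2) have "?S m - ?t m = v" by (intro LIMSEQ_unique)
    then show ?thesis using zspan_mono[OF v(1) lower_adms_mono[OF mon_slots_le[OF m]]] by simp
  qed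
  then have "(\<Sum>m\<in>Poly_Mapping.keys P. Poly_Mapping.lookup P m * (?S m - ?t m)) \<in> zspan (lower_adms separated (slots large_deg))"
    using P_over by (intro zspan_sum zspan_scale) (auto simp: polys_over_def)
  also have "(\<Sum>m\<in>Poly_Mapping.keys P. Poly_Mapping.lookup P m * (?S m - ?t m)) =
      (\<Sum>\<^sub>\<infinity>k\<in>weak_chains p. ser_term (Fract P (ser_denom p A n r)) k) - (\<Sum>s\<in>expo. fcoeff s * mzv s)"
    using infsumI[OF total] sum_top_value by (simp add: right_diff_distrib sum_subtractf)
  finally show "(\<Sum>\<^sub>\<infinity>k\<in>weak_chains p. ser_term (Fract P (ser_denom p A n r)) k) -
      (\<Sum>s\<in>expo. fcoeff s * mzv s) \<in> zspan (lower_adms separated (slots large_deg))" .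
qed

section \<open>Equivariance of the depth \<open>p\<close> coefficients\<close>

definition centre :: "nat \<Rightarrow> complex" where
  "centre i = of_nat (r i) + of_nat (n i) / 2"

lemma poly_value_rho_subst:
  assumes "i \<in> {1..p}"
  shows "poly_value x (rho_subst p n r (e, g) i) = of_int (e (g i)) * (x (g i) + centre (g i)) - centre i"
  using assms
  by (simp add: rho_subst_def Kshift_def centre_def poly_value_diff poly_value_mult poly_value_add
      del: PConst_hom)

lemma ser_denom_nonzero: "ser_denom p A n r \<noteq> 0"
  using value_ratio(1)[of "\<lambda>i. of_nat 1", OF off_poles_of_nat] by auto

lemma equivariant_values:
  assumes h: "h \<in> carrier (signed_perm_group p)"
    and rho: "rho p n r h (Fract P (ser_denom p A n r)) = scale_ratfun c (Fract P (ser_denom p A n r))"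
    and off: "\<And>i. i \<in> {1..p} \<Longrightarrow> off_poles (pslot i) (x i)"
      "\<And>i. i \<in> {1..p} \<Longrightarrow> off_poles (pslot i) (poly_value x (rho_subst p n r h i))"
  shows "(\<Sum>m\<in>Poly_Mapping.keys P. Poly_Mapping.lookup P m *
      (\<Prod>i=1..p. factor i (Poly_Mapping.lookup m i) (poly_value x (rho_subst p n r h i)))) =
    c * (\<Sum>m\<in>Poly_Mapping.keys P. Poly_Mapping.lookup P m *
      (\<Prod>i=1..p. factor i (Poly_Mapping.lookup m i) (x i)))"
proof -
  let ?D = "ser_denom p A n r" and ?s = "poly_subst (rho_subst p n r h)"
  have nz: "?D \<noteq> 0" "?s ?D \<noteq> 0"
    using ser_denom_nonzero poly_subst_rho_subst_eq_0[OF h] by blast+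
  have "Fract (?s P) (?s ?D) = Fract (PConst c * P) ?D"
    using rho unfolding rho_Fract[OF h nz(1)] scale_ratfun_def by simp
  then have "?s P * ?D = PConst c * P * ?s ?D" using nz by (simp add: eq_fract)
  then have "poly_value x (?s P) * poly_value x ?D = c * poly_value x P * poly_value x (?s ?D)"
    by (metis poly_value_mult poly_value_PConst)
  then have "poly_value (\<lambda>i. poly_value x (rho_subst p n r h i)) P * poly_value x ?D =
      c * poly_value x P * poly_value (\<lambda>i. poly_value x (rho_subst p n r h i)) ?D"
    unfolding poly_value_subst .
  moreover note value_ratio[OF off(1)] value_ratio[OF off(2)]
  ultimately show ?thesis by (simp add: divide_simps mult_ac)
qed

text \<open>Restricted to large integers, the hypothesis on \<open>R\<close> says that a linear
  combination of products of functions of one variable vanishes. Replacing each of these functions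
  by its signature, which is legitimate by \<open>tensor_sig\<close>, turns it into the relation
  between the coefficients.\<close>

lemma fcoeff_equivariant:
  assumes h: "(e, g) \<in> carrier (signed_perm_group p)"
    and rho: "rho p n r (e, g) (Fract P (ser_denom p A n r)) = scale_ratfun c (Fract P (ser_denom p A n r))"
    and t: "length t = p" "0 \<notin> set t"
  shows "(\<Prod>i=1..p. of_int (e i) ^ (t ! (i - 1))) * fcoeff (perm_tuple p (Hilbert_Choice.inv g) t) =
    c * fcoeff t"
proof -
  have eg: "e \<in> {1..p} \<rightarrow>\<^sub>E {-1, 1}" "g permutes {1..p}"
    using h by (auto simp: signed_perm_group_def sym_group_carrier)
  let ?g' = "Hilbert_Choice.inv g" and ?M = "Poly_Mapping.keys P"
  have g': "?g' permutes {1..p}" by (rule permutes_inv[OF eg(2)])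
  have gg: "g (?g' j) = j" "?g' (g j) = j" for j
    using permutes_inverses[OF eg(2)] by auto
  have in_p: "?g' j \<in> {1..p} \<longleftrightarrow> j \<in> {1..p}" "g j \<in> {1..p} \<longleftrightarrow> j \<in> {1..p}" for j
    using permutes_in_image[OF g'] permutes_in_image[OF eg(2)] by auto
  define \<epsilon> where "\<epsilon> j = (if j \<in> {1..p} then of_int (e j) else 1 :: complex)" for j
  have \<epsilon>: "\<epsilon> j = 1 \<or> \<epsilon> j = -1" for j
    using eg(1) by (auto simp: \<epsilon>_def PiE_def Pi_def)
  \<comment> \<open>Products are arranged by the variable \<open>k j\<close> and not by the factor:
    \<open>k j\<close> enters the factor with index \<open>?g' j\<close>, at the point \<epsilon>_j
    (k_j + centre_j) - centre_(g'(j)).\<close>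
  define u where "u j = \<epsilon> j * centre j - centre (?g' j)" for j
  define F where "F m j k = factor j (Poly_Mapping.lookup m j) (1 * of_nat k + 0)" for m j k
  define F' where "F' m j k = factor (?g' j) (Poly_Mapping.lookup m (?g' j)) (\<epsilon> j * of_nat k + u j)" for m j k
  have exp_i: "factor i l z = poly (fst (coeffs_of i l)) z + pf_sum (pslot i) (snd (coeffs_of i l)) z"
    if "off_poles (pslot i) z" for i l z
    using expansion[of i l] that by (auto simp: expansion_def)
  have zero_i: "snd (coeffs_of i l) a s = 0" if "order_bd (pslot i) < s" for i l a s
    using expansion[of i l] that by (auto simp: expansion_def pslot_def)
  have sig_i: "(\<Sum>a=pmin (pslot i)..pmax (pslot i). snd (coeffs_of i l) a s) = sig i l s" for i l s
    by (simp add: sig_def pslot_def)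
  have affine: "has_sig (\<lambda>k. factor i l (v * of_nat k + w)) (\<lambda>s. if s = 0 then 0 else v ^ s * sig i l s)"
    "\<forall>\<^sub>F k in sequentially. off_poles (pslot i) (v * of_nat k + w)"
    if "v = 1 \<or> v = -1" for i l v w
    using has_sig_affine[of "pslot i" "factor i l" _ "snd (coeffs_of i l)" v w, OF exp_i that zero_i]
    unfolding sig_i by blast+
  have "\<forall>\<^sub>F k in sequentially. \<forall>j\<in>{1..p}. off_poles (pslot (?g' j)) (\<epsilon> j * of_nat k + u j)"
    by (intro eventually_ball_finite ballI affine(2) \<epsilon>) auto
  then obtain N0 where N0: "\<And>k j. k \<ge> N0 \<Longrightarrow> j \<in> {1..p} \<Longrightarrow> off_poles (pslot (?g' j)) (\<epsilon> j * of_nat k + u j)"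
    unfolding eventually_sequentially by blast
  \<comment> \<open>From \<open>N0\<close> on the transformed arguments avoid the poles; the bound 1
    ensures the same for the original arguments, whose poles are at nonpositive integers.\<close>
  define N where "N = max 1 N0"
  have key: "(\<Sum>m\<in>?M. Poly_Mapping.lookup P m * (\<Prod>j=1..p. F' m j (k j))) =
      c * (\<Sum>m\<in>?M. Poly_Mapping.lookup P m * (\<Prod>j=1..p. F m j (k j)))"
    if k: "\<And>j. j \<in> {1..p} \<Longrightarrow> N \<le> k j" for k
  proof -
    let ?x = "\<lambda>j. of_nat (k j) :: complex"
    have val: "poly_value ?x (rho_subst p n r (e, g) (?g' j)) = \<epsilon> j * of_nat (k j) + u j"
      if "j \<in> {1..p}" for j
      using that in_p by (simp add: poly_value_rho_subst gg \<epsilon>_def u_def algebra_simps)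
    have off1: "off_poles (pslot i) (?x i)" if "i \<in> {1..p}" for i
      by (rule off_poles_of_nat) (use k[OF that] in \<open>simp add: N_def\<close>)
    have off2: "off_poles (pslot i) (poly_value ?x (rho_subst p n r (e, g) i))" if i: "i \<in> {1..p}" for i
      using val[of "g i"] N0[of "k (g i)" "g i"] k[of "g i"] in_p(2)[of i] i by (simp add: gg N_def)
    have "(\<Prod>j=1..p. F' m j (k j)) =
        (\<Prod>i=1..p. factor i (Poly_Mapping.lookup m i) (poly_value ?x (rho_subst p n r (e, g) i)))" for m
    proof -
      have "(\<Prod>j=1..p. F' m j (k j)) = (\<Prod>j=1..p. factor (?g' j) (Poly_Mapping.lookup m (?g' j))
          (poly_value ?x (rho_subst p n r (e, g) (?g' j))))"
        by (intro prod.cong refl) (simp add: F'_def val)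
      then show ?thesis
        using prod.permute[OF g', of "\<lambda>i. factor i (Poly_Mapping.lookup m i)
          (poly_value ?x (rho_subst p n r (e, g) i))"] by (simp add: comp_def)
    qed
    then show ?thesis using equivariant_values[OF h rho off1 off2] by (simp add: F_def)
  qed
  \<comment> \<open>Both sides of the relation form one vanishing sum: the tag \<open>True\<close>
    marks the transformed terms, \<open>False\<close> the original ones, which carry the weight
    \<open>- c\<close>.\<close>
  define G where "G x = (if snd x then F' (fst x) else F (fst x))" for x :: "(nat \<Rightarrow>\<^sub>0 nat) \<times> bool"
  define w where "w x = (if snd x then 1 else - c) * Poly_Mapping.lookup P (fst x)"
    for x :: "(nat \<Rightarrow>\<^sub>0 nat) \<times> bool"
  define \<tau> where "\<tau> x j s = (if s = 0 then 0 else if snd x then \<epsilon> j ^ s * sig (?g' j) (Poly_Mapping.lookup (fst x) (?g' j)) s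
      else 1 ^ s * sig j (Poly_Mapping.lookup (fst x) j) s)" for x :: "(nat \<Rightarrow>\<^sub>0 nat) \<times> bool" and j s
  have split: "(\<Sum>x\<in>?M \<times> UNIV. w x * H x) =
      (\<Sum>m\<in>?M. Poly_Mapping.lookup P m * H (m, True)) - c * (\<Sum>m\<in>?M. Poly_Mapping.lookup P m * H (m, False))"
    for H
    unfolding sum.cartesian_product[symmetric, of "\<lambda>m b. w (m, b) * H (m, b)", unfolded split_pairs case_prod_unfold prod.collapse]
    by (simp add: w_def UNIV_bool sum.distrib sum_distrib_left sum_negf mult_ac sum_subtractf)
  have "(\<Sum>x\<in>?M \<times> UNIV. w x * (\<Prod>j=1..p. \<tau> x j (t ! (j - 1)))) = 0"
  proof (rule tensor_sig[where F = G and N = N])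
    show "has_sig (G x j) (\<tau> x j)" for x j
    proof (cases "snd x")
      case True
      then have "G x j = (\<lambda>k. factor (?g' j) (Poly_Mapping.lookup (fst x) (?g' j)) (\<epsilon> j * of_nat k + u j))"
        "\<tau> x j = (\<lambda>s. if s = 0 then 0 else \<epsilon> j ^ s * sig (?g' j) (Poly_Mapping.lookup (fst x) (?g' j)) s)"
        by (auto simp: G_def F'_def \<tau>_def)
      then show ?thesis using affine(1)[OF \<epsilon>] by simp
    next
      case False
      then have "G x j = (\<lambda>k. factor j (Poly_Mapping.lookup (fst x) j) (1 * of_nat k + 0))"
        "\<tau> x j = (\<lambda>s. if s = 0 then 0 else 1 ^ s * sig j (Poly_Mapping.lookup (fst x) j) s)"
        by (auto simp: G_def F_def \<tau>_def)
      then show ?thesis using affine(1)[of 1 j "Poly_Mapping.lookup (fst x) j" 0] by simp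
    qed
    show "(\<Sum>x\<in>?M \<times> UNIV. w x * (\<Prod>j=1..p. G x j (k j))) = 0"
      if "\<And>j. j \<in> {1..p} \<Longrightarrow> N \<le> k j" for k
      using key[OF that] unfolding split by (simp add: G_def)
  qed auto
  then have main: "(\<Sum>m\<in>?M. Poly_Mapping.lookup P m * (\<Prod>j=1..p. \<tau> (m, True) j (t ! (j - 1)))) =
      c * (\<Sum>m\<in>?M. Poly_Mapping.lookup P m * (\<Prod>j=1..p. \<tau> (m, False) j (t ! (j - 1))))"
    unfolding split by simp
  have t0: "t ! (j - 1) \<noteq> 0" if "j \<in> {1..p}" for j
  proof -
    have "t ! (j - 1) \<in> set t" using that t(1) by (intro nth_mem) auto
    then show ?thesis using t(2) by metis
  qed
  have \<tau>F: "\<tau> (m, False) j (t ! (j - 1)) = sig j (Poly_Mapping.lookup m j) (t ! (j - 1))"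
    and \<tau>T: "\<tau> (m, True) j (t ! (j - 1)) =
      of_int (e j) ^ (t ! (j - 1)) * sig (?g' j) (Poly_Mapping.lookup m (?g' j)) (t ! (j - 1))"
    if "j \<in> {1..p}" for m j
    unfolding \<tau>_def fst_conv snd_conv using t0[OF that] that by (simp_all add: \<epsilon>_def)
  have "fcoeff t = (\<Sum>m\<in>?M. Poly_Mapping.lookup P m * (\<Prod>j=1..p. \<tau> (m, False) j (t ! (j - 1))))"
    using t \<tau>F by (auto simp: fcoeff_def intro!: sum.cong prod.cong arg_cong2[of _ _ _ _ "(*)"])
  moreover have "(\<Prod>i=1..p. of_int (e i) ^ (t ! (i - 1))) * fcoeff (perm_tuple p ?g' t) =
      (\<Sum>m\<in>?M. Poly_Mapping.lookup P m * (\<Prod>j=1..p. \<tau> (m, True) j (t ! (j - 1))))"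
  proof -
    let ?s = "perm_tuple p ?g' t"
    have nth: "?s ! (i - 1) = t ! (g i - 1)" if "i \<in> {1..p}" for i
      using that by (auto simp: perm_tuple_def permutes_inv_inv[OF eg(2)] simp del: upt_Suc)
    have len: "length ?s = p" by (simp add: perm_tuple_def)
    have "0 \<notin> set ?s"
    proof
      assume "0 \<in> set ?s"
      then obtain i where "i < p" "?s ! i = 0" using len by (auto simp: in_set_conv_nth)
      then have "t ! (g (Suc i) - 1) = 0" using nth[of "Suc i"] by simp
      moreover have "g (Suc i) \<in> {1..p}" using in_p(2)[of "Suc i"] \<open>i < p\<close> by simp
      ultimately show False using t0 by blast
    qed
    then have "fcoeff ?s = (\<Sum>m\<in>?M. Poly_Mapping.lookup P m *
        (\<Prod>i=1..p. sig i (Poly_Mapping.lookup m i) (t ! (g i - 1))))"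
      using len nth by (simp add: fcoeff_def)
    moreover have "(\<Prod>i=1..p. sig i (Poly_Mapping.lookup m i) (t ! (g i - 1))) =
        (\<Prod>j=1..p. sig (?g' j) (Poly_Mapping.lookup m (?g' j)) (t ! (j - 1)))" for m
      using prod.permute[OF g', of "\<lambda>i. sig i (Poly_Mapping.lookup m i) (t ! (g i - 1))"]
      by (simp add: comp_def gg)
    moreover have "(\<Prod>j=1..p. \<tau> (m, True) j (t ! (j - 1))) = (\<Prod>i=1..p. of_int (e i) ^ (t ! (i - 1))) *
        (\<Prod>j=1..p. sig (?g' j) (Poly_Mapping.lookup m (?g' j)) (t ! (j - 1)))" for m
      unfolding prod.distrib[symmetric] by (intro prod.cong refl \<tau>T)
    ultimately show ?thesis by (simp add: sum_distrib_left mult_ac)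
  qed
  ultimately show ?thesis using main by simp
qed

section \<open>The symmetric element and the representation of \<open>S\<close>\<close>

definition fvec :: fmzv where
  "fvec = Abs_poly_mapping fcoeff"

lemma lookup_fvec [simp]: "Poly_Mapping.lookup fvec s = fcoeff s"
proof -
  have "finite {s. fcoeff s \<noteq> 0}"
    by (rule finite_subset[OF _ finite_expo]) (use fcoeff_support(1) in auto)
  then show ?thesis by (simp add: fvec_def)
qed

lemma phi_fvec: "phi fvec = (\<Sum>s\<in>expo. fcoeff s * mzv s)"
  unfolding phi_def lookup_fvec
  by (rule sum.mono_neutral_left[OF finite_expo]) (use fcoeff_support(1) in \<open>auto simp: in_keys_iff\<close>)

lemma fvec_in_W': "fvec \<in> W'_space K p"
proof -
  have "length s = p \<and> 0 \<notin> set s \<and> 2 \<le> s ! 0" if "fcoeff s \<noteq> 0" for s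
  proof -
    have s: "length s = p" "adm separated (slots large_deg) s"
      using fcoeff_support[OF that] by (auto simp: expo_iff)
    then have "s \<noteq> []" using p1 by auto
    then show ?thesis using s by (auto simp: adm_def)
  qed
  then show ?thesis
    using fcoeff_in_K by (auto simp: W'_space_def W_space_def in_keys_iff)
qed

text \<open>Permuting tuples is inverted by the inverse permutation, so exactly one tuple is sent to
  \<open>t\<close>. The sign depends on the permuted tuple, that is on \<open>t\<close> itself,
  which matches \<open>fcoeff_equivariant\<close>.\<close>

lemma rho_tilde_fvec:
  assumes h: "(e, g) \<in> carrier (signed_perm_group p)"
    and rho: "rho p n r (e, g) (Fract P (ser_denom p A n r)) = scale_ratfun c (Fract P (ser_denom p A n r))"
  shows "rho_tilde p (e, g) fvec = scale_fmzv c fvec"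
proof (rule poly_mapping_eqI)
  fix t
  have g: "g permutes {1..p}" using h by (auto simp: signed_perm_group_def sym_group_carrier)
  let ?g' = "Hilbert_Choice.inv g"
  let ?w = "\<lambda>s. fcoeff s * of_int (\<Prod>i=1..p. e i ^ (perm_tuple p g s ! (i - 1)))"
  have scale: "Poly_Mapping.lookup (scale_fmzv c fvec) t = c * fcoeff t"
    by (simp add: scale_fmzv_def Poly_Mapping.map.rep_eq when_def)
  have look: "Poly_Mapping.lookup (rho_tilde p (e, g) fvec) t =
      (\<Sum>s\<in>Poly_Mapping.keys fvec. if perm_tuple p g s = t then ?w s else 0)"
    by (simp only: rho_tilde_def prod.case lookup_sum lookup_single when_def lookup_fvec)
  have len: "length s = p" if "s \<in> Poly_Mapping.keys fvec" for s
    using that fcoeff_support(1) by (auto simp: in_keys_iff expo_iff)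
  have perm_nth: "perm_tuple p f s ! (i - 1) = s ! (Hilbert_Choice.inv f i - 1)" if "i \<in> {1..p}" for f s i
    using that by (auto simp: perm_tuple_def simp del: upt_Suc)
  have inverse: "perm_tuple p (Hilbert_Choice.inv f) (perm_tuple p f s) = s"
    if f: "f permutes {1..p}" and s: "length s = p" for f s
  proof (rule nth_equalityI)
    show "length (perm_tuple p (Hilbert_Choice.inv f) (perm_tuple p f s)) = length s"
      using s by (simp add: perm_tuple_def)
    fix i assume "i < length (perm_tuple p (Hilbert_Choice.inv f) (perm_tuple p f s))"
    then have i: "Suc i \<in> {1..p}" by (simp add: perm_tuple_def del: upt_Suc)
    then have "f (Suc i) \<in> {1..p}" using permutes_in_image[OF f] by blast
    then show "perm_tuple p (Hilbert_Choice.inv f) (perm_tuple p f s) ! i = s ! i"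
      using perm_nth[OF i, of "Hilbert_Choice.inv f" "perm_tuple p f s"] perm_nth[of "f (Suc i)" f s]
      by (simp add: permutes_inv_inv[OF f] permutes_inverses[OF f])
  qed
  let ?s0 = "perm_tuple p ?g' t"
  show "Poly_Mapping.lookup (rho_tilde p (e, g) fvec) t = Poly_Mapping.lookup (scale_fmzv c fvec) t"
  proof (cases "length t = p")
    case False
    then have "perm_tuple p g s \<noteq> t" for s by (auto simp: perm_tuple_def)
    moreover have "fcoeff t = 0" using False by (simp add: fcoeff_def)
    ultimately show ?thesis unfolding look scale by simp
  next
    case True
    have round_trip: "perm_tuple p g ?s0 = t"
      using inverse[OF permutes_inv[OF g] True] by (simp add: permutes_inv_inv[OF g])
    have "perm_tuple p g s = t \<longleftrightarrow> s = ?s0" if "s \<in> Poly_Mapping.keys fvec" for s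
      using inverse[OF g len[OF that]] round_trip by metis
    then have "Poly_Mapping.lookup (rho_tilde p (e, g) fvec) t =
        (\<Sum>s\<in>Poly_Mapping.keys fvec. if s = ?s0 then ?w s else 0)"
      unfolding look by (intro sum.cong) auto
    also have "\<dots> = ?w ?s0" by (auto simp: sum.delta in_keys_iff)
    also have "\<dots> = (\<Prod>i=1..p. of_int (e i) ^ (t ! (i - 1))) * fcoeff ?s0"
      unfolding round_trip by simp
    also have "\<dots> = c * fcoeff t"
    proof (cases "0 \<in> set t")
      case False
      then show ?thesis by (intro fcoeff_equivariant h rho True)
    next
      \<comment> \<open>Tuples with an entry 0 are no basis symbols; permuting keeps the entry, so
        both coefficients are 0.\<close>
      case zero: True
      then obtain j where j: "j < p" "t ! j = 0" using True by (auto simp: in_set_conv_nth)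
      have "?g' (Suc j) \<in> {1..p}" using permutes_in_image[OF permutes_inv[OF g], of "Suc j"] j by simp
      then have "?s0 ! (?g' (Suc j) - 1) = 0"
        using perm_nth[of "?g' (Suc j)" ?g' t] j permutes_inverses[OF g] by (simp add: permutes_inv_inv[OF g])
      moreover have "?g' (Suc j) - 1 < length ?s0"
        using \<open>?g' (Suc j) \<in> {1..p}\<close> by (auto simp: perm_tuple_def)
      ultimately have "0 \<in> set ?s0" by (metis nth_mem)
      then show ?thesis using zero by (simp add: fcoeff_def)
    qed
    finally show ?thesis unfolding scale .
  qed
qed

lemma adm_imp_bounds:
  assumes "adm separated (slots large_deg) s"
  shows "s \<in> mzv_indices p"
    and "s \<noteq> [] \<Longrightarrow> block_bound p A s"
    and "s \<noteq> [] \<Longrightarrow> separated \<Longrightarrow> separated_bound p A n P s"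
  using adm_length[OF assms] assms adm_block_bound[OF assms] adm_separated_bound[of s]
  by (auto simp: mzv_indices_def adm_def)

lemma main_result:
  assumes S: "S = (\<Sum>\<^sub>\<infinity>k\<in>weak_chains p. ser_term (Fract P (ser_denom p A n r)) k)"
  shows "\<exists>lam. admissible_rep K p A n r P S lam \<and>
    (\<Sum>s | length s = p \<and> lam s \<noteq> 0. lam s * mzv s) = phi fvec"
proof -
  obtain l where l: "range l \<subseteq> K" "finite {s. l s \<noteq> 0}"
    "{s. l s \<noteq> 0} \<subseteq> lower_adms separated (slots large_deg)"
    "S - phi fvec = (\<Sum>s | l s \<noteq> 0. l s * mzv s)"
    using series_value(2) unfolding S phi_fvec zspan_def by auto
  \<comment> \<open>The two sources do not overlap: \<open>l\<close> is supported in depth less than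
    \<open>p\<close>, so the coefficients of depth \<open>p\<close> are exactly those of
    \<open>fvec\<close>.\<close>
  define lam where "lam s = (if length s = p then fcoeff s else l s)" for s
  have lp: "length s < p" if "l s \<noteq> 0" for s
    using l(3) that by (auto simp: lower_adms_def)
  have fp: "length s = p" if "fcoeff s \<noteq> 0" for s
    using fcoeff_support(1)[OF that] by (simp add: expo_iff)
  have supp: "{s. lam s \<noteq> 0} = {s. fcoeff s \<noteq> 0} \<union> {s. l s \<noteq> 0}"
    using lp fp by (auto simp: lam_def)
  have fin: "finite {s. fcoeff s \<noteq> 0}"
    by (rule finite_subset[OF _ finite_expo]) (use fcoeff_support(1) in auto)
  have phi: "phi fvec = (\<Sum>s | fcoeff s \<noteq> 0. fcoeff s * mzv s)"
    unfolding phi_fvec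
    by (rule sum.mono_neutral_right[OF finite_expo]) (use fcoeff_support(1) in auto)
  have "(\<Sum>s | lam s \<noteq> 0. lam s * mzv s) =
      (\<Sum>s | fcoeff s \<noteq> 0. lam s * mzv s) + (\<Sum>s | l s \<noteq> 0. lam s * mzv s)"
    unfolding supp by (rule sum.union_disjoint[OF fin l(2)]) (use lp fp in auto)
  also have "(\<Sum>s | fcoeff s \<noteq> 0. lam s * mzv s) = phi fvec"
    unfolding phi by (intro sum.cong) (auto simp: lam_def fp)
  also have "(\<Sum>s | l s \<noteq> 0. lam s * mzv s) = S - phi fvec"
    unfolding l(4) by (intro sum.cong) (auto simp: lam_def dest: lp)
  finally have sum: "S = (\<Sum>s | lam s \<noteq> 0. lam s * mzv s)" by simp
  have adm: "adm separated (slots large_deg) s" if "lam s \<noteq> 0" for s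
    using that l(3) fcoeff_support(2)[of s] unfolding lam_def lower_adms_def by (auto split: if_splits)
  have "admissible_rep K p A n r P S lam"
    unfolding admissible_rep_def
  proof (intro conjI allI impI)
    show "lam s \<in> K" for s using l(1) fcoeff_in_K by (auto simp: lam_def)
    show "finite {s. lam s \<noteq> 0}" unfolding supp using fin l(2) by simp
    show "{s. lam s \<noteq> 0} \<subseteq> mzv_indices p" using adm adm_imp_bounds(1) by blast
    show "S = (\<Sum>s | lam s \<noteq> 0. lam s * mzv s)" by (rule sum)
    fix s assume s: "lam s \<noteq> 0 \<and> s \<noteq> []"
    show "block_bound p A s" using adm_imp_bounds(2)[OF adm] s by blast
    assume "\<forall>i. 1 \<le> i \<and> i \<le> p - 1 \<longrightarrow> r (i + 1) + n (i + 1) + 1 \<le> r i"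
    then have separated by (simp add: separated_def)
    then show "separated_bound p A n P s" using adm_imp_bounds(3)[OF adm] s by blast
  qed
  moreover have "{s. length s = p \<and> lam s \<noteq> 0} = {s. fcoeff s \<noteq> 0}"
    using fp by (auto simp: lam_def)
  then have "(\<Sum>s | length s = p \<and> lam s \<noteq> 0. lam s * mzv s) = phi fvec"
    unfolding phi by (intro sum.cong) (auto simp: lam_def fp)
  ultimately show ?thesis by blast
qed

end

theorem theorem3p1:
  fixes K :: "complex set" and p :: nat and A n r :: "nat \<Rightarrow> nat"
    and P :: cpoly and R :: ratfun and S :: complex
    and H :: "((nat \<Rightarrow> int) \<times> (nat \<Rightarrow> nat)) set"
    and chi :: "(nat \<Rightarrow> int) \<times> (nat \<Rightarrow> nat) \<Rightarrow> complex"
  assumes "subfield K (ring_of_type_algebra :: complex ring)"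
    and "p \<ge> 1"
    and "P \<in> polys_over K p"
    and "\<forall>j\<in>{1..p}. (\<Sum>i=1..j. deg_in i P)
           \<le> ereal ((\<Sum>i=1..j. real (A i) * (real (n i) + 1)) - real j - 1)"
    and "R = Fract P (ser_denom p A n r)"
    and "S = (\<Sum>\<^sub>\<infinity>k\<in>weak_chains p. ser_term R k)"
    and "subgroup H (signed_perm_group p)"
    and "chi \<in> hom ((signed_perm_group p)\<lparr>carrier := H\<rparr>)
                (mult_of (ring_of_type_algebra :: complex ring))"
    and "\<forall>h\<in>H. rho p n r h R = scale_ratfun (chi h) R"
  shows "ser_term R summable_on weak_chains p \<and>
    (\<exists>lam x. admissible_rep K p A n r P S lam \<and>
       x \<in> W'_space K p \<and>
       (\<forall>h\<in>H. rho_tilde p h x = scale_fmzv (chi h) x) \<and>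
       (\<Sum>s | length s = p \<and> lam s \<noteq> 0. lam s * mzv s) = phi x)"
proof -
  interpret complex_subfield K by (rule complex_subfieldI) fact
  interpret mzv_series K p A n r P by unfold_locales fact+
  have carrier: "H \<subseteq> carrier (signed_perm_group p)" using assms(7) by (rule subgroup.subset)
  have "rho_tilde p h fvec = scale_fmzv (chi h) fvec" if "h \<in> H" for h
  proof -
    obtain e g where "h = (e, g)" by (cases h)
    then show ?thesis
      using rho_tilde_fvec[of e g "chi h"] assms(9) that carrier unfolding assms(5) by blast
  qed
  moreover obtain lam where "admissible_rep K p A n r P S lam"
    "(\<Sum>s | length s = p \<and> lam s \<noteq> 0. lam s * mzv s) = phi fvec"
    using main_result[of S] assms(6) unfolding assms(5) by blast
  ultimately show ?thesis
    using series_value(1) fvec_in_W' unfolding assms(5) by blast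
qed

end
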